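(* Let $\mathfrak g$ be a Lie algebra, $\mathcal F$ a singular foliation on $M$, $(E,Q)$ a universal Lie $\infty$-algebroid of $\mathcal F$ with anchor $\rho$, unary bracket $\ell_1$ and binary bracket $\ell_2$, and $\varrho\colon\mathfrak g\to\mathfrak X(M)$ a weak symmetry action of $\mathfrak g$ on $\mathcal F$, together with a map $\eta\colon\wedge^2\mathfrak g\to\Gamma(E_{-1})$ such that $\varrho([x,y]_{\mathfrak g})-[\varrho(x),\varrho(y)]=\rho(\eta(x,y))$ for all $x,y\in\mathfrak g$. Let $\ell_2'$ be the binary bracket of an associated Lie $\infty$-algebroid $(E',Q')$ (see context). Let $m\in M$ be a fixed point of the $\mathfrak g$-action $\varrho$, i.e. $\varrho(x)_{|_m}=0$ for all $x\in\mathfrak g$. Assume that the underlying complex $(E,\ell_1)$ of $(E,Q)$ is minimal at $m$, i.e. $\ell_{1|_m}=0$, and that for all $x,y\in\mathfrak g$ the element $\eta(x,y)_{|_m}$ is valued in the center $Z(\mathfrak g_m)$ of the isotropy Lie algebra $\mathfrak g_m$ of $\mathcal F$ at $m$. Then: (1) For every $x\in\mathfrak g[1]$, $\ell_2'(x,\cdot)$ (evaluated at $m$) preserves $Z(\mathfrak g_m)$, and the restriction of the $2$-ary bracket $\ell_2'\colon\mathfrak g\otimes Z(\mathfrak g_m)\to Z(\mathfrak g_m)$ endows $Z(\mathfrak g_m)$ with a $\mathfrak g$-module structure which depends neither on the choice of a weak symmetry action $\varrho$, nor of a universal Lie $\infty$-algebroid of $\mathcal F$, nor of the Lie $\infty$-morphism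 $\Phi\colon\mathfrak g[1]\rightsquigarrow\mathfrak X(E)[1]$ lifting $\varrho$. (2) The restriction of $\eta$ at $m$, $\eta_{|_m}\colon\wedge^2\mathfrak g\to Z(\mathfrak g_m)$, is a $2$-cocycle for the Chevalley–Eilenberg complex of $\mathfrak g$ valued in $Z(\mathfrak g_m)$. (3) The cohomology class of this cocycle does not depend on the representatives of the equivalence class of $\varrho$, nor on the choices made in the construction. (4) If $\varrho$ is equivalent to a strict symmetry action, then $\eta_{|_m}$ is exact.
   Context: $M$ is a smooth or complex manifold or an affine variety over $\mathbb C$, $\mathcal O$ its functions, $\mathfrak X(M)$ its vector fields. A singular foliation $\mathcal F\subset\mathfrak X(M)$ is a locally finitely generated $\mathcal O$-submodule closed under Lie bracket. A weak symmetry action of $\mathfrak g$ on $\mathcal F$ is a linear map $\varrho\colon\mathfrak g\to\mathfrak X(M)$ with $[\varrho(x),\mathcal F]\subseteq\mathcal F$ and $\varrho([x,y]_{\mathfrak g})-[\varrho(x),\varrho(y)]\in\mathcal F$ for all $x,y\in\mathfrak g$; it is a strict symmetry action if moreover $\varrho$ is a Lie algebra morphism. Two weak symmetry actions $\varrho,\varrho'\colon\mathfrak g\to\mathfrak X(M)$ of $\mathfrak g$ on $\mathcal F$ are equivalent if there exists a linear map $\varphi\colon\mathfrak g\to\mathcal F$ such that $\varrho-\varrho'=\varphi$. A Lie $\infty$-algebroid over $M$ is a sequence of vector bundles $E=(E_{-i})_{i\ge1}$ with a Lie $\infty$-algebra structure on sections (graded symmetric brackets $\ell_k$ of degree $+1$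 satisfying the higher Jacobi identities) and an anchor $\rho\colon E_{-1}\to TM$, such that $\ell_k$ is $\mathcal O$-multilinear for $k\ne2$ and $\ell_2(e_1,fe_2)=\rho(e_1)[f]e_2+f\ell_2(e_1,e_2)$ for $e_1\in\Gamma(E_{-1})$, $e_2\in \Gamma(E)$, $f\in\mathcal O$. Equivalently it is given by a degree $+1$ derivation $Q$ of $\Gamma(S^\bullet(E^* ))$ with $[Q,Q]=0$. It is a universal Lie $\infty$-algebroid of $\mathcal F$ if $\cdots\to\Gamma(E_{-2})\xrightarrow{\ell_1}\Gamma(E_{-1})\xrightarrow{\rho}\mathcal F\to0$ is exact. $\mathfrak X_\bullet(E)$ denotes the graded Lie algebra of graded derivations of $\Gamma(S^\bullet(E^* ))$, with differential $\mathrm{ad}_Q=[Q,\cdot\,]$. A Lie $\infty$-morphism $\Phi\colon\mathfrak g[1]\rightsquigarrow(\mathfrak X_\bullet(E)[1],[\cdot,\cdot],\mathrm{ad}_Q)$ lifts $\varrho$ if its $0$-th Taylor coefficient satisfies $\Phi_0(x)(f)=\varrho(x)[f]$ for all $x\in\mathfrak g$, $f\in\mathcal O$. The isotropy Lie algebra of $\mathcal F$ at $m$ is $\mathfrak g_m=\mathcal F(m)/\mathcal I_m\mathcal F$, where $\mathcal F(m)=\{X\in\mathcal F: X(m)=0\}$ and $\mathcal I_m$ is the ideal of functions vanishing at $m$. When $(E,\ell_1)$ is minimal at $m$, $\mathfrak g_m$ is identified with $\ker(\rho_m\colon E_{-1|_m}\to T_mM)$ with Lie bracket induced by $\ell_2$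 at $m$. $(E',Q')$ is a Lie $\infty$-algebroid, possibly of infinite rank if $\mathfrak g$ is infinite dimensional (such structures always exist and, for finite dimensional $\mathfrak g$, correspond to Lie $\infty$-morphisms $\mathfrak g[1]\rightsquigarrow(\mathfrak X_\bullet(E)[1],[\cdot,\cdot],\mathrm{ad}_Q)$ lifting $\varrho$), such that: $E'_{-1}=\mathfrak g[1]\oplus E_{-1}$ ($\mathfrak g[1]$ being the trivial bundle) and $E'_{-i}=E_{-i}$ for $i\ge2$, with the unary bracket $\ell_1$; it contains $(E,Q)$ as a sub-Lie $\infty$-algebroid; its anchor is $\rho'(x\oplus e)=\varrho(x)+\rho(e)$; for constant sections $x,y$ of $\mathfrak g[1]$ one has $\ell_2'(x\oplus0,y\oplus0)=[x,y]_{\mathfrak g}\oplus\eta(x,y)$ and $\ell_2'(x,\Gamma(E_{-1}))\subset\Gamma(E_{-1})$. Since $\varrho(x)_{|_m}=0$, $e_{|_m}\mapsto\ell_2'(x,e)_{|_m}$ is a well-defined endomorphism of $\mathfrak g_m=\ker\rho_m$.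
   Formalization: In (1) independence of ϱ is stated within the equivalence class of ϱ; in (3) and (4) "equivalent" means ϱ−ϱ'=φ with each φ(x) vanishing at m and of class in Z(g_m). Without these restrictions the claims are false, e.g. when g_m is the Heisenberg algebra. *)

theory Defs
  imports "HOL-Analysis.Analysis" "HOL-Library.Function_Algebras"
begin

section \<open>The base\<close>

text \<open>
  A base is a set of points with a topology and a sheaf of \<^typ>\<open>'k\<close>-valued functions, where
  \<^typ>\<open>'k\<close> is a \<^class>\<open>real_normed_field\<close>, that is, by the Gelfand-Mazur theorem, a copy of the
  real or of the complex numbers. The sheaf is needed because a complex manifold may have
  very few global functions.

  Throughout, a function or section over an open set \<open>U\<close> is a total function that vanishes
  outside \<open>U\<close>, so that the pointwise operations of \<open>Function_Algebras\<close> are the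
  operations on sections over \<open>U\<close>.
\<close>

record ('m, 'k) base =
  mtop :: "'m topology"
  funs :: "'m set \<Rightarrow> ('m \<Rightarrow> 'k) set"

abbreviation pts :: "('m, 'k, 'z) base_scheme \<Rightarrow> 'm set"
  where "pts M \<equiv> topspace (mtop M)"

abbreviation opn :: "('m, 'k, 'z) base_scheme \<Rightarrow> 'm set \<Rightarrow> bool"
  where "opn M U \<equiv> openin (mtop M) U"

definition res :: "'m set \<Rightarrow> ('m \<Rightarrow> 'a::zero) \<Rightarrow> 'm \<Rightarrow> 'a"
  where "res U s = (\<lambda>p. if p \<in> U then s p else 0)"

text \<open>Sheaves of functions with values in some type, as above vanishing outside their domain.\<close>

definition section_sheaf :: "('m, 'k) base \<Rightarrow> ('m set \<Rightarrow> ('m \<Rightarrow> 'a::zero) set) \<Rightarrow> bool"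
  where "section_sheaf M \<Gamma> \<longleftrightarrow>
    (\<forall>U s. opn M U \<and> s \<in> \<Gamma> U \<longrightarrow> (\<forall>p. p \<notin> U \<longrightarrow> s p = 0)) \<and>
    (\<forall>U W s. opn M U \<and> opn M W \<and> W \<subseteq> U \<and> s \<in> \<Gamma> U \<longrightarrow> res W s \<in> \<Gamma> W) \<and>
    (\<forall>U s. opn M U \<and> (\<forall>p. p \<notin> U \<longrightarrow> s p = 0) \<and>
       (\<forall>p\<in>U. \<exists>W. opn M W \<and> p \<in> W \<and> W \<subseteq> U \<and> res W s \<in> \<Gamma> W) \<longrightarrow> s \<in> \<Gamma> U)"

definition function_sheaf :: "('m, 'k::real_normed_field) base \<Rightarrow> bool"
  where "function_sheaf M \<longleftrightarrow> section_sheaf M (funs M) \<and>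
    (\<forall>U. opn M U \<longrightarrow>
       (\<forall>c. res U (\<lambda>_. c) \<in> funs M U) \<and>
       (\<forall>f\<in>funs M U. \<forall>h\<in>funs M U. f + h \<in> funs M U \<and> f * h \<in> funs M U))"

subsection \<open>Smooth and complex manifolds\<close>

text \<open>
  \<^typ>\<open>'k\<close>-affine \<open>n\<close>-space is the set of sequences vanishing from index \<open>n\<close> on.
  Functions all of whose iterated partial derivatives over \<^typ>\<open>'k\<close> exist and are continuous are
  the smooth functions if \<^typ>\<open>'k\<close> is real and the holomorphic functions if \<^typ>\<open>'k\<close> is complex.
\<close>

definition Kspace :: "nat \<Rightarrow> (nat \<Rightarrow> 'k::zero) set"
  where "Kspace n = {x. \<forall>i\<ge>n. x i = 0}"

primrec Ck :: "nat \<Rightarrow> nat \<Rightarrow> (nat \<Rightarrow> 'k::real_normed_field) set \<Rightarrow> ((nat \<Rightarrow> 'k) \<Rightarrow> 'k) \<Rightarrow> bool"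
  where
    "Ck n 0 V f \<longleftrightarrow> continuous_on V f"
  | "Ck n (Suc k) V f \<longleftrightarrow> continuous_on V f \<and>
       (\<exists>D. \<forall>i<n. (\<forall>x\<in>V. ((\<lambda>t. f (x(i := t))) has_field_derivative D i x) (at (x i))) \<and>
                  Ck n k V (D i))"

definition Kmanifold :: "('m, 'k::real_normed_field) base \<Rightarrow> bool"
  where "Kmanifold M \<longleftrightarrow> Hausdorff_space (mtop M) \<and> second_countable (mtop M) \<and>
    (\<exists>n. \<forall>p\<in>pts M. \<exists>U \<phi> V. opn M U \<and> p \<in> U \<and>
       openin (top_of_set (Kspace n)) V \<and>
       homeomorphic_map (subtopology (mtop M) U) (top_of_set V) \<phi> \<and>
       (\<forall>W. opn M W \<and> W \<subseteq> U \<longrightarrow>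
          funs M W = {f. (\<forall>q. q \<notin> W \<longrightarrow> f q = 0) \<and> (\<forall>k. Ck n k (\<phi> ` W) (f \<circ> inv_into U \<phi>))}))"

subsection \<open>Affine varieties over the complex numbers\<close>

inductive_set polyfun :: "nat \<Rightarrow> ((nat \<Rightarrow> 'k::comm_ring_1) \<Rightarrow> 'k) set" for n
  where
    const: "(\<lambda>_. c) \<in> polyfun n"
  | coord: "i < n \<Longrightarrow> (\<lambda>x. x i) \<in> polyfun n"
  | add: "P \<in> polyfun n \<Longrightarrow> Q \<in> polyfun n \<Longrightarrow> (\<lambda>x. P x + Q x) \<in> polyfun n"
  | mult: "P \<in> polyfun n \<Longrightarrow> Q \<in> polyfun n \<Longrightarrow> (\<lambda>x. P x * Q x) \<in> polyfun n"

definition zero_locus :: "nat \<Rightarrow> ((nat \<Rightarrow> 'k) \<Rightarrow> 'k) set \<Rightarrow> (nat \<Rightarrow> 'k::zero) set"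
  where "zero_locus n S = {x \<in> Kspace n. \<forall>P\<in>S. P x = 0}"

text \<open>
  The first conjunct forces \<^typ>\<open>'k\<close> to be a copy of the complex numbers. The topology is the
  Zariski topology and the functions are the regular functions.
\<close>

definition affine_variety :: "('m, 'k::real_normed_field) base \<Rightarrow> bool"
  where "affine_variety M \<longleftrightarrow> (\<exists>i::'k. i * i = - 1) \<and>
    (\<exists>n S \<phi>. S \<subseteq> polyfun n \<and> bij_betw \<phi> (pts M) (zero_locus n S) \<and>
       (\<forall>U. opn M U \<longleftrightarrow> U \<subseteq> pts M \<and>
          (\<exists>S'. S' \<subseteq> polyfun n \<and> \<phi> ` U = zero_locus n S - zero_locus n S')) \<and>
       (\<forall>U. opn M U \<longrightarrow> funs M U =
          {f. (\<forall>q. q \<notin> U \<longrightarrow> f q = 0) \<and>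
              (\<forall>p\<in>U. \<exists>W P Q. opn M W \<and> p \<in> W \<and> W \<subseteq> U \<and> P \<in> polyfun n \<and> Q \<in> polyfun n \<and>
                 (\<forall>q\<in>W. Q (\<phi> q) \<noteq> 0 \<and> f q = P (\<phi> q) / Q (\<phi> q)))}))"

definition base_space :: "('m, 'k::real_normed_field) base \<Rightarrow> bool"
  where "base_space M \<longleftrightarrow> function_sheaf M \<and> (Kmanifold M \<or> affine_variety M)"


section \<open>Vector fields and singular foliations\<close>

text \<open>
  A vector field over \<open>U\<close> is a derivation of the sheaf of functions on \<open>U\<close>: for each
  open \<open>W \<subseteq> U\<close> a derivation of \<open>funs M W\<close>, compatibly with restrictions.
  It takes the value \<open>0\<close> at all other arguments.
\<close>

type_synonym ('m, 'k) vfield = "'m set \<Rightarrow> ('m \<Rightarrow> 'k) \<Rightarrow> ('m \<Rightarrow> 'k)"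

definition vfields :: "('m, 'k::real_normed_field) base \<Rightarrow> 'm set \<Rightarrow> ('m, 'k) vfield set"
  where "vfields M U = {X.
    (\<forall>W f. \<not> (opn M W \<and> W \<subseteq> U \<and> f \<in> funs M W) \<longrightarrow> X W f = 0) \<and>
    (\<forall>W. opn M W \<and> W \<subseteq> U \<longrightarrow>
       (\<forall>f\<in>funs M W. X W f \<in> funs M W) \<and>
       (\<forall>f\<in>funs M W. \<forall>h\<in>funs M W.
          X W (f + h) = X W f + X W h \<and> X W (f * h) = X W f * h + f * X W h) \<and>
       (\<forall>c. \<forall>f\<in>funs M W. X W (\<lambda>p. c * f p) = (\<lambda>p. c * X W f p)) \<and>
       (\<forall>V. \<forall>f\<in>funs M W. opn M V \<and> V \<subseteq> W \<longrightarrow> X V (res V f) = res V (X W f)))}"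

definition vres :: "'m set \<Rightarrow> ('m, 'k::zero) vfield \<Rightarrow> ('m, 'k) vfield"
  where "vres U X = (\<lambda>W f. if W \<subseteq> U then X W f else 0)"

definition vsmult :: "('m \<Rightarrow> 'k::times) \<Rightarrow> ('m, 'k) vfield \<Rightarrow> ('m, 'k) vfield"
  where "vsmult f X = (\<lambda>W h. f * X W h)"

definition vscale :: "'k::times \<Rightarrow> ('m, 'k) vfield \<Rightarrow> ('m, 'k) vfield"
  where "vscale c = vsmult (\<lambda>_. c)"

definition vbracket :: "('m, 'k::real_normed_field) vfield \<Rightarrow> ('m, 'k) vfield \<Rightarrow> ('m, 'k) vfield"
  where "vbracket X Y = (\<lambda>W f. X W (Y W f) - Y W (X W f))"

text \<open>\<open>X\<close> vanishes at \<open>m\<close> as a tangent vector, for \<open>X\<close> defined near \<open>m\<close>.\<close>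

definition vanishes_at :: "'m \<Rightarrow> ('m, 'k::zero) vfield \<Rightarrow> bool"
  where "vanishes_at m X \<longleftrightarrow> (\<forall>W f. X W f m = 0)"

text \<open>
  A singular foliation, as a subsheaf of modules of the sheaf of vector fields: closed under
  the module operations and restriction, determined locally, locally finitely
  generated, and involutive.
\<close>

definition singular_foliation ::
    "('m, 'k::real_normed_field) base \<Rightarrow> ('m set \<Rightarrow> ('m, 'k) vfield set) \<Rightarrow> bool"
  where "singular_foliation M F \<longleftrightarrow>
    (\<forall>U. opn M U \<longrightarrow> F U \<subseteq> vfields M U \<and> 0 \<in> F U \<and>
       (\<forall>X\<in>F U. \<forall>Y\<in>F U. X + Y \<in> F U) \<and>
       (\<forall>f\<in>funs M U. \<forall>X\<in>F U. vsmult f X \<in> F U)) \<and>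
    (\<forall>U W. opn M U \<and> opn M W \<and> W \<subseteq> U \<longrightarrow> (\<forall>X\<in>F U. vres W X \<in> F W)) \<and>
    (\<forall>U. \<forall>X\<in>vfields M U. opn M U \<and>
       (\<forall>p\<in>U. \<exists>W. opn M W \<and> p \<in> W \<and> W \<subseteq> U \<and> vres W X \<in> F W) \<longrightarrow> X \<in> F U) \<and>
    (\<forall>p\<in>pts M. \<exists>U n G. opn M U \<and> p \<in> U \<and> (\<forall>i<n. G i \<in> F U) \<and>
       (\<forall>W X. opn M W \<and> W \<subseteq> U \<and> X \<in> F W \<longrightarrow>
          (\<forall>q\<in>W. \<exists>V f. opn M V \<and> q \<in> V \<and> V \<subseteq> W \<and> (\<forall>i<n::nat. f i \<in> funs M V) \<and>
             vres V X = (\<Sum>i<n. vsmult (f i) (vres V (G i)))))) \<and>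
    (\<forall>U. opn M U \<longrightarrow> (\<forall>X\<in>F U. \<forall>Y\<in>F U. vbracket X Y \<in> F U))"


section \<open>Lie algebras and symmetry actions\<close>

record ('k, 'g) lie_alg =
  lscale :: "'k \<Rightarrow> 'g \<Rightarrow> 'g"
  lbr :: "'g \<Rightarrow> 'g \<Rightarrow> 'g"

definition lie_algebra :: "('k::field, 'g::ab_group_add) lie_alg \<Rightarrow> bool"
  where "lie_algebra g \<longleftrightarrow> vector_space (lscale g) \<and>
    (\<forall>x. Vector_Spaces.linear (lscale g) (lscale g) (lbr g x)) \<and>
    (\<forall>y. Vector_Spaces.linear (lscale g) (lscale g) (\<lambda>x. lbr g x y)) \<and>
    (\<forall>x. lbr g x x = 0) \<and>
    (\<forall>x y z. lbr g x (lbr g y z) + lbr g y (lbr g z x) + lbr g z (lbr g x y) = 0)"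

definition weak_symmetry_action ::
    "('m, 'k::real_normed_field) base \<Rightarrow> ('m set \<Rightarrow> ('m, 'k) vfield set) \<Rightarrow>
     ('k, 'g::ab_group_add) lie_alg \<Rightarrow> ('g \<Rightarrow> ('m, 'k) vfield) \<Rightarrow> bool"
  where "weak_symmetry_action M F g \<rho> \<longleftrightarrow>
    Vector_Spaces.linear (lscale g) vscale \<rho> \<and> (\<forall>x. \<rho> x \<in> vfields M (pts M)) \<and>
    (\<forall>x U. opn M U \<longrightarrow> (\<forall>X\<in>F U. vbracket (vres U (\<rho> x)) X \<in> F U)) \<and>
    (\<forall>x y. \<rho> (lbr g x y) - vbracket (\<rho> x) (\<rho> y) \<in> F (pts M))"

definition strict_symmetry_action ::
    "('m, 'k::real_normed_field) base \<Rightarrow> ('m set \<Rightarrow> ('m, 'k) vfield set) \<Rightarrow>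
     ('k, 'g::ab_group_add) lie_alg \<Rightarrow> ('g \<Rightarrow> ('m, 'k) vfield) \<Rightarrow> bool"
  where "strict_symmetry_action M F g \<rho> \<longleftrightarrow> weak_symmetry_action M F g \<rho> \<and>
    (\<forall>x y. \<rho> (lbr g x y) = vbracket (\<rho> x) (\<rho> y))"

definition equivalent_via ::
    "('m, 'k::real_normed_field) base \<Rightarrow> ('m set \<Rightarrow> ('m, 'k) vfield set) \<Rightarrow>
     ('k, 'g::ab_group_add) lie_alg \<Rightarrow> ('g \<Rightarrow> ('m, 'k) vfield) \<Rightarrow>
     ('g \<Rightarrow> ('m, 'k) vfield) \<Rightarrow> ('g \<Rightarrow> ('m, 'k) vfield) \<Rightarrow> bool"
  where "equivalent_via M F g \<phi> \<rho> \<rho>' \<longleftrightarrow>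
    Vector_Spaces.linear (lscale g) vscale \<phi> \<and> (\<forall>x. \<phi> x \<in> F (pts M)) \<and>
    (\<forall>x. \<rho> x - \<rho>' x = \<phi> x)"

definition equivalent_actions ::
    "('m, 'k::real_normed_field) base \<Rightarrow> ('m set \<Rightarrow> ('m, 'k) vfield set) \<Rightarrow>
     ('k, 'g::ab_group_add) lie_alg \<Rightarrow> ('g \<Rightarrow> ('m, 'k) vfield) \<Rightarrow>
     ('g \<Rightarrow> ('m, 'k) vfield) \<Rightarrow> bool"
  where "equivalent_actions M F g \<rho> \<rho>' \<longleftrightarrow> (\<exists>\<phi>. equivalent_via M F g \<phi> \<rho> \<rho>')"


section \<open>Lie infinity-algebroids\<close>

text \<open>
  Index \<open>i\<close> stands for degree \<open>-i\<close>. The fibres \<open>fib A i p\<close> are subsets of a common type \<^typ>\<open>'v\<close>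
  with scalar multiplication \<open>scl A\<close>, and \<open>sec A i U\<close> is the set of sections
  over \<open>U\<close>. The \<open>k\<close>-ary bracket over \<open>U\<close> takes a list of \<open>k\<close> homogeneous
  sections, each paired with its index; since brackets have degree \<open>+1\<close>, the result has
  index (sum of the indices) \<open>- 1\<close>. There is nothing but \<open>0\<close> in degree \<open>0\<close>.
\<close>

record ('m, 'k, 'v) algebroid =
  scl :: "'k \<Rightarrow> 'v \<Rightarrow> 'v"
  fib :: "nat \<Rightarrow> 'm \<Rightarrow> 'v set"
  sec :: "nat \<Rightarrow> 'm set \<Rightarrow> ('m \<Rightarrow> 'v) set"
  anch :: "'m set \<Rightarrow> ('m \<Rightarrow> 'v) \<Rightarrow> ('m, 'k) vfield"
  brk :: "'m set \<Rightarrow> (nat \<times> ('m \<Rightarrow> 'v)) list \<Rightarrow> ('m \<Rightarrow> 'v)"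

definition smul :: "('k \<Rightarrow> 'v \<Rightarrow> 'v) \<Rightarrow> ('m \<Rightarrow> 'k) \<Rightarrow> ('m \<Rightarrow> 'v) \<Rightarrow> ('m \<Rightarrow> 'v)"
  where "smul s f \<sigma> = (\<lambda>p. s (f p) (\<sigma> p))"

text \<open>A vector bundle of finite rank: fibres, and a sheaf of sections with local frames.\<close>

definition vector_bundle ::
    "('m, 'k::real_normed_field) base \<Rightarrow> ('k \<Rightarrow> 'v::ab_group_add \<Rightarrow> 'v) \<Rightarrow>
     ('m \<Rightarrow> 'v set) \<Rightarrow> ('m set \<Rightarrow> ('m \<Rightarrow> 'v) set) \<Rightarrow> bool"
  where "vector_bundle M s E \<Gamma> \<longleftrightarrow> vector_space s \<and> section_sheaf M \<Gamma> \<and>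
    (\<forall>p\<in>pts M. module.subspace s (E p)) \<and>
    (\<forall>p\<in>pts M. \<exists>U r b. opn M U \<and> p \<in> U \<and>
       (\<forall>q\<in>U. E q = {\<Sum>i<r. s (c i) (b i q) | c. True} \<and>
          (\<forall>c. (\<Sum>i<r. s (c i) (b i q)) = 0 \<longrightarrow> (\<forall>i<r. c i = 0))) \<and>
       (\<forall>W. opn M W \<and> W \<subseteq> U \<longrightarrow>
          \<Gamma> W = {\<Sum>i<r::nat. smul s (f i) (b i) | f. \<forall>i<r. f i \<in> funs M W}))"

text \<open>
  Koszul sign of the unshuffle which moves the arguments with positions in \<open>S\<close> to the front.
\<close>

definition koszul :: "nat list \<Rightarrow> nat set \<Rightarrow> 'k::comm_ring_1"
  where "koszul d S =
    (- 1) ^ (\<Sum>(a, b) \<in> {(a, b). a < b \<and> b < length d \<and> a \<notin> S \<and> b \<in> S}. d ! a * d ! b)"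

definition homogeneous_args ::
    "('m, 'k, 'v) algebroid \<Rightarrow> 'm set \<Rightarrow> (nat \<times> ('m \<Rightarrow> 'v)) list \<Rightarrow> bool"
  where "homogeneous_args A U as \<longleftrightarrow> as \<noteq> [] \<and> (\<forall>(i, \<sigma>) \<in> set as. \<sigma> \<in> sec A i U)"

text \<open>
  The conjuncts after the first line: the anchor is a morphism of sheaves of modules; degree of
  the brackets and compatibility with restrictions; additivity; graded symmetry; linearity
  over functions except for the binary bracket; the Leibniz rule (with the anchor extended
  by zero to indices other than \<open>1\<close>); the higher Jacobi identities. Homogeneity over the constants is the case of a
  constant function in the linearity and Leibniz rules. No finiteness of ranks is required.
\<close>

definition lie_infinity_structure ::
    "('m, 'k::real_normed_field) base \<Rightarrow> ('m, 'k, 'v::ab_group_add) algebroid \<Rightarrow> bool"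
  where "lie_infinity_structure M A \<longleftrightarrow>
    vector_space (scl A) \<and> (\<forall>U. opn M U \<longrightarrow> sec A 0 U = {0}) \<and>
    (\<forall>U. opn M U \<longrightarrow>
       (\<forall>\<sigma>\<in>sec A 1 U. anch A U \<sigma> \<in> vfields M U \<and>
          (\<forall>\<tau>\<in>sec A 1 U. anch A U (\<sigma> + \<tau>) = anch A U \<sigma> + anch A U \<tau>) \<and>
          (\<forall>f\<in>funs M U. anch A U (smul (scl A) f \<sigma>) = vsmult f (anch A U \<sigma>)) \<and>
          (\<forall>W. opn M W \<and> W \<subseteq> U \<longrightarrow> anch A W (res W \<sigma>) = vres W (anch A U \<sigma>)))) \<and>
    (\<forall>U as. opn M U \<and> homogeneous_args A U as \<longrightarrow>
       brk A U as \<in> sec A (sum_list (map fst as) - 1) U \<and>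
       (\<forall>W. opn M W \<and> W \<subseteq> U \<longrightarrow> res W (brk A U as) = brk A W (map (map_prod id (res W)) as))) \<and>
    (\<forall>U as bs i \<sigma> \<tau>. opn M U \<and>
       homogeneous_args A U (as @ (i, \<sigma>) # bs) \<and> homogeneous_args A U (as @ (i, \<tau>) # bs) \<longrightarrow>
       brk A U (as @ (i, \<sigma> + \<tau>) # bs) = brk A U (as @ (i, \<sigma>) # bs) + brk A U (as @ (i, \<tau>) # bs)) \<and>
    (\<forall>U as bs i j \<sigma> \<tau>. opn M U \<and> homogeneous_args A U (as @ (i, \<sigma>) # (j, \<tau>) # bs) \<longrightarrow>
       brk A U (as @ (i, \<sigma>) # (j, \<tau>) # bs) =
         smul (scl A) (\<lambda>_. (- 1) ^ (i * j)) (brk A U (as @ (j, \<tau>) # (i, \<sigma>) # bs))) \<and>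
    (\<forall>U as bs i \<sigma>. \<forall>f\<in>funs M U. opn M U \<and> homogeneous_args A U (as @ (i, \<sigma>) # bs) \<and>
       length (as @ (i, \<sigma>) # bs) \<noteq> 2 \<longrightarrow>
       brk A U (as @ (i, smul (scl A) f \<sigma>) # bs) = smul (scl A) f (brk A U (as @ (i, \<sigma>) # bs))) \<and>
    (\<forall>U i j \<sigma> \<tau>. \<forall>f\<in>funs M U. opn M U \<and> homogeneous_args A U [(i, \<sigma>), (j, \<tau>)] \<longrightarrow>
       brk A U [(i, \<sigma>), (j, smul (scl A) f \<tau>)] =
         (if i = 1 then smul (scl A) (anch A U \<sigma> U f) \<tau> else 0) +
         smul (scl A) f (brk A U [(i, \<sigma>), (j, \<tau>)])) \<and>
    (\<forall>U as. opn M U \<and> homogeneous_args A U as \<longrightarrow>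
       (\<Sum>S \<in> Pow {..<length as} - {{}}.
          smul (scl A) (\<lambda>_. koszul (map fst as) S)
            (brk A U ((sum_list (map fst (nths as S)) - 1, brk A U (nths as S)) # nths as (- S)))) = 0)"

definition lie_infinity_algebroid ::
    "('m, 'k::real_normed_field) base \<Rightarrow> ('m, 'k, 'v::ab_group_add) algebroid \<Rightarrow> bool"
  where "lie_infinity_algebroid M A \<longleftrightarrow> lie_infinity_structure M A \<and>
    (\<forall>i\<ge>1. vector_bundle M (scl A) (fib A i) (sec A i))"

text \<open>Exactness of \<open>\<dots> \<rightarrow> E\<^sub>-\<^sub>2 \<rightarrow> E\<^sub>-\<^sub>1 \<rightarrow> F \<rightarrow> 0\<close> as a sequence of sheaves.\<close>

definition universal_algebroid ::
    "('m, 'k::real_normed_field) base \<Rightarrow> ('m set \<Rightarrow> ('m, 'k) vfield set) \<Rightarrow>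
     ('m, 'k, 'v::ab_group_add) algebroid \<Rightarrow> bool"
  where "universal_algebroid M F A \<longleftrightarrow> lie_infinity_algebroid M A \<and>
    (\<forall>U. opn M U \<longrightarrow>
       (\<forall>\<sigma>\<in>sec A 1 U. anch A U \<sigma> \<in> F U) \<and>
       (\<forall>X\<in>F U. \<forall>p\<in>U. \<exists>W. opn M W \<and> p \<in> W \<and> W \<subseteq> U \<and> (\<exists>\<sigma>\<in>sec A 1 W. anch A W \<sigma> = vres W X)) \<and>
       (\<forall>\<sigma>\<in>sec A 1 U. anch A U \<sigma> = 0 \<longleftrightarrow>
          (\<forall>p\<in>U. \<exists>W. opn M W \<and> p \<in> W \<and> W \<subseteq> U \<and> (\<exists>\<tau>\<in>sec A 2 W. brk A W [(2, \<tau>)] = res W \<sigma>))) \<and>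
       (\<forall>i\<ge>2. \<forall>\<sigma>\<in>sec A i U. brk A U [(i, \<sigma>)] = 0 \<longleftrightarrow>
          (\<forall>p\<in>U. \<exists>W. opn M W \<and> p \<in> W \<and> W \<subseteq> U \<and>
             (\<exists>\<tau>\<in>sec A (i + 1) W. brk A W [(i + 1, \<tau>)] = res W \<sigma>))))"

definition minimal_at ::
    "('m, 'k::real_normed_field) base \<Rightarrow> 'm \<Rightarrow> ('m, 'k, 'v::ab_group_add) algebroid \<Rightarrow> bool"
  where "minimal_at M m A \<longleftrightarrow>
    (\<forall>i\<ge>2. \<forall>U. opn M U \<and> m \<in> U \<longrightarrow> (\<forall>\<sigma>\<in>sec A i U. brk A U [(i, \<sigma>)] m = 0))"

text \<open>The map \<open>\<eta>\<close>, a linear map on the second exterior power given as an alternating bilinear map.\<close>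

definition curvature_lift ::
    "('m, 'k::real_normed_field) base \<Rightarrow> ('k, 'g::ab_group_add) lie_alg \<Rightarrow>
     ('m, 'k, 'v::ab_group_add) algebroid \<Rightarrow> ('g \<Rightarrow> ('m, 'k) vfield) \<Rightarrow> ('g \<Rightarrow> 'g \<Rightarrow> 'm \<Rightarrow> 'v) \<Rightarrow> bool"
  where "curvature_lift M g A \<rho> \<eta> \<longleftrightarrow>
    (\<forall>x y. \<eta> x y \<in> sec A 1 (pts M)) \<and>
    (\<forall>x. Vector_Spaces.linear (lscale g) (\<lambda>c. smul (scl A) (\<lambda>_. c)) (\<eta> x)) \<and>
    (\<forall>y. Vector_Spaces.linear (lscale g) (\<lambda>c. smul (scl A) (\<lambda>_. c)) (\<lambda>x. \<eta> x y)) \<and>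
    (\<forall>x. \<eta> x x = 0) \<and>
    (\<forall>x y. \<rho> (lbr g x y) - vbracket (\<rho> x) (\<rho> y) = anch A (pts M) (\<eta> x y))"

subsection \<open>The associated Lie infinity-algebroid\<close>

text \<open>Sections of the trivial bundle with fibre the Lie algebra: locally finite combinations of
  constant sections.\<close>

definition trivial_sections ::
    "('m, 'k::real_normed_field) base \<Rightarrow> ('k \<Rightarrow> 'g::ab_group_add \<Rightarrow> 'g) \<Rightarrow> 'm set \<Rightarrow> ('m \<Rightarrow> 'g) set"
  where "trivial_sections M s U = {\<xi>. (\<forall>p. p \<notin> U \<longrightarrow> \<xi> p = 0) \<and>
    (\<forall>p\<in>U. \<exists>W n f x. opn M W \<and> p \<in> W \<and> W \<subseteq> U \<and> (\<forall>i<n::nat. f i \<in> funs M W) \<and>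
       res W \<xi> = (\<lambda>q. \<Sum>i<n. s (f i q) (x i)))}"

definition const_sec :: "'m set \<Rightarrow> 'g \<Rightarrow> 'm \<Rightarrow> 'g::zero \<times> 'v::zero"
  where "const_sec U x = (\<lambda>p. (if p \<in> U then x else 0, 0))"

definition emb_sec :: "('m \<Rightarrow> 'v) \<Rightarrow> 'm \<Rightarrow> 'g::zero \<times> 'v"
  where "emb_sec \<sigma> = (\<lambda>p. (0, \<sigma> p))"

definition associated_algebroid ::
    "('m, 'k::real_normed_field) base \<Rightarrow> ('k, 'g::ab_group_add) lie_alg \<Rightarrow>
     ('m, 'k, 'v::ab_group_add) algebroid \<Rightarrow> ('g \<Rightarrow> ('m, 'k) vfield) \<Rightarrow> ('g \<Rightarrow> 'g \<Rightarrow> 'm \<Rightarrow> 'v) \<Rightarrow>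
     ('m, 'k, 'g \<times> 'v) algebroid \<Rightarrow> bool"
  where "associated_algebroid M g A \<rho> \<eta> A' \<longleftrightarrow>
    scl A' = (\<lambda>c (x, v). (lscale g c x, scl A c v)) \<and>
    (\<forall>i\<ge>1. \<forall>p\<in>pts M. fib A' i p = (if i = 1 then UNIV else {0}) \<times> fib A i p) \<and>
    (\<forall>i\<ge>1. \<forall>U. opn M U \<longrightarrow> sec A' i U =
       {s. fst \<circ> s \<in> (if i = 1 then trivial_sections M (lscale g) U else {0}) \<and>
           snd \<circ> s \<in> sec A i U}) \<and>
    lie_infinity_structure M A' \<and>
    (\<forall>U as. opn M U \<and> homogeneous_args A U as \<longrightarrow>
       brk A' U (map (map_prod id emb_sec) as) = emb_sec (brk A U as)) \<and>
    (\<forall>U x. \<forall>\<sigma>\<in>sec A 1 U. opn M U \<longrightarrow>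
       anch A' U (const_sec U x + emb_sec \<sigma>) = vres U (\<rho> x) + anch A U \<sigma>) \<and>
    (\<forall>U x y. opn M U \<longrightarrow>
       brk A' U [(1, const_sec U x), (1, const_sec U y)] =
         const_sec U (lbr g x y) + emb_sec (res U (\<eta> x y))) \<and>
    (\<forall>U x. \<forall>\<sigma>\<in>sec A 1 U. opn M U \<longrightarrow>
       brk A' U [(1, const_sec U x), (1, emb_sec \<sigma>)] \<in> emb_sec ` sec A 1 U)"


section \<open>The isotropy Lie algebra at a point\<close>

text \<open>
  The quotient of the germs of \<open>F\<close> which vanish at \<open>m\<close> by the product of \<open>F\<close> with the vanishing
  ideal of \<open>m\<close>. Germs are represented by pairs (neighbourhood of \<open>m\<close>, vector field on it).
\<close>

definition isotropy_reps ::
    "('m, 'k::real_normed_field) base \<Rightarrow> ('m set \<Rightarrow> ('m, 'k) vfield set) \<Rightarrow> 'm \<Rightarrow>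
     ('m set \<times> ('m, 'k) vfield) set"
  where "isotropy_reps M F m = {(U, X). opn M U \<and> m \<in> U \<and> X \<in> F U \<and> vanishes_at m X}"

definition ideal_times ::
    "('m, 'k::real_normed_field) base \<Rightarrow> ('m set \<Rightarrow> ('m, 'k) vfield set) \<Rightarrow> 'm \<Rightarrow> 'm set \<Rightarrow>
     ('m, 'k) vfield set"
  where "ideal_times M F m U =
    {\<Sum>i<n. vsmult (f i) (Y i) | n f Y. \<forall>i<n::nat. f i \<in> funs M U \<and> f i m = 0 \<and> Y i \<in> F U}"

definition isotropy_rel ::
    "('m, 'k::real_normed_field) base \<Rightarrow> ('m set \<Rightarrow> ('m, 'k) vfield set) \<Rightarrow> 'm \<Rightarrow>
     (('m set \<times> ('m, 'k) vfield) \<times> ('m set \<times> ('m, 'k) vfield)) set"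
  where "isotropy_rel M F m = {((U, X), (V, Y)).
    (U, X) \<in> isotropy_reps M F m \<and> (V, Y) \<in> isotropy_reps M F m \<and>
    (\<exists>W. opn M W \<and> m \<in> W \<and> W \<subseteq> U \<inter> V \<and> vres W X - vres W Y \<in> ideal_times M F m W)}"

definition isotropy ::
    "('m, 'k::real_normed_field) base \<Rightarrow> ('m set \<Rightarrow> ('m, 'k) vfield set) \<Rightarrow> 'm \<Rightarrow>
     ('m set \<times> ('m, 'k) vfield) set set"
  where "isotropy M F m = isotropy_reps M F m // isotropy_rel M F m"

abbreviation isotropy_class ::
    "('m, 'k::real_normed_field) base \<Rightarrow> ('m set \<Rightarrow> ('m, 'k) vfield set) \<Rightarrow> 'm \<Rightarrow>
     'm set \<Rightarrow> ('m, 'k) vfield \<Rightarrow> ('m set \<times> ('m, 'k) vfield) set"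
  where "isotropy_class M F m U X \<equiv> isotropy_rel M F m `` {(U, X)}"

text \<open>The classes united here, and in the map \<open>isotropy_ident\<close> below, all coincide.\<close>

definition isotropy_bracket ::
    "('m, 'k::real_normed_field) base \<Rightarrow> ('m set \<Rightarrow> ('m, 'k) vfield set) \<Rightarrow> 'm \<Rightarrow>
     ('m set \<times> ('m, 'k) vfield) set \<Rightarrow> ('m set \<times> ('m, 'k) vfield) set \<Rightarrow>
     ('m set \<times> ('m, 'k) vfield) set"
  where "isotropy_bracket M F m a b =
    (\<Union>(U, X)\<in>a. \<Union>(V, Y)\<in>b.
       isotropy_class M F m (U \<inter> V) (vbracket (vres (U \<inter> V) X) (vres (U \<inter> V) Y)))"

definition isotropy_center ::
    "('m, 'k::real_normed_field) base \<Rightarrow> ('m set \<Rightarrow> ('m, 'k) vfield set) \<Rightarrow> 'm \<Rightarrow>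
     ('m set \<times> ('m, 'k) vfield) set set"
  where "isotropy_center M F m = {a \<in> isotropy M F m. \<forall>b\<in>isotropy M F m.
    isotropy_bracket M F m a b = isotropy_class M F m (pts M) 0}"

definition anchor_kernel ::
    "('m, 'k::real_normed_field) base \<Rightarrow> 'm \<Rightarrow> ('m, 'k, 'v::ab_group_add) algebroid \<Rightarrow> 'v set"
  where "anchor_kernel M m A =
    {\<sigma> m | \<sigma> U. opn M U \<and> m \<in> U \<and> \<sigma> \<in> sec A 1 U \<and> vanishes_at m (anch A U \<sigma>)}"

text \<open>For \<open>A\<close> minimal at \<open>m\<close>, the identification of the kernel of the anchor at \<open>m\<close> with the
  isotropy Lie algebra: a vector is extended to a section, to which the anchor is applied.\<close>

definition isotropy_ident ::
    "('m, 'k::real_normed_field) base \<Rightarrow> ('m set \<Rightarrow> ('m, 'k) vfield set) \<Rightarrow> 'm \<Rightarrow>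
     ('m, 'k, 'v::ab_group_add) algebroid \<Rightarrow> 'v \<Rightarrow> ('m set \<times> ('m, 'k) vfield) set"
  where "isotropy_ident M F m A v =
    \<Union>{isotropy_class M F m U (anch A U \<sigma>) | U \<sigma>. opn M U \<and> m \<in> U \<and> \<sigma> \<in> sec A 1 U \<and> \<sigma> m = v}"

text \<open>The centre of the isotropy Lie algebra, inside the kernel of the anchor.\<close>

definition center_in ::
    "('m, 'k::real_normed_field) base \<Rightarrow> ('m set \<Rightarrow> ('m, 'k) vfield set) \<Rightarrow> 'm \<Rightarrow>
     ('m, 'k, 'v::ab_group_add) algebroid \<Rightarrow> 'v set"
  where "center_in M F m A =
    {v \<in> anchor_kernel M m A. isotropy_ident M F m A v \<in> isotropy_center M F m}"

text \<open>The canonical map between the kernels of the anchors of \<open>B\<close> and \<open>A\<close> at \<open>m\<close>, both being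
  identified with the isotropy Lie algebra.\<close>

definition isotropy_transport ::
    "('m, 'k::real_normed_field) base \<Rightarrow> ('m set \<Rightarrow> ('m, 'k) vfield set) \<Rightarrow> 'm \<Rightarrow>
     ('m, 'k, 'w::ab_group_add) algebroid \<Rightarrow> ('m, 'k, 'v::ab_group_add) algebroid \<Rightarrow> 'w \<Rightarrow> 'v"
  where "isotropy_transport M F m B A w =
    (THE v. v \<in> anchor_kernel M m A \<and> isotropy_ident M F m A v = isotropy_ident M F m B w)"

text \<open>The endomorphism of the fibre at \<open>m\<close> which \<open>\<ell>\<^sub>2'(x, \<cdot>)\<close> induces; \<open>A'\<close> is an algebroid
  associated with \<open>A\<close>.\<close>

definition fibre_action ::
    "('m, 'k::real_normed_field) base \<Rightarrow> 'm \<Rightarrow> ('m, 'k, 'v::ab_group_add) algebroid \<Rightarrow>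
     ('m, 'k, 'g::ab_group_add \<times> 'v) algebroid \<Rightarrow> 'g \<Rightarrow> 'v \<Rightarrow> 'v"
  where "fibre_action M m A A' x v =
    (THE w. \<exists>U \<sigma>. opn M U \<and> m \<in> U \<and> \<sigma> \<in> sec A 1 U \<and> \<sigma> m = v \<and>
       w = snd (brk A' U [(1, const_sec U x), (1, emb_sec \<sigma>)] m))"


section \<open>Modules and Chevalley-Eilenberg cohomology\<close>

definition lie_module ::
    "('k::field, 'g::ab_group_add) lie_alg \<Rightarrow> ('k \<Rightarrow> 'v::ab_group_add \<Rightarrow> 'v) \<Rightarrow> 'v set \<Rightarrow>
     ('g \<Rightarrow> 'v \<Rightarrow> 'v) \<Rightarrow> bool"
  where "lie_module g s Z act \<longleftrightarrow> module.subspace s Z \<and>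
    (\<forall>x. \<forall>z\<in>Z. act x z \<in> Z) \<and>
    (\<forall>x. \<forall>z\<in>Z. \<forall>z'\<in>Z. act x (z + z') = act x z + act x z') \<and>
    (\<forall>x c. \<forall>z\<in>Z. act x (s c z) = s c (act x z)) \<and>
    (\<forall>x y. \<forall>z\<in>Z. act (x + y) z = act x z + act y z) \<and>
    (\<forall>c x. \<forall>z\<in>Z. act (lscale g c x) z = s c (act x z)) \<and>
    (\<forall>x y. \<forall>z\<in>Z. act (lbr g x y) z = act x (act y z) - act y (act x z))"

definition lie_module_iso ::
    "('k \<Rightarrow> 'v::ab_group_add \<Rightarrow> 'v) \<Rightarrow> 'v set \<Rightarrow> ('g \<Rightarrow> 'v \<Rightarrow> 'v) \<Rightarrow>
     ('k \<Rightarrow> 'w::ab_group_add \<Rightarrow> 'w) \<Rightarrow> 'w set \<Rightarrow> ('g \<Rightarrow> 'w \<Rightarrow> 'w) \<Rightarrow> ('v \<Rightarrow> 'w) \<Rightarrow> bool"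
  where "lie_module_iso s Z act s' Z' act' T \<longleftrightarrow> bij_betw T Z Z' \<and>
    (\<forall>z\<in>Z. \<forall>z'\<in>Z. T (z + z') = T z + T z') \<and>
    (\<forall>c. \<forall>z\<in>Z. T (s c z) = s' c (T z)) \<and>
    (\<forall>x. \<forall>z\<in>Z. T (act x z) = act' x (T z))"

text \<open>Cochains are alternating multilinear maps, applied to lists of arguments.\<close>

definition ce_cochain ::
    "('k::field, 'g::ab_group_add) lie_alg \<Rightarrow> ('k \<Rightarrow> 'v::ab_group_add \<Rightarrow> 'v) \<Rightarrow> 'v set \<Rightarrow> nat \<Rightarrow>
     ('g list \<Rightarrow> 'v) \<Rightarrow> bool"
  where "ce_cochain g s Z n \<omega> \<longleftrightarrow>
    (\<forall>xs. length xs = n \<longrightarrow> \<omega> xs \<in> Z) \<and>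
    (\<forall>xs ys x y. length xs + 1 + length ys = n \<longrightarrow>
       \<omega> (xs @ (x + y) # ys) = \<omega> (xs @ x # ys) + \<omega> (xs @ y # ys)) \<and>
    (\<forall>xs ys c x. length xs + 1 + length ys = n \<longrightarrow>
       \<omega> (xs @ lscale g c x # ys) = s c (\<omega> (xs @ x # ys))) \<and>
    (\<forall>xs. length xs = n \<and> \<not> distinct xs \<longrightarrow> \<omega> xs = 0)"

definition ce_differential ::
    "('k::field, 'g::ab_group_add) lie_alg \<Rightarrow> ('k \<Rightarrow> 'v::ab_group_add \<Rightarrow> 'v) \<Rightarrow> ('g \<Rightarrow> 'v \<Rightarrow> 'v) \<Rightarrow>
     ('g list \<Rightarrow> 'v) \<Rightarrow> 'g list \<Rightarrow> 'v"
  where "ce_differential g s act \<omega> xs =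
    (\<Sum>i<length xs. s ((- 1) ^ i) (act (xs ! i) (\<omega> (nths xs (- {i}))))) +
    (\<Sum>(i, j) \<in> {(i, j). i < j \<and> j < length xs}.
       s ((- 1) ^ (i + j)) (\<omega> (lbr g (xs ! i) (xs ! j) # nths xs (- {i, j}))))"

definition ce_cocycle ::
    "('k::field, 'g::ab_group_add) lie_alg \<Rightarrow> ('k \<Rightarrow> 'v::ab_group_add \<Rightarrow> 'v) \<Rightarrow> 'v set \<Rightarrow>
     ('g \<Rightarrow> 'v \<Rightarrow> 'v) \<Rightarrow> nat \<Rightarrow> ('g list \<Rightarrow> 'v) \<Rightarrow> bool"
  where "ce_cocycle g s Z act n \<omega> \<longleftrightarrow> ce_cochain g s Z n \<omega> \<and>
    (\<forall>xs. length xs = n + 1 \<longrightarrow> ce_differential g s act \<omega> xs = 0)"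

definition ce_exact ::
    "('k::field, 'g::ab_group_add) lie_alg \<Rightarrow> ('k \<Rightarrow> 'v::ab_group_add \<Rightarrow> 'v) \<Rightarrow> 'v set \<Rightarrow>
     ('g \<Rightarrow> 'v \<Rightarrow> 'v) \<Rightarrow> nat \<Rightarrow> ('g list \<Rightarrow> 'v) \<Rightarrow> bool"
  where "ce_exact g s Z act n \<omega> \<longleftrightarrow> n \<ge> 1 \<and>
    (\<exists>\<beta>. ce_cochain g s Z (n - 1) \<beta> \<and> (\<forall>xs. length xs = n \<longrightarrow> \<omega> xs = ce_differential g s act \<beta> xs))"

definition ce_cohomologous ::
    "('k::field, 'g::ab_group_add) lie_alg \<Rightarrow> ('k \<Rightarrow> 'v::ab_group_add \<Rightarrow> 'v) \<Rightarrow> 'v set \<Rightarrow>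
     ('g \<Rightarrow> 'v \<Rightarrow> 'v) \<Rightarrow> nat \<Rightarrow> ('g list \<Rightarrow> 'v) \<Rightarrow> ('g list \<Rightarrow> 'v) \<Rightarrow> bool"
  where "ce_cohomologous g s Z act n \<omega> \<omega>' \<longleftrightarrow>
    ce_cocycle g s Z act n \<omega> \<and> ce_cocycle g s Z act n \<omega>' \<and>
    ce_exact g s Z act n (\<lambda>xs. \<omega> xs - \<omega>' xs)"

definition eta_at :: "('g \<Rightarrow> 'g \<Rightarrow> 'm \<Rightarrow> 'v) \<Rightarrow> 'm \<Rightarrow> 'g list \<Rightarrow> 'v"
  where "eta_at \<eta> m xs = \<eta> (xs ! 0) (xs ! 1) m"


section \<open>Fixed point data\<close>

text \<open>All choices made over a fixed base, Lie algebra, singular foliation and point, with the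
  assumptions on them.\<close>

definition fixed_point_data ::
    "('m, 'k::real_normed_field) base \<Rightarrow> ('k, 'g::ab_group_add) lie_alg \<Rightarrow>
     ('m set \<Rightarrow> ('m, 'k) vfield set) \<Rightarrow> 'm \<Rightarrow> ('m, 'k, 'v::ab_group_add) algebroid \<Rightarrow>
     ('g \<Rightarrow> ('m, 'k) vfield) \<Rightarrow> ('g \<Rightarrow> 'g \<Rightarrow> 'm \<Rightarrow> 'v) \<Rightarrow> ('m, 'k, 'g \<times> 'v) algebroid \<Rightarrow> bool"
  where "fixed_point_data M g F m A \<rho> \<eta> A' \<longleftrightarrow>
    universal_algebroid M F A \<and>
    weak_symmetry_action M F g \<rho> \<and>
    curvature_lift M g A \<rho> \<eta> \<and>
    associated_algebroid M g A \<rho> \<eta> A' \<and>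
    (\<forall>x. vanishes_at m (\<rho> x)) \<and>
    minimal_at M m A \<and>
    (\<forall>x y. \<eta> x y m \<in> center_in M F m A)"

text \<open>
  Equivalence of actions through a map \<open>\<phi>\<close> whose values vanish at \<open>m\<close> and have central class in
  the isotropy Lie algebra. For a merely equivalent action the class of \<open>\<eta>\<close> at \<open>m\<close> may change:
  let \<open>F\<close> be generated by \<open>P = x \<partial>\<^sub>y\<close>, \<open>Q = y \<partial>\<^sub>z\<close> and \<open>Z = x \<partial>\<^sub>z = [P, Q]\<close> on
  three-space, so that the isotropy Lie algebra at \<open>0\<close> is the Heisenberg algebra. The
  zero action of an abelian Lie algebra with basis \<open>a, b\<close> is strict; it is equivalent to
  the weak action \<open>a \<mapsto> P, b \<mapsto> Q\<close>, for which \<open>\<eta>(a, b)\<close> at \<open>0\<close> is the class of \<open>- Z\<close>. This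
  is central and not zero, and it is not exact because all coboundaries vanish.
\<close>

definition centrally_equivalent_at ::
    "('m, 'k::real_normed_field) base \<Rightarrow> ('m set \<Rightarrow> ('m, 'k) vfield set) \<Rightarrow>
     ('k, 'g::ab_group_add) lie_alg \<Rightarrow> 'm \<Rightarrow> ('g \<Rightarrow> ('m, 'k) vfield) \<Rightarrow>
     ('g \<Rightarrow> ('m, 'k) vfield) \<Rightarrow> bool"
  where "centrally_equivalent_at M F g m \<rho> \<rho>' \<longleftrightarrow> (\<exists>\<phi>. equivalent_via M F g \<phi> \<rho> \<rho>' \<and>
    (\<forall>x. isotropy_class M F m (pts M) (\<phi> x) \<in> isotropy_center M F m))"

end

theory Submission
  imports Defs
begin

text \<open>
  Everything is read off from germs of vector fields at \<open>m\<close>. Since \<open>\<rho>\<close> vanishes at \<open>m\<close>, each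
  \<open>\<rho> x\<close> acts by bracket on \<open>F\<close>, on the germs of \<open>F\<close> vanishing at \<open>m\<close> and on the product of \<open>F\<close>
  with the ideal of \<open>m\<close>. A vector in the fibre of \<open>E\<^sub>-\<^sub>1\<close> at \<open>m\<close> represents a germ of \<open>F\<close> if it
  extends to a section with that germ as anchor; minimality makes the vector unique and makes it
  zero precisely for germs in the product with the ideal. Under this correspondence \<open>\<ell>\<^sub>2'(x, \<cdot>)\<close>
  becomes the bracket with \<open>\<rho> x\<close> and \<open>\<eta>(x, y)\<close> becomes the curvature \<open>\<rho>[x, y] - [\<rho> x, \<rho> y]\<close>,
  neither of which involves the algebroids. The cocycle condition is the Bianchi identity, and
  changing \<open>\<rho>\<close> by \<open>\<phi>\<close> with central values changes the curvature by the coboundary of \<open>\<phi>\<close>, the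
  quadratic term \<open>[\<phi> x, \<phi> y]\<close> being zero in the isotropy Lie algebra.
\<close>

text \<open>In the holomorphic and algebraic settings a local section need not extend, so
  congruences are only asked to hold on all sufficiently small neighbourhoods of \<open>m\<close>.
  The correspondence between fibre vectors and germs is kept as a relation \<open>rep\<close> rather
  than a map: a germ of \<open>F\<close> has exactly one vector, a vector has its germ only modulo
  \<open>gI\<close>, and an identity between fibre vectors is proved by exhibiting congruent germs.
  As the germs belong to the foliation alone, the same germs compare two universal algebroids with
  unrelated fibre types. The obstacle is to turn the bracket of \<open>A'\<close> into a bracket of
  vector fields. That the anchor respects this bracket has to be extracted from the Leibniz and
  Jacobi rules, and since \<open>A'\<close> may have infinite rank, the test sections are taken from
  E_{-1}, where frames exist. Two strengths of equivalence occur. A difference of actions with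
  values in \<open>F\<close> that vanish at \<open>m\<close> acts trivially on the centre, which
  settles the module structure; comparing cocycles requires the differences themselves to be
  central.\<close>

section \<open>Restriction and vanishing at a point\<close>

lemma res_apply: "p \<in> U \<Longrightarrow> res U s p = s p"
  by (simp add: res_def)

lemma res_0 [simp]: "res W 0 = 0"
  by (simp add: res_def fun_eq_iff)

lemma vres_apply [simp]: "vres U X W = (if W \<subseteq> U then X W else 0)"
  by (simp add: vres_def fun_eq_iff)

lemma vres_0 [simp]: "vres W 0 = 0"
  and vres_add: "vres W (X + Y) = vres W X + vres W Y"
  and vres_diff: "vres W (X - Y) = vres W X - vres W Y"
  for X Y :: "('m, 'k::ab_group_add) vfield"
  by (simp_all add: fun_eq_iff)

lemma vres_vres: "W \<subseteq> U \<Longrightarrow> vres W (vres U X) = vres W X"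
  by (auto simp add: fun_eq_iff)

lemma vres_vscale: "vres W (vscale c X) = vscale c (vres W X)"
  for X :: "('m, 'k::real_normed_field) vfield"
  by (simp add: fun_eq_iff vscale_def vsmult_def)

lemma vscale_apply: "vscale c X W h p = c * X W h p"
  by (simp add: vscale_def vsmult_def)

lemma vbracket_swap: "vbracket X Y = - vbracket Y X"
  by (simp add: vbracket_def fun_eq_iff)

lemma vres_vbracket: "vres W (vbracket X Y) = vbracket (vres W X) (vres W Y)"
  by (auto simp: vbracket_def fun_eq_iff)

lemma vanishes_at_add: "vanishes_at m X \<Longrightarrow> vanishes_at m Y \<Longrightarrow> vanishes_at m (X + Y)"
  and vanishes_at_vscale: "vanishes_at m X \<Longrightarrow> vanishes_at m (vscale c X)"
  and vanishes_at_vbracket: "vanishes_at m X \<Longrightarrow> vanishes_at m Y \<Longrightarrow> vanishes_at m (vbracket X Y)"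
  for X :: "('m, 'k::real_normed_field) vfield"
  by (simp_all add: vanishes_at_def vscale_apply vbracket_def)

lemmas vanishes_at_closed = vanishes_at_add vanishes_at_vscale vanishes_at_vbracket

lemma vanishes_at_0 [simp]: "vanishes_at m 0"
  by (simp add: vanishes_at_def)

lemma vanishes_at_vres: "vanishes_at m X \<Longrightarrow> vanishes_at m (vres W X)"
  by (simp add: vanishes_at_def)

lemma section_sheaf_outside:
  "section_sheaf M \<Gamma> \<Longrightarrow> opn M U \<Longrightarrow> s \<in> \<Gamma> U \<Longrightarrow> p \<notin> U \<Longrightarrow> s p = 0"
  unfolding section_sheaf_def by (drule conjunct1) blast

lemma section_sheaf_res:
  "section_sheaf M \<Gamma> \<Longrightarrow> opn M U \<Longrightarrow> opn M W \<Longrightarrow> W \<subseteq> U \<Longrightarrow> s \<in> \<Gamma> U \<Longrightarrow> res W s \<in> \<Gamma> W"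
  unfolding section_sheaf_def by (drule conjunct2, drule conjunct1) blast

section \<open>Functions and vector fields\<close>

locale function_base =
  fixes M :: "('m, 'k::real_normed_field) base"
  assumes function_sheaf: "function_sheaf M"
begin

lemma opn_Int: "opn M U \<Longrightarrow> opn M V \<Longrightarrow> opn M (U \<inter> V)"
  by (rule openin_Int)

lemma funs_outside: "opn M U \<Longrightarrow> f \<in> funs M U \<Longrightarrow> p \<notin> U \<Longrightarrow> f p = 0"
  using section_sheaf_outside function_sheaf unfolding function_sheaf_def by metis

lemma funs_res: "opn M U \<Longrightarrow> opn M W \<Longrightarrow> W \<subseteq> U \<Longrightarrow> f \<in> funs M U \<Longrightarrow> res W f \<in> funs M W"
  using section_sheaf_res function_sheaf unfolding function_sheaf_def by metis

lemma funs_const: "opn M U \<Longrightarrow> res U (\<lambda>_. c) \<in> funs M U"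
  using function_sheaf unfolding function_sheaf_def by blast

lemma funs_add: "opn M U \<Longrightarrow> f \<in> funs M U \<Longrightarrow> h \<in> funs M U \<Longrightarrow> f + h \<in> funs M U"
  using function_sheaf unfolding function_sheaf_def by blast

lemma funs_mult: "opn M U \<Longrightarrow> f \<in> funs M U \<Longrightarrow> h \<in> funs M U \<Longrightarrow> f * h \<in> funs M U"
  using function_sheaf unfolding function_sheaf_def by blast

lemma funs_0: "opn M U \<Longrightarrow> 0 \<in> funs M U"
  using funs_const[of U 0] by (simp add: res_def zero_fun_def)

lemma funs_scale:
  assumes "opn M U" and "f \<in> funs M U"
  shows "(\<lambda>p. c * f p) \<in> funs M U"
proof -
  have "(\<lambda>p. c * f p) = res U (\<lambda>_. c) * f"
    using funs_outside[OF assms] by (auto simp: fun_eq_iff res_def)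
  then show ?thesis using assms funs_const funs_mult by simp
qed

lemma funs_uminus: "opn M U \<Longrightarrow> f \<in> funs M U \<Longrightarrow> - f \<in> funs M U"
  using funs_scale[of U f "- 1"] by (simp add: fun_Compl_def)

lemma funs_diff: "opn M U \<Longrightarrow> f \<in> funs M U \<Longrightarrow> h \<in> funs M U \<Longrightarrow> f - h \<in> funs M U"
  using funs_add[of U f "- h"] funs_uminus by simp

section \<open>Vector fields as derivations, their module operations and their bracket\<close>

lemma vf_outside: "X \<in> vfields M U \<Longrightarrow> \<not> (opn M W \<and> W \<subseteq> U \<and> f \<in> funs M W) \<Longrightarrow> X W f = 0"
  by (simp add: vfields_def)

lemma vf_funs: "X \<in> vfields M U \<Longrightarrow> opn M W \<Longrightarrow> W \<subseteq> U \<Longrightarrow> f \<in> funs M W \<Longrightarrow> X W f \<in> funs M W"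
  by (simp add: vfields_def)

lemma vf_plus: "X \<in> vfields M U \<Longrightarrow> opn M W \<Longrightarrow> W \<subseteq> U \<Longrightarrow> f \<in> funs M W \<Longrightarrow> h \<in> funs M W
    \<Longrightarrow> X W (f + h) = X W f + X W h"
  by (simp add: vfields_def)

lemma vf_times: "X \<in> vfields M U \<Longrightarrow> opn M W \<Longrightarrow> W \<subseteq> U \<Longrightarrow> f \<in> funs M W \<Longrightarrow> h \<in> funs M W
    \<Longrightarrow> X W (f * h) = X W f * h + f * X W h"
  by (simp add: vfields_def)

lemma vf_mult_const: "X \<in> vfields M U \<Longrightarrow> opn M W \<Longrightarrow> W \<subseteq> U \<Longrightarrow> f \<in> funs M W
    \<Longrightarrow> X W (\<lambda>p. c * f p) = (\<lambda>p. c * X W f p)"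
  by (simp add: vfields_def)

lemma vf_res: "X \<in> vfields M U \<Longrightarrow> opn M W \<Longrightarrow> W \<subseteq> U \<Longrightarrow> f \<in> funs M W \<Longrightarrow> opn M V \<Longrightarrow> V \<subseteq> W
    \<Longrightarrow> X V (res V f) = res V (X W f)"
  by (simp add: vfields_def)

lemma vf_at_0:
  assumes "X \<in> vfields M U"
  shows "X W 0 = 0"
proof (cases "opn M W \<and> W \<subseteq> U")
  case True
  then show ?thesis using vf_plus[OF assms, of W 0 0] funs_0 by auto
qed (use vf_outside[OF assms] in blast)

lemma vf_minus:
  assumes "X \<in> vfields M U" and "opn M W" and "W \<subseteq> U" and "f \<in> funs M W" and "h \<in> funs M W"
  shows "X W (f - h) = X W f - X W h"
  using vf_plus[OF assms(1-3), of "f - h" h] funs_diff assms by (simp add: algebra_simps)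

text \<open>Identities between vector fields are equalities of total functions, so inadmissible
  arguments have to be dealt with too; the second case disposes of them for all the fields in
  \<open>S\<close> at once.\<close>

lemma vf_cases:
  assumes "\<And>X. X \<in> S \<Longrightarrow> X \<in> vfields M U"
  obtains "opn M W" and "W \<subseteq> U" and "f \<in> funs M W"
  | "\<And>X. X \<in> S \<Longrightarrow> X W f = 0"
  using assms vf_outside by metis

lemma vf_support:
  assumes "X \<in> vfields M U" and "p \<notin> W"
  shows "X W f p = 0"
  using assms vf_outside[OF assms(1), of W f] vf_funs[OF assms(1), of W f] funs_outside
  by (metis zero_fun_apply)

lemma vres_self: "X \<in> vfields M U \<Longrightarrow> vres U X = X"
  using vf_outside[of X U] by (auto simp: fun_eq_iff)

lemma vres_vfields:
  assumes "X \<in> vfields M U" and "W \<subseteq> U"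
  shows "vres W X \<in> vfields M W"
  unfolding vfields_def
  using vf_outside[OF assms(1)] vf_funs[OF assms(1)] vf_plus[OF assms(1)] vf_times[OF assms(1)]
    vf_mult_const[OF assms(1)] vf_res[OF assms(1)] assms(2)
  by (auto simp: subset_iff)

lemma vfI:
  assumes "\<And>W f. \<not> (opn M W \<and> W \<subseteq> U \<and> f \<in> funs M W) \<Longrightarrow> X W f = 0"
    and "\<And>W f. opn M W \<Longrightarrow> W \<subseteq> U \<Longrightarrow> f \<in> funs M W \<Longrightarrow> X W f \<in> funs M W"
    and "\<And>W f h. opn M W \<Longrightarrow> W \<subseteq> U \<Longrightarrow> f \<in> funs M W \<Longrightarrow> h \<in> funs M W \<Longrightarrow>
      X W (f + h) = X W f + X W h \<and> X W (f * h) = X W f * h + f * X W h"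
    and "\<And>W c f. opn M W \<Longrightarrow> W \<subseteq> U \<Longrightarrow> f \<in> funs M W \<Longrightarrow>
      X W (\<lambda>p. c * f p) = (\<lambda>p. c * X W f p)"
    and "\<And>W V f. opn M W \<Longrightarrow> W \<subseteq> U \<Longrightarrow> f \<in> funs M W \<Longrightarrow> opn M V \<Longrightarrow> V \<subseteq> W \<Longrightarrow>
      X V (res V f) = res V (X W f)"
  shows "X \<in> vfields M U"
  unfolding vfields_def mem_Collect_eq
  by (intro conjI allI impI ballI) (use assms in auto)

lemma add_vfields:
  assumes X: "X \<in> vfields M U" and Y: "Y \<in> vfields M U"
  shows "X + Y \<in> vfields M U"
proof (rule vfI)
  fix W V f h c assume W: "opn M W" "W \<subseteq> U" and f: "f \<in> funs M W"
  show "(X + Y) W f \<in> funs M W"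
    by (simp add: funs_add W vf_funs[OF X W f] vf_funs[OF Y W f])
  show "(X + Y) W (\<lambda>p. c * f p) = (\<lambda>p. c * (X + Y) W f p)"
    by (simp add: fun_eq_iff algebra_simps vf_mult_const[OF X W f] vf_mult_const[OF Y W f])
  show "(X + Y) W (f + h) = (X + Y) W f + (X + Y) W h \<and>
      (X + Y) W (f * h) = (X + Y) W f * h + f * (X + Y) W h" if "h \<in> funs M W"
    using that by (simp add: algebra_simps vf_plus[OF X W f] vf_plus[OF Y W f]
        vf_times[OF X W f] vf_times[OF Y W f])
  show "(X + Y) V (res V f) = res V ((X + Y) W f)" if "opn M V" "V \<subseteq> W"
    by (simp add: vf_res[OF X W f that] vf_res[OF Y W f that]) (simp add: fun_eq_iff res_def)
qed (use vf_outside[OF X] vf_outside[OF Y] in auto)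

lemma vscale_vfields:
  assumes X: "X \<in> vfields M U"
  shows "vscale c X \<in> vfields M U"
proof (rule vfI)
  fix W V f h d assume W: "opn M W" "W \<subseteq> U" and f: "f \<in> funs M W"
  have [simp]: "vscale c X W f = (\<lambda>p. c * X W f p)" for W f
    by (simp add: fun_eq_iff vscale_apply)
  show "vscale c X W f \<in> funs M W"
    by (simp add: funs_scale W vf_funs[OF X W f])
  show "vscale c X W (\<lambda>p. d * f p) = (\<lambda>p. d * vscale c X W f p)"
    by (simp add: fun_eq_iff algebra_simps vf_mult_const[OF X W f])
  show "vscale c X W (f + h) = vscale c X W f + vscale c X W h \<and>
      vscale c X W (f * h) = vscale c X W f * h + f * vscale c X W h" if "h \<in> funs M W"
    using that by (simp add: fun_eq_iff algebra_simps vf_plus[OF X W f] vf_times[OF X W f])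
  show "vscale c X V (res V f) = res V (vscale c X W f)" if "opn M V" "V \<subseteq> W"
    by (simp add: vf_res[OF X W f that]) (simp add: fun_eq_iff res_def)
qed (use vf_outside[OF X] in \<open>auto simp: fun_eq_iff vscale_apply\<close>)

lemma vscale_minus1: "vscale (- 1) X = - X" for X :: "('m, 'k) vfield"
  by (simp add: fun_eq_iff vscale_apply)

lemma uminus_vfields: "X \<in> vfields M U \<Longrightarrow> - X \<in> vfields M U"
  using vscale_vfields[of X U "- 1"] by (simp add: vscale_minus1)

lemma diff_vfields: "X \<in> vfields M U \<Longrightarrow> Y \<in> vfields M U \<Longrightarrow> X - Y \<in> vfields M U"
  using add_vfields[of X U "- Y"] uminus_vfields by simp

lemma vbracket_vfields:
  assumes X: "X \<in> vfields M U" and Y: "Y \<in> vfields M U"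
  shows "vbracket X Y \<in> vfields M U"
proof (rule vfI)
  fix W V f h c assume W: "opn M W" "W \<subseteq> U" and f: "f \<in> funs M W"
  note XW = vf_funs[OF X W] vf_plus[OF X W] vf_times[OF X W] vf_mult_const[OF X W]
  note YW = vf_funs[OF Y W] vf_plus[OF Y W] vf_times[OF Y W] vf_mult_const[OF Y W]
  note cl = funs_diff[OF W(1)] funs_add[OF W(1)] funs_mult[OF W(1)]
  show "vbracket X Y W f \<in> funs M W"
    by (simp add: vbracket_def f cl XW YW)
  show "vbracket X Y W (\<lambda>p. c * f p) = (\<lambda>p. c * vbracket X Y W f p)"
    by (simp add: vbracket_def fun_eq_iff algebra_simps XW YW f)
  show "vbracket X Y W (f + h) = vbracket X Y W f + vbracket X Y W h \<and>
      vbracket X Y W (f * h) = vbracket X Y W f * h + f * vbracket X Y W h" if "h \<in> funs M W"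
    using that by (simp add: vbracket_def fun_eq_iff algebra_simps XW YW f cl)
  show "vbracket X Y V (res V f) = res V (vbracket X Y W f)" if "opn M V" "V \<subseteq> W"
    by (simp add: vbracket_def vf_res[OF X W _ that] vf_res[OF Y W _ that] XW YW f)
      (simp add: fun_eq_iff res_def)
next
  fix W f assume "\<not> (opn M W \<and> W \<subseteq> U \<and> f \<in> funs M W)"
  then show "vbracket X Y W f = 0"
    using vf_outside[OF X] vf_outside[OF Y] vf_at_0[OF X] vf_at_0[OF Y]
    by (simp add: vbracket_def)
qed

lemma vbracket_add_right:
  assumes X: "X \<in> vfields M U" and "Y \<in> vfields M U" and "Z \<in> vfields M U"
  shows "vbracket X (Y + Z) = vbracket X Y + vbracket X Z"
proof (intro ext)
  fix W f p
  show "vbracket X (Y + Z) W f p = (vbracket X Y + vbracket X Z) W f p"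
  proof (rule vf_cases[of "{X, Y, Z}" U W f])
    assume "opn M W" "W \<subseteq> U" "f \<in> funs M W"
    then show ?thesis using assms vf_funs vf_plus[OF X] by (simp add: vbracket_def)
  qed (use assms vf_at_0 in \<open>auto simp: vbracket_def simp flip: zero_fun_def\<close>)
qed

lemma vbracket_scale_right:
  assumes X: "X \<in> vfields M U" and "Y \<in> vfields M U"
  shows "vbracket X (vscale c Y) = vscale c (vbracket X Y)"
proof (intro ext)
  fix W f p
  have [simp]: "vscale c X W f = (\<lambda>p. c * X W f p)" for X :: "('m, 'k) vfield" and W f
    by (simp add: fun_eq_iff vscale_apply)
  show "vbracket X (vscale c Y) W f p = vscale c (vbracket X Y) W f p"
  proof (rule vf_cases[of "{X, Y}" U W f])
    assume "opn M W" "W \<subseteq> U" "f \<in> funs M W"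
    then show ?thesis
      using assms vf_funs vf_mult_const[OF X] by (simp add: vbracket_def algebra_simps)
  qed (use assms vf_at_0 in \<open>auto simp: vbracket_def vscale_apply simp flip: zero_fun_def\<close>)
qed

lemma vbracket_uminus_right:
  "X \<in> vfields M U \<Longrightarrow> Y \<in> vfields M U \<Longrightarrow> vbracket X (- Y) = - vbracket X Y"
  using vbracket_scale_right[of X U Y "- 1"] by (simp add: vscale_minus1)

lemma vbracket_diff_right:
  "X \<in> vfields M U \<Longrightarrow> Y \<in> vfields M U \<Longrightarrow> Z \<in> vfields M U \<Longrightarrow>
    vbracket X (Y - Z) = vbracket X Y - vbracket X Z"
  using vbracket_add_right[of X U Y "- Z"] vbracket_uminus_right[of X U Z]
  by (simp add: uminus_vfields)

lemma vbracket_add_left: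
  assumes "X \<in> vfields M U" and "Y \<in> vfields M U" and "Z \<in> vfields M U"
  shows "vbracket (X + Y) Z = vbracket X Z + vbracket Y Z"
  using vbracket_add_right[OF assms(3,1,2)]
  by (simp add: vbracket_swap[of _ Z])

lemma vbracket_diff_left:
  assumes "X \<in> vfields M U" and "Y \<in> vfields M U" and "Z \<in> vfields M U"
  shows "vbracket (X - Y) Z = vbracket X Z - vbracket Y Z"
  using vbracket_diff_right[OF assms(3,1,2)]
  by (simp add: vbracket_swap[of _ Z])

lemma vbracket_scale_left:
  assumes "X \<in> vfields M U" and "Y \<in> vfields M U"
  shows "vbracket (vscale c X) Y = vscale c (vbracket X Y)"
  using vbracket_scale_right[OF assms(2,1), of c]
  by (simp add: vbracket_swap[of _ Y]) (simp add: fun_eq_iff vscale_apply)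

lemma vbracket_jacobi:
  assumes X: "X \<in> vfields M U" and Y: "Y \<in> vfields M U" and Z: "Z \<in> vfields M U"
  shows "vbracket X (vbracket Y Z) = vbracket (vbracket X Y) Z + vbracket Y (vbracket X Z)"
proof (intro ext)
  fix W f p
  show "vbracket X (vbracket Y Z) W f p =
    (vbracket (vbracket X Y) Z + vbracket Y (vbracket X Z)) W f p"
  proof (rule vf_cases[of "{X, Y, Z}" U W f])
    assume W: "opn M W" "W \<subseteq> U" and f: "f \<in> funs M W"
    then show ?thesis
      by (simp add: vbracket_def vf_funs[OF X W] vf_funs[OF Y W] vf_funs[OF Z W]
          vf_minus[OF X W] vf_minus[OF Y W] vf_minus[OF Z W])
  qed (use assms vf_at_0 in \<open>auto simp: vbracket_def simp flip: zero_fun_def\<close>)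
qed

lemma vbracket_vsmult:
  assumes X: "X \<in> vfields M U" and Y: "Y \<in> vfields M U" and f: "f \<in> funs M U" and U: "opn M U"
  shows "vbracket X (vsmult f Y) = vsmult (X U f) Y + vsmult f (vbracket X Y)"
proof (intro ext)
  fix W h p
  show "vbracket X (vsmult f Y) W h p = (vsmult (X U f) Y + vsmult f (vbracket X Y)) W h p"
  proof (rule vf_cases[of "{X, Y}" U W h])
    assume W: "opn M W" "W \<subseteq> U" and h: "h \<in> funs M W"
    \<comment> \<open>The Leibniz rule over \<open>W\<close> needs both factors in
      \<open>funs M W\<close>, while \<open>f\<close> lives over \<open>U\<close>. As
      \<open>Y W h\<close> vanishes off \<open>W\<close>, cutting \<open>f\<close> down to
      \<open>W\<close> leaves the product unchanged.\<close>
    have eq: "f * Y W h = res W f * Y W h"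
      using vf_support[OF Y, of _ W h] by (auto simp: fun_eq_iff res_def)
    have "X W (f * Y W h) = res W (X U f) * Y W h + res W f * X W (Y W h)"
      unfolding eq
      using vf_times[OF X W funs_res[OF U W f] vf_funs[OF Y W h]] vf_res[OF X U subset_refl f W]
      by simp
    then show ?thesis
      using vf_support[OF X, of p W] vf_support[OF Y, of p W]
      by (auto simp: vbracket_def vsmult_def res_def algebra_simps)
  qed (use assms vf_at_0 in \<open>auto simp: vbracket_def vsmult_def simp flip: zero_fun_def\<close>)
qed

lemma vbracket_0 [simp]:
  assumes "X \<in> vfields M U" shows "vbracket X 0 = 0" and "vbracket 0 X = 0"
  using vf_at_0[OF assms] by (simp_all add: vbracket_def fun_eq_iff)

end

section \<open>Singular foliations\<close>

locale foliated_point = function_base M for M :: "('m, 'k::real_normed_field) base" +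
  fixes F :: "'m set \<Rightarrow> ('m, 'k) vfield set" and m :: 'm
  assumes foliation: "singular_foliation M F" and m_in: "m \<in> pts M"
begin

lemma F_vfields: "opn M U \<Longrightarrow> X \<in> F U \<Longrightarrow> X \<in> vfields M U"
  and F_0: "opn M U \<Longrightarrow> 0 \<in> F U"
  and F_add: "opn M U \<Longrightarrow> X \<in> F U \<Longrightarrow> Y \<in> F U \<Longrightarrow> X + Y \<in> F U"
  and F_vsmult: "opn M U \<Longrightarrow> f \<in> funs M U \<Longrightarrow> X \<in> F U \<Longrightarrow> vsmult f X \<in> F U"
  using foliation[unfolded singular_foliation_def, THEN conjunct1] by (auto simp: subset_iff)

lemma F_res: "opn M U \<Longrightarrow> opn M W \<Longrightarrow> W \<subseteq> U \<Longrightarrow> X \<in> F U \<Longrightarrow> vres W X \<in> F W"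
  using foliation[unfolded singular_foliation_def, THEN conjunct2, THEN conjunct1] by simp

lemma F_vbracket: "opn M U \<Longrightarrow> X \<in> F U \<Longrightarrow> Y \<in> F U \<Longrightarrow> vbracket X Y \<in> F U"
  using foliation[unfolded singular_foliation_def, THEN conjunct2, THEN conjunct2, THEN conjunct2,
      THEN conjunct2] by simp

lemma vsmult_res:
  assumes "X \<in> vfields M U"
  shows "vsmult (res U f) X = vsmult f X"
proof (intro ext)
  fix W h p
  show "vsmult (res U f) X W h p = vsmult f X W h p"
    using vf_support[OF assms, of p W h] vf_outside[OF assms, of W h]
    by (cases "W \<subseteq> U"; cases "p \<in> W") (auto simp: vsmult_def res_def)
qed

text \<open>A constant function does not in general vanish off \<open>U\<close>, so it becomes a
  function over \<open>U\<close> only after restriction; on vector fields over \<open>U\<close> the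
  restriction has no effect.\<close>

lemma F_vscale: "opn M U \<Longrightarrow> X \<in> F U \<Longrightarrow> vscale c X \<in> F U"
  using vsmult_res[OF F_vfields, of U X "\<lambda>_. c"] F_vsmult[OF _ funs_const, of U X c]
  by (simp add: vscale_def)

section \<open>The module generated by the vanishing ideal\<close>

lemma ideal_times_0: "0 \<in> ideal_times M F m W"
  unfolding ideal_times_def mem_Collect_eq
  by (intro exI[of _ 0]) simp

lemma ideal_times_add:
  assumes "X \<in> ideal_times M F m W" and "Y \<in> ideal_times M F m W"
  shows "X + Y \<in> ideal_times M F m W"
proof -
  obtain n f X' where X: "X = (\<Sum>i<n. vsmult (f i) (X' i))"
    and fX: "\<forall>i<n::nat. f i \<in> funs M W \<and> f i m = 0 \<and> X' i \<in> F W"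
    using assms(1) unfolding ideal_times_def by blast
  obtain k h Y' where Y: "Y = (\<Sum>i<k. vsmult (h i) (Y' i))"
    and hY: "\<forall>i<k::nat. h i \<in> funs M W \<and> h i m = 0 \<and> Y' i \<in> F W"
    using assms(2) unfolding ideal_times_def by blast
  define e where "e i = (if i < n then f i else h (i - n))" for i
  define E where "E i = (if i < n then X' i else Y' (i - n))" for i
  have "(\<Sum>i<n + k. vsmult (e i) (E i)) = X + Y"
  proof -
    have "(\<Sum>i<n + k. vsmult (e i) (E i)) =
        (\<Sum>i<n. vsmult (e i) (E i)) + (\<Sum>i<k. vsmult (e (n + i)) (E (n + i)))"
      by (induction k) (simp_all add: add.assoc)
    then show ?thesis by (simp add: X Y e_def E_def)
  qed
  moreover have "\<forall>i<n + k. e i \<in> funs M W \<and> e i m = 0 \<and> E i \<in> F W"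
    using fX hY by (auto simp: e_def E_def)
  ultimately show ?thesis
    unfolding ideal_times_def mem_Collect_eq by (intro exI[of _ "n + k"] exI[of _ e] exI[of _ E]) simp
qed

lemma ideal_times_vsmult:
  "f \<in> funs M W \<Longrightarrow> f m = 0 \<Longrightarrow> X \<in> F W \<Longrightarrow> vsmult f X \<in> ideal_times M F m W"
  unfolding ideal_times_def mem_Collect_eq
  by (intro exI[of _ 1] exI[of _ "\<lambda>_. f"] exI[of _ "\<lambda>_. X"]) simp

text \<open>Replaces the sum representation by peeling off one summand at a time. Membership of the
  remaining partial sum is part of the induction step, because bracket rules need it to be a vector
  field.\<close>

lemma ideal_times_induct [consumes 1, case_names zero add]:
  assumes "X \<in> ideal_times M F m W"
    and "P 0"
    and "\<And>f Y X. f \<in> funs M W \<Longrightarrow> f m = 0 \<Longrightarrow> Y \<in> F W \<Longrightarrow> X \<in> ideal_times M F m W \<Longrightarrow> P X \<Longrightarrow>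
      P (X + vsmult f Y)"
  shows "P X"
proof -
  obtain n f Y where X: "X = (\<Sum>i<n. vsmult (f i) (Y i))"
    and fY: "\<forall>i<n::nat. f i \<in> funs M W \<and> f i m = 0 \<and> Y i \<in> F W"
    using assms(1) unfolding ideal_times_def by blast
  have "k \<le> n \<Longrightarrow> (\<Sum>i<k. vsmult (f i) (Y i)) \<in> ideal_times M F m W \<and>
      P (\<Sum>i<k. vsmult (f i) (Y i))" for k
    by (induction k)
      (use assms(2,3) fY in \<open>auto intro!: ideal_times_0 ideal_times_add ideal_times_vsmult\<close>)
  then show ?thesis using X by blast
qed

lemma vsmult_0 [simp]: "vsmult f 0 = 0"
  for f :: "'m \<Rightarrow> 'k"
  by (simp add: fun_eq_iff vsmult_def)

lemma vres_vsmult: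
  assumes "X \<in> vfields M U" and "W \<subseteq> U"
  shows "vres W (vsmult f X) = vsmult (res W f) (vres W X)"
proof -
  have "vres W (vsmult f X) = vsmult f (vres W X)"
    by (simp add: fun_eq_iff vsmult_def)
  then show ?thesis using vsmult_res[OF vres_vfields[OF assms]] by simp
qed

lemma ideal_times_vscale:
  assumes W: "opn M W" and "X \<in> ideal_times M F m W"
  shows "vscale c X \<in> ideal_times M F m W"
  using assms(2)
proof (induction rule: ideal_times_induct)
  case zero
  then show "vscale c 0 \<in> ideal_times M F m W" using ideal_times_0 by (simp add: vscale_def)
next
  case (add f Y X)
  have "vscale c (X + vsmult f Y) = vscale c X + vsmult (\<lambda>p. c * f p) Y"
    by (simp add: fun_eq_iff vscale_def vsmult_def algebra_simps)
  then show "vscale c (X + vsmult f Y) \<in> ideal_times M F m W"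
    using add funs_scale[OF W] by (auto intro!: ideal_times_add ideal_times_vsmult)
qed

lemma ideal_times_res:
  assumes U: "opn M U" and W: "opn M W" "W \<subseteq> U" "m \<in> W" and "X \<in> ideal_times M F m U"
  shows "vres W X \<in> ideal_times M F m W"
  using assms(5)
proof (induction rule: ideal_times_induct)
  case zero
  then show "vres W 0 \<in> ideal_times M F m W" using ideal_times_0 by simp
next
  case (add f Y X)
  have "vres W X \<in> ideal_times M F m W" by (rule add)
  with add show "vres W (X + vsmult f Y) \<in> ideal_times M F m W"
    using funs_res[OF U W(1,2)] F_res[OF U W(1,2)] vres_vsmult[OF F_vfields[OF U] W(2)] W(3)
    by (auto simp: vres_add res_apply intro!: ideal_times_add ideal_times_vsmult)
qed

section \<open>Fields vanishing at the point and the normalizer of the foliation\<close>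

definition vanishing_F :: "'m set \<Rightarrow> ('m, 'k) vfield set"
  where "vanishing_F U = {X \<in> F U. vanishes_at m X}"

text \<open>A common home for the symmetries \<open>\<rho> x\<close> and for the elements of
  \<open>F\<close> vanishing at \<open>m\<close>, so that brackets with either are covered by the
  same lemmas. The quantification over all smaller \<open>W\<close> makes it stable under
  restriction.\<close>

definition normalizer :: "'m set \<Rightarrow> ('m, 'k) vfield set"
  where "normalizer U = {X \<in> vfields M U. vanishes_at m X \<and>
    (\<forall>W. opn M W \<and> W \<subseteq> U \<longrightarrow> (\<forall>Y\<in>F W. vbracket (vres W X) Y \<in> F W))}"

lemma ideal_times_subset:
  assumes W: "opn M W" and "X \<in> ideal_times M F m W"
  shows "X \<in> vanishing_F W"
  using assms(2)
proof (induction rule: ideal_times_induct)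
  case zero
  then show "0 \<in> vanishing_F W" using F_0[OF W] by (simp add: vanishing_F_def)
next
  case (add f Y X)
  then have "vanishes_at m (vsmult f Y)" by (simp add: vanishes_at_def vsmult_def)
  then show "X + vsmult f Y \<in> vanishing_F W" using add F_add[OF W] F_vsmult[OF W] vanishes_at_closed
    by (auto simp: vanishing_F_def)
qed

lemma normalizer_vbracket: "opn M U \<Longrightarrow> X \<in> normalizer U \<Longrightarrow> Y \<in> F U \<Longrightarrow> vbracket X Y \<in> F U"
  using vres_self[of X U] unfolding normalizer_def by fastforce

lemma normalizer_res:
  assumes "opn M U" "opn M W" "W \<subseteq> U" and "X \<in> normalizer U"
  shows "vres W X \<in> normalizer W"
  using assms vres_vfields[of X U W] unfolding normalizer_def
  by (auto simp: vanishes_at_vres vres_vres)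

lemma vanishing_F_subset_normalizer:
  assumes "opn M U" and "X \<in> vanishing_F U"
  shows "X \<in> normalizer U"
  using assms F_vfields F_vbracket F_res[of U] unfolding normalizer_def vanishing_F_def by auto

text \<open>In [X, f Y] = X(f) Y + f [X, Y] the function X(f) vanishes at \<open>m\<close> because X
  does, and [X, Y] stays in \<open>F\<close>; both summands therefore have a coefficient in the
  ideal of \<open>m\<close>.\<close>

lemma normalizer_ideal_times:
  assumes W: "opn M W" and X: "X \<in> normalizer W" and "Y \<in> ideal_times M F m W"
  shows "vbracket X Y \<in> ideal_times M F m W"
  using assms(3)
proof (induction rule: ideal_times_induct)
  case zero
  then show "vbracket X 0 \<in> ideal_times M F m W" using ideal_times_0 X by (simp add: normalizer_def vbracket_0(1)[of X W])
next
  case (add f Y X')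
  have Xv: "X \<in> vfields M W" using X by (simp add: normalizer_def)
  have Yv: "Y \<in> vfields M W" and fYv: "vsmult f Y \<in> vfields M W" and X'v: "X' \<in> vfields M W"
    using add W F_vfields F_vsmult ideal_times_subset by (auto simp: vanishing_F_def)
  have "vbracket X (X' + vsmult f Y) = vbracket X X' + (vsmult (X W f) Y + vsmult f (vbracket X Y))"
    using add W by (simp add: vbracket_add_right[OF Xv X'v fYv] vbracket_vsmult[OF Xv Yv])
  moreover have "X W f m = 0" using X by (simp add: normalizer_def vanishes_at_def)
  ultimately show "vbracket X (X' + vsmult f Y) \<in> ideal_times M F m W"
    using add vf_funs[OF Xv W subset_refl] normalizer_vbracket[OF W X]
    by (auto intro!: ideal_times_add ideal_times_vsmult)
qed

section \<open>Germs at the point\<close>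

definition nbhd :: "'m set \<Rightarrow> bool"
  where "nbhd W \<longleftrightarrow> opn M W \<and> m \<in> W"

lemma nbhd_Int: "nbhd U \<Longrightarrow> nbhd V \<Longrightarrow> nbhd (U \<inter> V)"
  by (auto simp: nbhd_def)

lemma nbhd_pts: "nbhd (pts M)"
  by (simp add: nbhd_def m_in)

text \<open>Germs as a filter on open sets instead of a quotient: finding a common neighbourhood for
  finitely many conditions becomes an instance of \<open>eventually_elim\<close>.\<close>

definition small :: "'m set filter"
  where "small = Abs_filter (\<lambda>P. \<exists>U. nbhd U \<and> (\<forall>W. nbhd W \<and> W \<subseteq> U \<longrightarrow> P W))"

lemma eventually_small: "eventually P small \<longleftrightarrow> (\<exists>U. nbhd U \<and> (\<forall>W. nbhd W \<and> W \<subseteq> U \<longrightarrow> P W))"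
  unfolding small_def
proof (rule eventually_Abs_filter, rule is_filter.intro)
  fix P Q :: "'m set \<Rightarrow> bool"
  assume "\<exists>U. nbhd U \<and> (\<forall>W. nbhd W \<and> W \<subseteq> U \<longrightarrow> P W)" "\<exists>U. nbhd U \<and> (\<forall>W. nbhd W \<and> W \<subseteq> U \<longrightarrow> Q W)"
  then obtain U V where "nbhd U" "\<forall>W. nbhd W \<and> W \<subseteq> U \<longrightarrow> P W" "nbhd V" "\<forall>W. nbhd W \<and> W \<subseteq> V \<longrightarrow> Q W"
    by blast
  then show "\<exists>U. nbhd U \<and> (\<forall>W. nbhd W \<and> W \<subseteq> U \<longrightarrow> P W \<and> Q W)"
    by (intro exI[of _ "U \<inter> V"]) (auto simp: nbhd_Int)
qed (use nbhd_pts in blast)+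

lemma small_subset: "nbhd U \<Longrightarrow> \<forall>\<^sub>F W in small. opn M W \<and> nbhd W \<and> W \<subseteq> U"
  unfolding eventually_small by (rule exI[of _ U]) (simp add: nbhd_def)

lemma small_nbhd: "\<forall>\<^sub>F W in small. opn M W \<and> nbhd W"
  using small_subset[OF nbhd_pts] by eventually_elim simp

lemma small_ex: "\<forall>\<^sub>F W in small. P W \<Longrightarrow> \<exists>W. nbhd W \<and> P W"
  by (auto simp: eventually_small)

text \<open>A total function stands for the germ of its small restrictions; its behaviour on large
  open sets is unconstrained. Equality of germs is the separate relation
  \<open>germ_eq\<close>.\<close>

definition germs :: "('m set \<Rightarrow> ('m, 'k) vfield set) \<Rightarrow> ('m, 'k) vfield set"
  where "germs P = {X. \<forall>\<^sub>F W in small. vres W X \<in> P W}"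

definition germ_eq :: "('m, 'k) vfield \<Rightarrow> ('m, 'k) vfield \<Rightarrow> bool"
  where "germ_eq X Y \<longleftrightarrow> (\<forall>\<^sub>F W in small. vres W X = vres W Y)"

lemma germ_eq_sym: "germ_eq X Y \<Longrightarrow> germ_eq Y X"
  unfolding germ_eq_def by (simp add: eq_commute)

lemma germs_cong:
  assumes "germ_eq X Y" and "X \<in> germs P"
  shows "Y \<in> germs P"
  using assms unfolding germ_eq_def germs_def mem_Collect_eq by eventually_elim simp

lemma germ_eq_vres: "nbhd U \<Longrightarrow> germ_eq (vres U X) X"
  unfolding germ_eq_def by (drule small_subset, erule eventually_mono) (simp add: vres_vres)

lemma germs_mono:
  assumes "\<And>W X. nbhd W \<Longrightarrow> opn M W \<Longrightarrow> X \<in> P W \<Longrightarrow> X \<in> Q W" and "X \<in> germs P"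
  shows "X \<in> germs Q"
  using assms(2) small_nbhd unfolding germs_def mem_Collect_eq
  by eventually_elim (auto intro: assms(1))

text \<open>The device by which every closure property over a fixed open set passes to germs. Unary
  operations are instances that ignore the second argument.\<close>

lemma germs_map2:
  assumes "\<And>W X Y. nbhd W \<Longrightarrow> opn M W \<Longrightarrow> X \<in> P W \<Longrightarrow> Y \<in> Q W \<Longrightarrow> f X Y \<in> R W"
    and "\<And>W. vres W (f X Y) = f (vres W X) (vres W Y)"
    and "X \<in> germs P" and "Y \<in> germs Q"
  shows "f X Y \<in> germs R"
  using assms(3,4) small_nbhd unfolding germs_def mem_Collect_eq
  by eventually_elim (auto simp: assms(2) intro: assms(1))

section \<open>Closure properties and congruences of germs\<close>

abbreviation "gV \<equiv> germs (vfields M)"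
abbreviation "gF \<equiv> germs F"
abbreviation "gF0 \<equiv> germs vanishing_F"
abbreviation "gI \<equiv> germs (ideal_times M F m)"
abbreviation "gN \<equiv> germs normalizer"

lemma gF_gV: "X \<in> gF \<Longrightarrow> X \<in> gV"
  and gF0_gF: "X \<in> gF0 \<Longrightarrow> X \<in> gF"
  and gI_gF0: "X \<in> gI \<Longrightarrow> X \<in> gF0"
  and gF0_gN: "X \<in> gF0 \<Longrightarrow> X \<in> gN"
  and gN_gV: "X \<in> gN \<Longrightarrow> X \<in> gV"
  by (erule germs_mono[rotated];
      use F_vfields ideal_times_subset vanishing_F_subset_normalizer in
      \<open>auto simp: vanishing_F_def normalizer_def\<close>)+

lemma gF0_add: "X \<in> gF0 \<Longrightarrow> Y \<in> gF0 \<Longrightarrow> X + Y \<in> gF0"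
  using germs_map2[of vanishing_F vanishing_F "(+)" vanishing_F X Y]
  by (simp add: F_add vres_add vanishing_F_def vanishes_at_closed)

lemma gI_add: "X \<in> gI \<Longrightarrow> Y \<in> gI \<Longrightarrow> X + Y \<in> gI"
  using germs_map2[of "ideal_times M F m" "ideal_times M F m" "(+)" "ideal_times M F m" X Y]
  by (simp add: ideal_times_add vres_add)

lemma gF_vscale: "X \<in> gF \<Longrightarrow> vscale c X \<in> gF"
  using germs_map2[of F F "\<lambda>X _. vscale c X" F X X] by (simp add: F_vscale vres_vscale)

lemma gF0_vscale: "X \<in> gF0 \<Longrightarrow> vscale c X \<in> gF0"
  using germs_map2[of vanishing_F vanishing_F "\<lambda>X _. vscale c X" vanishing_F X X]
  by (simp add: F_vscale vres_vscale vanishing_F_def vanishes_at_closed)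

lemma gI_vscale: "X \<in> gI \<Longrightarrow> vscale c X \<in> gI"
  using germs_map2[of "ideal_times M F m" "ideal_times M F m" "\<lambda>X _. vscale c X" "ideal_times M F m" X X]
  by (simp add: ideal_times_vscale vres_vscale)

lemma gF_uminus: "X \<in> gF \<Longrightarrow> - X \<in> gF"
  and gF0_uminus: "X \<in> gF0 \<Longrightarrow> - X \<in> gF0"
  and gI_uminus: "X \<in> gI \<Longrightarrow> - X \<in> gI"
  using gF_vscale[of X "- 1"] gF0_vscale[of X "- 1"] gI_vscale[of X "- 1"]
  by (simp_all add: vscale_minus1)

lemma gF0_diff: "X \<in> gF0 \<Longrightarrow> Y \<in> gF0 \<Longrightarrow> X - Y \<in> gF0"
  and gI_diff: "X \<in> gI \<Longrightarrow> Y \<in> gI \<Longrightarrow> X - Y \<in> gI"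
  using gF0_add[of X "- Y"] gI_add[of X "- Y"] gF0_uminus[of Y] gI_uminus[of Y]
  by simp_all

lemma gI_0: "0 \<in> gI"
  by (simp add: germs_def ideal_times_0)

lemma gI_minus_commute: "X - Y \<in> gI \<Longrightarrow> Y - X \<in> gI"
  using gI_uminus[of "X - Y"] by simp

lemma gI_trans: "X - Y \<in> gI \<Longrightarrow> Y - Z \<in> gI \<Longrightarrow> X - Z \<in> gI"
  using gI_add[of "X - Y" "Y - Z"] by simp

lemma germ_eq_gI:
  assumes "germ_eq X Y" shows "X - Y \<in> gI"
  using assms unfolding germ_eq_def germs_def mem_Collect_eq
  by eventually_elim (simp add: vres_diff ideal_times_0)

lemma gN_gI: "X \<in> gN \<Longrightarrow> Y \<in> gI \<Longrightarrow> vbracket X Y \<in> gI"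
  using germs_map2[of normalizer "ideal_times M F m" "vbracket" "ideal_times M F m" X Y]
  by (simp add: normalizer_ideal_times vres_vbracket)

lemma normalizer_vanishing_F:
  "opn M W \<Longrightarrow> X \<in> normalizer W \<Longrightarrow> Y \<in> vanishing_F W \<Longrightarrow> vbracket X Y \<in> vanishing_F W"
  using normalizer_vbracket[of W X Y] vanishes_at_vbracket[of m X Y]
  by (simp add: vanishing_F_def normalizer_def)

lemma gN_gF0: "X \<in> gN \<Longrightarrow> Y \<in> gF0 \<Longrightarrow> vbracket X Y \<in> gF0"
  using germs_map2[of normalizer vanishing_F "vbracket" vanishing_F X Y]
  by (simp add: normalizer_vanishing_F vres_vbracket)

text \<open>Only an equality of germs: the bracket of two total functions is bilinear once they are
  derivations, and the arguments are known to restrict to derivations only near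
  \<open>m\<close>.\<close>

lemma germ_vbracket_diff_right:
  assumes "X \<in> gV" and "Y \<in> gV" and "Z \<in> gV"
  shows "germ_eq (vbracket X (Y - Z)) (vbracket X Y - vbracket X Z)"
  using assms unfolding germs_def germ_eq_def mem_Collect_eq
  by eventually_elim (simp add: vres_vbracket vres_diff vbracket_diff_right)

lemma germ_vbracket_diff_left:
  assumes "X \<in> gV" and "Y \<in> gV" and "Z \<in> gV"
  shows "germ_eq (vbracket (X - Y) Z) (vbracket X Z - vbracket Y Z)"
  using assms unfolding germs_def germ_eq_def mem_Collect_eq
  by eventually_elim (simp add: vres_vbracket vres_diff vbracket_diff_left)

lemma germ_vbracket_add_right:
  assumes "X \<in> gV" and "Y \<in> gV" and "Z \<in> gV"
  shows "germ_eq (vbracket X (Y + Z)) (vbracket X Y + vbracket X Z)"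
  using assms unfolding germs_def germ_eq_def mem_Collect_eq
  by eventually_elim (simp add: vres_vbracket vres_add vbracket_add_right)

lemma germ_vbracket_scale_right:
  assumes "X \<in> gV" and "Y \<in> gV"
  shows "germ_eq (vbracket X (vscale c Y)) (vscale c (vbracket X Y))"
  using assms unfolding germs_def germ_eq_def mem_Collect_eq
  by eventually_elim (simp add: vres_vbracket vres_vscale vbracket_scale_right)

lemma germ_vbracket_jacobi:
  assumes "X \<in> gV" and "Y \<in> gV" and "Z \<in> gV"
  shows "germ_eq (vbracket X (vbracket Y Z)) (vbracket (vbracket X Y) Z + vbracket Y (vbracket X Z))"
  using assms unfolding germs_def germ_eq_def mem_Collect_eq
  by eventually_elim (simp only: vres_vbracket vres_add vbracket_jacobi[symmetric])

section \<open>Germs whose isotropy class is central\<close>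

definition gZ :: "('m, 'k) vfield set"
  where "gZ = {X \<in> gF0. \<forall>Y\<in>gF0. vbracket X Y \<in> gI}"

lemma gZ_gF0: "X \<in> gZ \<Longrightarrow> X \<in> gF0"
  by (simp add: gZ_def)

lemma gZ_right: "Y \<in> gF0 \<Longrightarrow> X \<in> gZ \<Longrightarrow> vbracket Y X \<in> gI"
  using gI_uminus[of "vbracket X Y"] by (simp add: gZ_def vbracket_swap[of Y])

lemma gZI: "X \<in> gF0 \<Longrightarrow> (\<And>Y. Y \<in> gF0 \<Longrightarrow> vbracket Y X \<in> gI) \<Longrightarrow> X \<in> gZ"
  using gI_uminus unfolding gZ_def by (auto simp: vbracket_swap[of X])

lemmas germ_incl = gZ_gF0 gF0_gF gF_gV gN_gV gF0_gN gI_gF0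

lemma gI_gZ: "X \<in> gI \<Longrightarrow> X \<in> gZ"
  by (rule gZI) (auto intro: germ_incl gN_gI)

lemma gZ_add:
  assumes "X \<in> gZ" and "Y \<in> gZ" shows "X + Y \<in> gZ"
proof (rule gZI)
  fix Z assume Z: "Z \<in> gF0"
  then have "vbracket Z X + vbracket Z Y \<in> gI" using assms gZ_right gI_add by blast
  then show "vbracket Z (X + Y) \<in> gI"
    using germ_vbracket_add_right[of Z X Y] Z assms germs_cong germ_eq_sym germ_incl by metis
qed (use assms gF0_add gZ_gF0 in auto)

lemma gZ_vscale:
  assumes "X \<in> gZ" shows "vscale c X \<in> gZ"
proof (rule gZI)
  fix Z assume Z: "Z \<in> gF0"
  then have "vscale c (vbracket Z X) \<in> gI" using assms gZ_right gI_vscale by blast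
  then show "vbracket Z (vscale c X) \<in> gI"
    using germ_vbracket_scale_right[of Z X c] Z assms germs_cong germ_eq_sym germ_incl by metis
qed (use assms gF0_vscale gZ_gF0 in auto)

lemma gZ_cong: "X \<in> gZ \<Longrightarrow> X - Y \<in> gI \<Longrightarrow> Y \<in> gZ"
  using gZ_add[of X "Y - X"] gI_gZ gI_minus_commute by simp

text \<open>A derivation preserves the centre. By Jacobi [Z, [X, Y]] = [X, [Z, Y]] - [[X, Z], Y];
  the first term is in \<open>gI\<close> because X normalizes \<open>gI\<close>, the second because
  [X, Z] is again in \<open>gF0\<close> and Y is central.\<close>

lemma gN_gZ:
  assumes X: "X \<in> gN" and Y: "Y \<in> gZ" shows "vbracket X Y \<in> gZ"
proof (rule gZI)
  fix Z assume Z: "Z \<in> gF0"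
  have "vbracket X (vbracket Z Y) \<in> gI" using X Y Z gN_gI gZ_right by blast
  then have "vbracket (vbracket X Z) Y + vbracket Z (vbracket X Y) \<in> gI"
    using germ_vbracket_jacobi[of X Z Y] X Y Z germs_cong germ_incl by metis
  moreover have "vbracket (vbracket X Z) Y \<in> gI" using X Y Z gN_gF0 gZ_right by blast
  ultimately show "vbracket Z (vbracket X Y) \<in> gI" using gI_diff by fastforce
qed (use assms gN_gF0 gZ_gF0 in auto)

lemma gN_congr:
  assumes "X \<in> gN" "Y \<in> gV" "Z \<in> gV" "Y - Z \<in> gI"
  shows "vbracket X Y - vbracket X Z \<in> gI"
  using gN_gI[OF assms(1,4)] germ_vbracket_diff_right[of X Y Z] assms germs_cong germ_incl by metis

end

text \<open>The index \<open>1\<close> of E_{-1} would otherwise be rewritten to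
  \<open>Suc 0\<close> and no longer match the facts about \<open>sec A 1\<close>.\<close>

declare One_nat_def [simp del]

context foliated_point
begin

section \<open>The isotropy Lie algebra\<close>

lemma gI_I:
  assumes "nbhd W" and "vres W X \<in> ideal_times M F m W"
  shows "X \<in> gI"
  unfolding germs_def mem_Collect_eq using small_subset[OF assms(1)]
proof eventually_elim
  case (elim V)
  then show ?case
    using ideal_times_res[OF _ _ _ _ assms(2), of V] assms(1) by (simp add: nbhd_def vres_vres)
qed

lemma gF_I:
  assumes "nbhd W" and "vres W X \<in> F W"
  shows "X \<in> gF"
  unfolding germs_def mem_Collect_eq using small_subset[OF assms(1)]
proof eventually_elim
  case (elim V)
  then show ?case
    using F_res[OF _ _ _ assms(2), of V] assms(1) by (simp add: nbhd_def vres_vres)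
qed

lemma gF0_I:
  assumes "X \<in> gF" and "vanishes_at m X"
  shows "X \<in> gF0"
  using assms(1) unfolding germs_def mem_Collect_eq
  by eventually_elim (simp add: vanishing_F_def vanishes_at_vres[OF assms(2)])

text \<open>The isotropy class of a germ without reference to a neighbourhood. It agrees with
  \<open>isotropy_class\<close> on genuine representatives, but also makes sense for a total
  function that is a vector field only near \<open>m\<close>.\<close>

definition iso_class :: "('m, 'k) vfield \<Rightarrow> ('m set \<times> ('m, 'k) vfield) set"
  where "iso_class X = {(V, Y) \<in> isotropy_reps M F m. X - Y \<in> gI}"

lemma isotropy_reps_gF0:
  assumes "(U, X) \<in> isotropy_reps M F m"
  shows "nbhd U" and "X \<in> gF0"
proof -
  have U: "nbhd U" and X: "X \<in> F U" "vanishes_at m X"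
    using assms by (auto simp: isotropy_reps_def nbhd_def)
  show "nbhd U" by fact
  show "X \<in> gF0"
    using X U vres_self[OF F_vfields[of U X]] by (auto simp: nbhd_def intro!: gF0_I gF_I[OF U])
qed

lemma gF0_isotropy_reps:
  assumes "X \<in> gF0"
  obtains U where "nbhd U" and "(U, vres U X) \<in> isotropy_reps M F m"
proof -
  obtain U where "nbhd U" "vres U X \<in> vanishing_F U"
    using assms small_ex[of "\<lambda>U. vres U X \<in> vanishing_F U"] unfolding germs_def by auto
  then show thesis using that by (auto simp: isotropy_reps_def nbhd_def vanishing_F_def)
qed

lemma isotropy_class_eq:
  assumes "(U, X) \<in> isotropy_reps M F m"
  shows "isotropy_class M F m U X = iso_class X"
proof -
  have "(\<exists>W. opn M W \<and> m \<in> W \<and> W \<subseteq> U \<inter> V \<and> vres W X - vres W Y \<in> ideal_times M F m W) \<longleftrightarrow>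
      X - Y \<in> gI" (is "?L = ?R") if V: "(V, Y) \<in> isotropy_reps M F m" for V Y
  proof
    assume ?L then show ?R using gI_I[of _ "X - Y"] by (auto simp: vres_diff nbhd_def)
  next
    assume R: ?R
    have UV: "nbhd (U \<inter> V)" using isotropy_reps_gF0 assms V nbhd_Int by blast
    have "\<forall>\<^sub>F W in small. opn M W \<and> m \<in> W \<and> W \<subseteq> U \<inter> V \<and>
        vres W X - vres W Y \<in> ideal_times M F m W"
      using R small_subset[OF UV] unfolding germs_def mem_Collect_eq
      by eventually_elim (simp add: nbhd_def vres_diff)
    then show ?L using small_ex by blast
  qed
  then show ?thesis using assms by (auto simp: isotropy_rel_def iso_class_def)
qed

lemma iso_class_cong:
  assumes "X - Y \<in> gI"
  shows "iso_class X = iso_class Y"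
  using gI_trans[of X Y] gI_trans[of Y X] gI_minus_commute[OF assms] assms
  by (auto simp: iso_class_def)

lemma iso_class_member:
  assumes "X \<in> gF0"
  obtains V Y where "(V, Y) \<in> iso_class X"
proof (rule gF0_isotropy_reps[OF assms])
  fix U assume "nbhd U" "(U, vres U X) \<in> isotropy_reps M F m"
  then show thesis
    using that germ_eq_gI[OF germ_eq_sym[OF germ_eq_vres]] by (auto simp: iso_class_def)
qed

text \<open>A common member of both classes is congruent to both germs. That one exists is where
  \<open>X \<in> gF0\<close> enters; germs outside \<open>gF0\<close> all have the empty
  class.\<close>

lemma iso_class_eq_iff:
  assumes "X \<in> gF0"
  shows "iso_class X = iso_class Y \<longleftrightarrow> X - Y \<in> gI"
proof
  assume eq: "iso_class X = iso_class Y"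
  obtain V Z where "(V, Z) \<in> iso_class X" using iso_class_member[OF assms] .
  moreover from this have "(V, Z) \<in> iso_class Y" using eq by simp
  ultimately show "X - Y \<in> gI"
    using gI_trans[of X Z Y] gI_minus_commute[of Y Z] by (auto simp: iso_class_def)
qed (rule iso_class_cong)

lemma isotropy_eq: "isotropy M F m = iso_class ` gF0"
proof (intro equalityI subsetI)
  fix a assume "a \<in> isotropy M F m"
  then show "a \<in> iso_class ` gF0"
    unfolding isotropy_def quotient_def by (auto simp: isotropy_class_eq intro!: imageI dest: isotropy_reps_gF0(2))
next
  fix a assume "a \<in> iso_class ` gF0"
  then obtain X where X: "X \<in> gF0" "a = iso_class X" by blast
  obtain U where U: "nbhd U" "(U, vres U X) \<in> isotropy_reps M F m"
    using gF0_isotropy_reps[OF X(1)] .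
  have "isotropy_class M F m U (vres U X) = a"
    using isotropy_class_eq[OF U(2)] iso_class_cong[OF germ_eq_gI[OF germ_eq_vres[OF U(1)]]] X(2)
    by simp
  then show "a \<in> isotropy M F m"
    unfolding isotropy_def quotient_def using U(2) by blast
qed

text \<open>The arguments are exchanged one at a time. Congruence is available in the second slot of
  the bracket, so the first slot is reached through antisymmetry.\<close>

lemma gF0_vbracket_cong:
  assumes "X \<in> gF0" "X' \<in> gF0" "Y \<in> gF0" "Y' \<in> gF0" and "X - X' \<in> gI" and "Y - Y' \<in> gI"
  shows "vbracket X Y - vbracket X' Y' \<in> gI"
proof (rule gI_trans)
  show "vbracket X Y - vbracket X Y' \<in> gI" using gN_congr[of X Y Y'] assms by (simp add: germ_incl)
  have "vbracket Y' X' - vbracket Y' X \<in> gI"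
    using gN_congr[of Y' X' X] assms gI_minus_commute[of X X'] by (simp add: germ_incl)
  then show "vbracket X Y' - vbracket X' Y' \<in> gI" by (simp add: vbracket_swap[of _ Y'])
qed

lemma isotropy_bracket_eq:
  assumes X: "X \<in> gF0" and Y: "Y \<in> gF0"
  shows "isotropy_bracket M F m (iso_class X) (iso_class Y) = iso_class (vbracket X Y)"
proof -
  have *: "isotropy_class M F m (U \<inter> V) (vbracket (vres (U \<inter> V) X') (vres (U \<inter> V) Y')) =
      iso_class (vbracket X Y)"
    if "(U, X') \<in> iso_class X" "(V, Y') \<in> iso_class Y" for U X' V Y'
  proof -
    have UX: "(U, X') \<in> isotropy_reps M F m" "X - X' \<in> gI"
      and VY: "(V, Y') \<in> isotropy_reps M F m" "Y - Y' \<in> gI"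
      using that by (auto simp: iso_class_def)
    have UV: "nbhd (U \<inter> V)" using isotropy_reps_gF0 UX VY nbhd_Int by blast
    have "vbracket (vres (U \<inter> V) X') (vres (U \<inter> V) Y') \<in> F (U \<inter> V)"
      using UX VY UV by (intro F_vbracket F_res[of U] F_res[of V]) (auto simp: isotropy_reps_def nbhd_def)
    then have "(U \<inter> V, vbracket (vres (U \<inter> V) X') (vres (U \<inter> V) Y')) \<in> isotropy_reps M F m"
      using UX VY UV
      by (auto simp: isotropy_reps_def nbhd_def intro!: vanishes_at_vbracket vanishes_at_vres)
    then have "isotropy_class M F m (U \<inter> V) (vbracket (vres (U \<inter> V) X') (vres (U \<inter> V) Y')) =
        iso_class (vres (U \<inter> V) (vbracket X' Y'))"
      by (simp add: isotropy_class_eq vres_vbracket)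
    also have "\<dots> = iso_class (vbracket X' Y')"
      by (rule iso_class_cong[OF germ_eq_gI[OF germ_eq_vres[OF UV]]])
    also have "\<dots> = iso_class (vbracket X Y)"
      using X Y UX VY isotropy_reps_gF0
      by (intro iso_class_cong gF0_vbracket_cong) (auto intro: gI_minus_commute)
    finally show ?thesis .
  qed
  \<comment> \<open>Both index sets of the defining union must be inhabited; otherwise the union of
    the coinciding classes would be empty.\<close>
  obtain p q where "p \<in> iso_class X" "q \<in> iso_class Y"
    using iso_class_member X Y by metis
  then show ?thesis
    unfolding isotropy_bracket_def using * by (auto simp: split_beta)
qed

lemma isotropy_class_0: "isotropy_class M F m (pts M) 0 = iso_class 0"
  using nbhd_pts by (intro isotropy_class_eq) (auto simp: isotropy_reps_def nbhd_def F_0)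

lemma isotropy_center_iff:
  assumes "X \<in> gF0"
  shows "iso_class X \<in> isotropy_center M F m \<longleftrightarrow> X \<in> gZ"
  using assms gN_gF0[OF gF0_gN[OF assms]] iso_class_eq_iff[of _ 0]
  unfolding isotropy_center_def isotropy_class_0 isotropy_eq gZ_def
  by (auto simp: isotropy_bracket_eq)

text \<open>The relation holds only between representatives, so the class of a pair that is not one
  is empty, whereas an element of the isotropy algebra is not. Centrality of the class therefore
  already forces X into \<open>F\<close> and to vanish at \<open>m\<close>.\<close>

lemma isotropy_center_class:
  assumes "isotropy_class M F m U X \<in> isotropy_center M F m"
  shows "X \<in> gZ" and "vanishes_at m X"
proof -
  have "isotropy_class M F m U X \<in> iso_class ` gF0"
    using assms isotropy_eq by (simp add: isotropy_center_def)
  then have "isotropy_class M F m U X \<noteq> {}" using iso_class_member by blast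
  then have UX: "(U, X) \<in> isotropy_reps M F m" by (auto simp: isotropy_rel_def)
  then show "X \<in> gZ"
    using assms isotropy_center_iff isotropy_reps_gF0 by (simp add: isotropy_class_eq)
  show "vanishes_at m X" using UX by (simp add: isotropy_reps_def)
qed

end

lemma vres_vsmult_left: "vres W (vsmult f X) = vsmult f (vres W X)"
  for X :: "('m, 'k::real_normed_field) vfield"
  by (simp add: fun_eq_iff vsmult_def)

lemma sum_fun_apply: "(\<Sum>i\<in>I. f i) p = (\<Sum>i\<in>I. f i p)"
  for f :: "'i \<Rightarrow> 'a \<Rightarrow> 'b::comm_monoid_add"
  by (induction I rule: infinite_finite_induct) simp_all

section \<open>The fibre at the point and germs of the foliation\<close>

locale minimal_algebroid = foliated_point M F m
  for M :: "('m, 'k::real_normed_field) base" and F and m :: 'm +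
  fixes A :: "('m, 'k, 'v::ab_group_add) algebroid"
  assumes universal: "universal_algebroid M F A" and minimal: "minimal_at M m A"
begin

lemma lie_structure: "lie_infinity_structure M A"
  using universal by (simp add: universal_algebroid_def lie_infinity_algebroid_def)

lemma anchored_bundle: "vector_bundle M (scl A) (fib A 1) (sec A 1)"
  using universal by (simp add: universal_algebroid_def lie_infinity_algebroid_def)

sublocale vector_space "scl A"
  using anchored_bundle by (simp add: vector_bundle_def)

lemma sheaf: "section_sheaf M (sec A 1)"
  using anchored_bundle by (simp add: vector_bundle_def)

lemmas sec_res = section_sheaf_res[OF sheaf]

lemma anch_struct:
  assumes "opn M U" and "\<sigma> \<in> sec A 1 U"
  shows "anch A U \<sigma> \<in> vfields M U"
    and "\<tau> \<in> sec A 1 U \<Longrightarrow> anch A U (\<sigma> + \<tau>) = anch A U \<sigma> + anch A U \<tau>"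
    and "f \<in> funs M U \<Longrightarrow> anch A U (smul (scl A) f \<sigma>) = vsmult f (anch A U \<sigma>)"
    and "opn M W \<Longrightarrow> W \<subseteq> U \<Longrightarrow> anch A W (res W \<sigma>) = vres W (anch A U \<sigma>)"
  using assms lie_structure[unfolded lie_infinity_structure_def, THEN conjunct2, THEN conjunct2,
      THEN conjunct1] by simp_all

lemma anch_F: "opn M U \<Longrightarrow> \<sigma> \<in> sec A 1 U \<Longrightarrow> anch A U \<sigma> \<in> F U"
  and anch_surj: "opn M U \<Longrightarrow> X \<in> F U \<Longrightarrow> p \<in> U \<Longrightarrow>
    \<exists>W. opn M W \<and> p \<in> W \<and> W \<subseteq> U \<and> (\<exists>\<sigma>\<in>sec A 1 W. anch A W \<sigma> = vres W X)"
  and anch_eq_0D: "opn M U \<Longrightarrow> \<sigma> \<in> sec A 1 U \<Longrightarrow> anch A U \<sigma> = 0 \<Longrightarrow> p \<in> U \<Longrightarrow>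
    \<exists>W. opn M W \<and> p \<in> W \<and> W \<subseteq> U \<and> (\<exists>\<tau>\<in>sec A 2 W. brk A W [(2, \<tau>)] = res W \<sigma>)"
  using universal[unfolded universal_algebroid_def, THEN conjunct2] by simp_all

definition frame :: "'m set \<Rightarrow> nat \<Rightarrow> (nat \<Rightarrow> 'm \<Rightarrow> 'v) \<Rightarrow> bool"
  where "frame U r b \<longleftrightarrow> nbhd U \<and>
    (\<forall>q\<in>U. \<forall>c. (\<Sum>i<r. scl A (c i) (b i q)) = 0 \<longrightarrow> (\<forall>i<r. c i = 0)) \<and>
    (\<forall>W. opn M W \<and> W \<subseteq> U \<longrightarrow>
      sec A 1 W = {\<Sum>i<r. smul (scl A) (f i) (b i) | f. \<forall>i<r. f i \<in> funs M W})"

lemma frame_exists: obtains U r b where "frame U r b"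
proof -
  obtain U r b where U: "opn M U" "m \<in> U"
    and b: "\<forall>q\<in>U. fib A 1 q = {\<Sum>i<r. scl A (c i) (b i q) | c. True} \<and>
          (\<forall>c. (\<Sum>i<r. scl A (c i) (b i q)) = 0 \<longrightarrow> (\<forall>i<r. c i = 0))"
      "\<forall>W. opn M W \<and> W \<subseteq> U \<longrightarrow>
          sec A 1 W = {\<Sum>i<r::nat. smul (scl A) (f i) (b i) | f. \<forall>i<r. f i \<in> funs M W}"
    using anchored_bundle[unfolded vector_bundle_def, THEN conjunct2, THEN conjunct2, THEN conjunct2,
        THEN bspec, OF m_in]
    by (elim exE conjE)
  show thesis
  proof (rule that[of U r b], unfold frame_def, intro conjI)
    show "nbhd U" using U by (simp add: nbhd_def)
  qed (use b(1) in simp, rule b(2))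
qed

lemma frame_sec:
  assumes "frame U r b" and "opn M W" and "W \<subseteq> U"
  shows "sec A 1 W = {\<Sum>i<r. smul (scl A) (f i) (b i) | f. \<forall>i<r. f i \<in> funs M W}"
  using assms by (simp add: frame_def)

lemma smul_apply: "smul (scl A) f \<sigma> p = scl A (f p) (\<sigma> p)"
  by (simp add: smul_def)

text \<open>The bundle axioms describe sections through local frames, so the module structure is
  read off the coefficients, over open sets inside a frame domain.\<close>

lemma frame_sec_add:
  assumes "frame U r b" and "opn M W" and "W \<subseteq> U" and "\<sigma> \<in> sec A 1 W" and "\<tau> \<in> sec A 1 W"
  shows "\<sigma> + \<tau> \<in> sec A 1 W"
proof -
  obtain f h where fh: "\<forall>i<r. f i \<in> funs M W" "\<forall>i<r. h i \<in> funs M W"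
    and eq: "\<sigma> = (\<Sum>i<r. smul (scl A) (f i) (b i))" "\<tau> = (\<Sum>i<r. smul (scl A) (h i) (b i))"
    using assms(4,5) unfolding frame_sec[OF assms(1-3)] by auto
  have "\<sigma> + \<tau> = (\<Sum>i<r. smul (scl A) ((f i) + (h i)) (b i))"
    by (simp add: eq fun_eq_iff sum_fun_apply smul_apply scale_left_distrib sum.distrib)
  then show ?thesis
    unfolding frame_sec[OF assms(1-3)] using fh funs_add[OF assms(2)]
    by (intro CollectI exI[of _ "\<lambda>i. f i + h i"]) simp
qed

lemma frame_sec_smul:
  assumes "frame U r b" and "opn M W" and "W \<subseteq> U" and "\<sigma> \<in> sec A 1 W" and "f \<in> funs M W"
  shows "smul (scl A) f \<sigma> \<in> sec A 1 W"
proof -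
  obtain h where h: "\<forall>i<r. h i \<in> funs M W" and eq: "\<sigma> = (\<Sum>i<r. smul (scl A) (h i) (b i))"
    using assms(4) unfolding frame_sec[OF assms(1-3)] by auto
  have "smul (scl A) f \<sigma> = (\<Sum>i<r. smul (scl A) (f * h i) (b i))"
    by (simp add: eq fun_eq_iff sum_fun_apply smul_apply scale_sum_right)
  then show ?thesis
    unfolding frame_sec[OF assms(1-3)] using h funs_mult[OF assms(2,5)]
    by (intro CollectI exI[of _ "\<lambda>i. f * h i"]) simp
qed

lemma frame_sec_0:
  assumes "frame U r b" and "opn M W" and "W \<subseteq> U"
  shows "0 \<in> sec A 1 W"
  unfolding frame_sec[OF assms] using funs_0[OF assms(2)]
  by (intro CollectI exI[of _ "\<lambda>_. 0"]) (simp add: fun_eq_iff sum_fun_apply smul_apply)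

text \<open>The frame element \<open>b j\<close> need not vanish off \<open>W\<close>, so it is its
  restriction that is a section over \<open>W\<close>; the coefficients are the constant 1 cut down
  to \<open>W\<close> in place \<open>j\<close> and zero elsewhere.\<close>

lemma frame_sec_basis:
  assumes "frame U r b" and W: "opn M W" and "W \<subseteq> U" and "j < r"
  shows "res W (b j) \<in> sec A 1 W"
  unfolding frame_sec[OF assms(1-3)]
proof (intro CollectI exI conjI)
  have "(\<Sum>i<r. scl A ((if i = j then res W (\<lambda>_. 1) else 0) p) (b i p)) = res W (b j) p" for p
    using assms(4) by (simp add: if_distrib[of "\<lambda>c. scl A (c p) _"] res_def cong: if_cong)
  then show "res W (b j) = (\<Sum>i<r. smul (scl A) ((\<lambda>i. if i = j then res W (\<lambda>_. 1) else 0) i) (b i))"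
    by (intro ext) (simp add: sum_fun_apply smul_apply)
qed (auto simp: funs_const funs_0 W)

lemma anch_0:
  assumes "opn M U" and "0 \<in> sec A 1 U"
  shows "anch A U 0 = 0"
  using anch_struct(2)[OF assms assms(2)] by simp

section \<open>Fibre vectors representing germs\<close>

definition rep :: "'v \<Rightarrow> ('m, 'k) vfield \<Rightarrow> bool"
  where "rep v X \<longleftrightarrow> (\<exists>U. nbhd U \<and> (\<exists>\<sigma>\<in>sec A 1 U. \<sigma> m = v \<and> anch A U \<sigma> = vres U X))"

text \<open>Restrictions of one section serve all smaller neighbourhoods. The eventual form allows
  several represented germs to be treated on one common neighbourhood.\<close>

lemma rep_small:
  "rep v X \<longleftrightarrow> (\<forall>\<^sub>F W in small. \<exists>\<sigma>\<in>sec A 1 W. \<sigma> m = v \<and> anch A W \<sigma> = vres W X)"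
proof
  assume "rep v X"
  then obtain U \<sigma> where U: "nbhd U" and \<sigma>: "\<sigma> \<in> sec A 1 U" "\<sigma> m = v" "anch A U \<sigma> = vres U X"
    unfolding rep_def by blast
  show "\<forall>\<^sub>F W in small. \<exists>\<sigma>\<in>sec A 1 W. \<sigma> m = v \<and> anch A W \<sigma> = vres W X"
    using small_subset[OF U]
  proof eventually_elim
    case (elim W)
    then show ?case
      using U \<sigma> sec_res[of U W \<sigma>] anch_struct(4)[of U \<sigma> W]
      by (intro bexI[of _ "res W \<sigma>"]) (auto simp: nbhd_def res_apply vres_vres)
  qed
next
  assume "\<forall>\<^sub>F W in small. \<exists>\<sigma>\<in>sec A 1 W. \<sigma> m = v \<and> anch A W \<sigma> = vres W X"
  then show "rep v X" unfolding rep_def using small_ex by fastforce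
qed

lemma repI: "nbhd U \<Longrightarrow> \<sigma> \<in> sec A 1 U \<Longrightarrow> rep (\<sigma> m) (anch A U \<sigma>)"
  unfolding rep_def using vres_self anch_struct(1) by (metis nbhd_def)

lemma rep_cong: 
  assumes "rep v X" and "germ_eq X Y"
  shows "rep v Y"
  using assms unfolding rep_small germ_eq_def by eventually_elim simp

lemma rep_gF: "rep v X \<Longrightarrow> X \<in> gF"
  unfolding rep_def using gF_I anch_F by (metis nbhd_def)

lemma rep_exists:
  assumes "X \<in> gF"
  shows "\<exists>v. rep v X"
proof -
  obtain U where U: "nbhd U" "vres U X \<in> F U"
    using assms small_ex[of "\<lambda>U. vres U X \<in> F U"] by (auto simp: germs_def)
  then obtain W \<sigma> where W: "opn M W" "m \<in> W" "W \<subseteq> U" and \<sigma>: "\<sigma> \<in> sec A 1 W"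
      "anch A W \<sigma> = vres W (vres U X)"
    using anch_surj[of U "vres U X" m] by (auto simp: nbhd_def)
  then show ?thesis unfolding rep_def by (auto simp: nbhd_def vres_vres)
qed

lemma rep_add:
  assumes "rep v X" and "rep w Y"
  shows "rep (v + w) (X + Y)"
proof -
  obtain U r b where fr: "frame U r b" using frame_exists .
  then have "nbhd U" by (simp add: frame_def)
  from assms small_subset[OF this] show ?thesis
    unfolding rep_small
  proof eventually_elim
    case (elim W)
    then obtain \<sigma> \<tau> where "\<sigma> \<in> sec A 1 W" "\<sigma> m = v" "anch A W \<sigma> = vres W X"
      "\<tau> \<in> sec A 1 W" "\<tau> m = w" "anch A W \<tau> = vres W Y" by blast
    then show ?case
      using elim frame_sec_add[OF fr, of W \<sigma> \<tau>] anch_struct(2)[of W \<sigma> \<tau>]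
      by (intro bexI[of _ "\<sigma> + \<tau>"]) (auto simp: vres_add)
  qed
qed

lemma rep_vsmult:
  assumes "rep v X" and V: "opn M V" "m \<in> V" and f: "f \<in> funs M V"
  shows "rep (scl A (f m) v) (vsmult f X)"
proof -
  obtain U r b where fr: "frame U r b" using frame_exists .
  then have U: "nbhd U" by (simp add: frame_def)
  have "nbhd V" using V by (simp add: nbhd_def)
  from assms(1) small_subset[OF U] small_subset[OF this] show ?thesis
    unfolding rep_small
  proof eventually_elim
    case (elim W)
    then obtain \<sigma> where \<sigma>: "\<sigma> \<in> sec A 1 W" "\<sigma> m = v" "anch A W \<sigma> = vres W X"
      by blast
    have fW: "res W f \<in> funs M W" using elim V f funs_res by blast
    have "vres W X \<in> vfields M W" using \<sigma> elim anch_struct(1)[of W \<sigma>] by simp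
    then have "vres W (vsmult f X) = vsmult (res W f) (vres W X)"
      using vsmult_res[of "vres W X" W f] by (metis vres_vsmult_left)
    then show ?case
      using \<sigma> elim frame_sec_smul[OF fr _ _ _ fW, of \<sigma>] anch_struct(3)[OF _ _ fW, of \<sigma>]
      by (intro bexI[of _ "smul (scl A) (res W f) \<sigma>"]) (auto simp: smul_apply res_apply nbhd_def)
  qed
qed

lemma rep_vscale:
  assumes "rep v X"
  shows "rep (scl A c v) (vscale c X)"
proof -
  have "rep (scl A c v) (vsmult (res (pts M) (\<lambda>_. c)) X)"
    using rep_vsmult[OF assms _ _ funs_const, of "pts M" c] m_in by (simp add: res_def)
  moreover have "germ_eq (vsmult (res (pts M) (\<lambda>_. c)) X) (vscale c X)"
    using gF_gV[OF rep_gF[OF assms]] small_nbhd unfolding germ_eq_def germs_def mem_Collect_eq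
  proof eventually_elim
    case (elim W)
    then have "W \<subseteq> pts M" by (simp add: openin_subset)
    show ?case
    proof (intro ext)
      fix V h p
      show "vres W (vsmult (res (pts M) (\<lambda>_. c)) X) V h p = vres W (vscale c X) V h p"
        using vf_support[of "vres W X" W p V h] elim \<open>W \<subseteq> pts M\<close>
        by (cases "p \<in> V") (auto simp: vsmult_def vscale_def res_def)
    qed
  qed
  ultimately show ?thesis using rep_cong by blast
qed

lemma rep_uminus: "rep v X \<Longrightarrow> rep (- v) (- X)"
  using rep_vscale[of v X "- 1"] by (simp add: vscale_minus1)

lemma rep_diff: "rep v X \<Longrightarrow> rep w Y \<Longrightarrow> rep (v - w) (X - Y)"
  using rep_add[of v X "- w" "- Y"] rep_uminus by simp

text \<open>Some vector represents the zero germ; subtracting that representation from itself leaves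
  0 on both sides.\<close>

lemma rep_0: "rep 0 0"
  using rep_exists[OF gF0_gF[OF gI_gF0[OF gI_0]]] rep_diff by force

text \<open>Minimality enters only here: a section in the kernel of the anchor is a boundary near \<open>m\<close>,
  hence vanishes at \<open>m\<close>.\<close>

lemma rep_of_0:
  assumes "rep v 0"
  shows "v = 0"
proof -
  obtain U \<sigma> where U: "nbhd U" and \<sigma>: "\<sigma> \<in> sec A 1 U" "\<sigma> m = v" "anch A U \<sigma> = 0"
    using assms unfolding rep_def by auto
  obtain W \<tau> where W: "opn M W" "m \<in> W" and \<tau>: "\<tau> \<in> sec A 2 W" "brk A W [(2, \<tau>)] = res W \<sigma>"
    using anch_eq_0D[of U \<sigma> m] U \<sigma> by (auto simp: nbhd_def)
  have "brk A W [(2, \<tau>)] m = 0" using minimal[unfolded minimal_at_def, rule_format, of 2 W \<tau>] W \<tau>(1) by simp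
  then show ?thesis using \<tau> \<sigma> W by (simp add: res_apply)
qed

text \<open>If \<open>w\<close> represents \<open>Y\<close>, then \<open>vsmult f Y\<close> is
  represented by \<open>f m\<close> times \<open>w\<close>, which is 0 for \<open>f\<close> in the
  ideal of \<open>m\<close>.\<close>

lemma ideal_times_rep_0:
  assumes W: "nbhd W" and "X \<in> ideal_times M F m W"
  shows "rep 0 X"
  using assms(2)
proof (induction rule: ideal_times_induct)
  case zero
  show "rep 0 0" by (rule rep_0)
next
  case (add f Y X)
  have "Y \<in> gF" using add W F_vfields[of W Y] vres_self[of Y W] by (intro gF_I[OF W]) (auto simp: nbhd_def)
  then obtain w where "rep w Y" using rep_exists by blast
  then have "rep 0 (vsmult f Y)" using rep_vsmult[of w Y W f] add W by (simp add: nbhd_def)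
  moreover have "rep 0 X" by (rule add)
  ultimately show "rep 0 (X + vsmult f Y)" using rep_add by fastforce
qed

lemma anch_sum:
  assumes fr: "frame U r b" and W: "opn M W" "W \<subseteq> U" and f: "\<And>i. i < r \<Longrightarrow> f i \<in> funs M W"
  shows "anch A W (\<Sum>i<r. smul (scl A) (f i) (b i)) = (\<Sum>i<r. vsmult (f i) (anch A W (res W (b i))))"
proof -
  have eq: "smul (scl A) (f i) (b i) = smul (scl A) (f i) (res W (b i))" if "i < r" for i
    using funs_outside[OF W(1) f[OF that]] by (auto simp: fun_eq_iff smul_apply res_def)
  define S where "S k = (\<Sum>i<k. smul (scl A) (f i) (b i))" for k
  define R where "R k = (\<Sum>i<k. vsmult (f i) (anch A W (res W (b i))))" for k
  have S: "S 0 = 0" "S (Suc k) = S k + smul (scl A) (f k) (b k)"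
    and R: "R 0 = 0" "R (Suc k) = R k + vsmult (f k) (anch A W (res W (b k)))" for k
    by (simp_all only: S_def R_def lessThan_0 sum.empty sum.lessThan_Suc)
  \<comment> \<open>Additivity of the anchor applies to sections only, so membership of the partial
    sums is carried through the induction.\<close>
  have "k \<le> r \<Longrightarrow> S k \<in> sec A 1 W \<and> anch A W (S k) = R k" for k
  proof (induction k)
    case 0
    show ?case unfolding S R using frame_sec_0[OF fr W] anch_0[OF W(1)] by blast
  next
    case (Suc k)
    have k: "k < r" using Suc.prems by simp
    have "smul (scl A) (f k) (b k) \<in> sec A 1 W"
      unfolding eq[OF k] by (rule frame_sec_smul[OF fr W frame_sec_basis[OF fr W k] f[OF k]])
    moreover have "anch A W (smul (scl A) (f k) (b k)) = vsmult (f k) (anch A W (res W (b k)))"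
      unfolding eq[OF k] by (rule anch_struct(3)[OF W(1) frame_sec_basis[OF fr W k] f[OF k]])
    ultimately show ?case
      unfolding S R using Suc frame_sec_add[OF fr W] anch_struct(2)[OF W(1)] by (metis Suc_leD)
  qed
  then show ?thesis unfolding S_def R_def by blast
qed

text \<open>If the vector is zero, independence of the frame at \<open>m\<close> makes all
  coefficients of the section vanish there, and applying the anchor exhibits X as a combination with
  coefficients in the ideal. Conversely a germ in \<open>gI\<close> is also represented by 0, and
  minimality makes the vector unique.\<close>

lemma rep_eq_0_iff:
  assumes "rep v X"
  shows "v = 0 \<longleftrightarrow> X \<in> gI"
proof
  assume "X \<in> gI"
  then obtain W where W: "nbhd W" "vres W X \<in> ideal_times M F m W"
    using small_ex[of "\<lambda>W. vres W X \<in> ideal_times M F m W"] by (auto simp: germs_def)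
  have "rep 0 X"
    using ideal_times_rep_0[OF W] germ_eq_vres[OF W(1)] rep_cong by blast
  then show "v = 0" using rep_diff[OF assms] rep_of_0 by fastforce
next
  assume v: "v = 0"
  obtain U r b where fr: "frame U r b" using frame_exists .
  then have U: "nbhd U" by (simp add: frame_def)
  have "\<forall>\<^sub>F W in small. vres W X \<in> ideal_times M F m W"
    using assms[unfolded rep_small] small_subset[OF U]
  proof eventually_elim
    case (elim W)
    then obtain \<sigma> where \<sigma>: "\<sigma> \<in> sec A 1 W" "\<sigma> m = v" "anch A W \<sigma> = vres W X" and W: "opn M W" "W \<subseteq> U"
      by blast
    then obtain f where f: "\<forall>i<r. f i \<in> funs M W" and eq: "\<sigma> = (\<Sum>i<r. smul (scl A) (f i) (b i))"
      using frame_sec[OF fr W] by auto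
    have "(\<Sum>i<r. scl A (f i m) (b i m)) = 0"
      using \<sigma> v eq by (simp add: sum_fun_apply smul_apply)
    then have f0: "\<forall>i<r. f i m = 0"
      using fr elim U by (auto simp: frame_def nbhd_def dest!: bspec[of _ _ m] spec[of _ "\<lambda>i. f i m"])
    have "vres W X = (\<Sum>i<r. vsmult (f i) (anch A W (res W (b i))))"
      using \<sigma> eq anch_sum[OF fr W] f by simp
    then show ?case
      unfolding ideal_times_def mem_Collect_eq
      using f f0 anch_F[OF W(1) frame_sec_basis[OF fr W]]
      by (intro exI[of _ r] exI[of _ f] exI[of _ "\<lambda>i. anch A W (res W (b i))"]) simp
  qed
  then show "X \<in> gI" by (simp add: germs_def)
qed

lemma rep_eq_iff: "rep v X \<Longrightarrow> rep w Y \<Longrightarrow> v = w \<longleftrightarrow> X - Y \<in> gI"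
  using rep_eq_0_iff[OF rep_diff] by force

lemma rep_unique: "rep v X \<Longrightarrow> rep w Y \<Longrightarrow> X - Y \<in> gI \<Longrightarrow> v = w"
  using rep_eq_iff by blast

lemma rep_gI_cong: 
  assumes "rep v X" and "X - Y \<in> gI"
  shows "rep v Y"
proof -
  obtain w where "rep w (X - Y)" using rep_exists assms(2) gF0_gF gI_gF0 by blast
  then have "rep 0 (X - Y)" using rep_eq_0_iff assms(2) by blast
  then show ?thesis using rep_diff[OF assms(1)] by fastforce
qed

lemma anchor_kernel_eq: "anchor_kernel M m A = {v. \<exists>X\<in>gF0. rep v X}"
proof (intro equalityI subsetI)
  fix v assume "v \<in> anchor_kernel M m A"
  then show "v \<in> {v. \<exists>X\<in>gF0. rep v X}"
    unfolding anchor_kernel_def using repI rep_gF gF0_I by (fastforce simp: nbhd_def)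
next
  fix v assume "v \<in> {v. \<exists>X\<in>gF0. rep v X}"
  then obtain X where "X \<in> gF0" and "rep v X" by blast
  then have "\<forall>\<^sub>F W in small. nbhd W \<and> (\<exists>\<sigma>\<in>sec A 1 W. \<sigma> m = v \<and> anch A W \<sigma> = vres W X) \<and>
      vres W X \<in> vanishing_F W"
    unfolding rep_small germs_def mem_Collect_eq using small_nbhd by eventually_elim simp
  then obtain W where "nbhd W" "\<exists>\<sigma>\<in>sec A 1 W. \<sigma> m = v \<and> anch A W \<sigma> = vres W X" 
      "vres W X \<in> vanishing_F W" using small_ex by blast
  then show "v \<in> anchor_kernel M m A"
    unfolding anchor_kernel_def by (fastforce simp: nbhd_def vanishing_F_def)
qed

lemma isotropy_ident_eq:
  assumes "rep v X" and "X \<in> gF0"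
  shows "isotropy_ident M F m A v = iso_class X"
proof -
  have *: "isotropy_class M F m U (anch A U \<sigma>) = iso_class X"
    if "opn M U" "m \<in> U" "\<sigma> \<in> sec A 1 U" "\<sigma> m = v" for U \<sigma>
  proof -
    have U: "nbhd U" using that by (simp add: nbhd_def)
    have "X - anch A U \<sigma> \<in> gI" using repI[OF U that(3)] that(4) assms rep_eq_iff by blast
    then have F0: "anch A U \<sigma> \<in> gF0" using gF0_diff[OF assms(2) gI_gF0] by fastforce
    have "\<forall>\<^sub>F W in small. nbhd W \<and> W \<subseteq> U \<and> vanishes_at m (vres W (anch A U \<sigma>))"
      using F0 small_subset[OF U] unfolding germs_def mem_Collect_eq
      by eventually_elim (simp add: vanishing_F_def)
    then obtain W where W: "nbhd W" "W \<subseteq> U" "vanishes_at m (vres W (anch A U \<sigma>))"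
      using small_ex by blast
    have vf: "anch A U \<sigma> \<in> vfields M U" using anch_struct(1) that by blast
    \<comment> \<open>Congruence to X gives vanishing only on the small neighbourhood
      \<open>W\<close>, whereas a representative over \<open>U\<close> must vanish when evaluated on
      any \<open>V\<close>. Locality of derivations reduces \<open>V\<close> to its intersection
      with \<open>W\<close>.\<close>
    have "vanishes_at m (anch A U \<sigma>)"
      unfolding vanishes_at_def
    proof (intro allI)
      fix V f
      show "anch A U \<sigma> V f m = 0"
      proof (cases "opn M V \<and> V \<subseteq> U \<and> f \<in> funs M V \<and> m \<in> V")
        case True
        then have V: "opn M V" "V \<subseteq> U" "f \<in> funs M V" "m \<in> V" by auto
        have VW: "opn M (V \<inter> W)" using V(1) W(1) opn_Int unfolding nbhd_def by blast
        have "anch A U \<sigma> V f m = anch A U \<sigma> (V \<inter> W) (res (V \<inter> W) f) m"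
          using vf_res[OF vf V(1-3) VW] V(4) W(1) by (simp add: res_apply nbhd_def)
        also have "\<dots> = vres W (anch A U \<sigma>) (V \<inter> W) (res (V \<inter> W) f) m" by simp
        also have "\<dots> = 0" using W(3) unfolding vanishes_at_def by blast
        finally show ?thesis .
      next
        case False
        then show ?thesis using vf_outside[OF vf, of V f] vf_support[OF vf, of m V f] by fastforce
      qed
    qed
    then have "(U, anch A U \<sigma>) \<in> isotropy_reps M F m"
      using that anch_F by (simp add: isotropy_reps_def)
    then show ?thesis
      using isotropy_class_eq iso_class_cong[OF \<open>X - anch A U \<sigma> \<in> gI\<close>] by simp
  qed
  obtain U \<sigma> where "nbhd U" "\<sigma> \<in> sec A 1 U" "\<sigma> m = v" using assms(1) unfolding rep_def by blast
  then have "{isotropy_class M F m U (anch A U \<sigma>) | U \<sigma>. opn M U \<and> m \<in> U \<and> \<sigma> \<in> sec A 1 U \<and> \<sigma> m = v} =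
      {iso_class X}"
    using * unfolding nbhd_def by blast
  then show ?thesis by (simp add: isotropy_ident_def)
qed

lemma center_in_eq: "center_in M F m A = {v. \<exists>X\<in>gZ. rep v X}"
  unfolding center_in_def anchor_kernel_eq
  using isotropy_ident_eq isotropy_center_iff gZ_gF0 by auto

lemma center_in_I: "rep v X \<Longrightarrow> X \<in> gZ \<Longrightarrow> v \<in> center_in M F m A"
  unfolding center_in_eq by blast

lemma center_in_rep:
  assumes "v \<in> center_in M F m A" and "rep v X"
  shows "X \<in> gZ"
proof -
  obtain Y where "Y \<in> gZ" "rep v Y" using assms(1) unfolding center_in_eq by blast
  then show ?thesis using gZ_cong rep_eq_iff assms(2) by blast
qed

lemma subspace_center: "subspace (center_in M F m A)"
  unfolding center_in_eq
proof (rule subspaceI)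
  show "0 \<in> {v. \<exists>X\<in>gZ. rep v X}" using rep_0 gI_gZ[OF gI_0] by blast
  show "x + y \<in> {v. \<exists>X\<in>gZ. rep v X}"
    if "x \<in> {v. \<exists>X\<in>gZ. rep v X}" "y \<in> {v. \<exists>X\<in>gZ. rep v X}" for x y
    using that rep_add gZ_add by fast
  show "scl A c x \<in> {v. \<exists>X\<in>gZ. rep v X}" if "x \<in> {v. \<exists>X\<in>gZ. rep v X}" for c x
    using that rep_vscale gZ_vscale by fast
qed

end

section \<open>Compatibility of the anchor with brackets\<close>

lemma lie_infinity_vector_space: "lie_infinity_structure M A \<Longrightarrow> vector_space (scl A)"
  by (simp add: lie_infinity_structure_def)

lemma lie_infinity_sec_0: "lie_infinity_structure M A \<Longrightarrow> opn M U \<Longrightarrow> sec A 0 U = {0}"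
  by (simp add: lie_infinity_structure_def)

lemma lie_infinity_anch:
  assumes "lie_infinity_structure M A" and "opn M U" and "\<sigma> \<in> sec A 1 U"
  shows "anch A U \<sigma> \<in> vfields M U"
  using assms(1)[unfolded lie_infinity_structure_def, THEN conjunct2, THEN conjunct2, THEN conjunct1]
    assms(2,3) by simp

lemma lie_infinity_brk:
  assumes "lie_infinity_structure M A" and "opn M U" and "homogeneous_args A U as"
  shows "brk A U as \<in> sec A (sum_list (map fst as) - 1) U"
    and "opn M W \<Longrightarrow> W \<subseteq> U \<Longrightarrow>
      res W (brk A U as) = brk A W (map (map_prod id (res W)) as)"
  using assms(1)[unfolded lie_infinity_structure_def, THEN conjunct2, THEN conjunct2, THEN conjunct2,
      THEN conjunct1]
    assms(2,3) by simp_all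

lemma lie_infinity_add:
  assumes "lie_infinity_structure M A" and "opn M U"
    and "homogeneous_args A U (as @ (i, \<sigma>) # bs)" and "homogeneous_args A U (as @ (i, \<tau>) # bs)"
  shows "brk A U (as @ (i, \<sigma> + \<tau>) # bs) = brk A U (as @ (i, \<sigma>) # bs) + brk A U (as @ (i, \<tau>) # bs)"
  by (rule assms(1)[unfolded lie_infinity_structure_def, THEN conjunct2, THEN conjunct2, THEN conjunct2,
      THEN conjunct2, THEN conjunct1, rule_format]) (use assms in blast)

lemma lie_infinity_symmetry:
  assumes "lie_infinity_structure M A" and "opn M U"
    and "homogeneous_args A U (as @ (i, \<sigma>) # (j, \<tau>) # bs)"
  shows "brk A U (as @ (i, \<sigma>) # (j, \<tau>) # bs) =
    smul (scl A) (\<lambda>_. (- 1) ^ (i * j)) (brk A U (as @ (j, \<tau>) # (i, \<sigma>) # bs))"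
  by (rule assms(1)[unfolded lie_infinity_structure_def, THEN conjunct2, THEN conjunct2, THEN conjunct2,
      THEN conjunct2, THEN conjunct2, THEN conjunct1, rule_format]) (use assms in blast)

lemma lie_infinity_linear:
  assumes "lie_infinity_structure M A" and "opn M U" and "f \<in> funs M U"
    and "homogeneous_args A U (as @ (i, \<sigma>) # bs)" and "length (as @ (i, \<sigma>) # bs) \<noteq> 2"
  shows "brk A U (as @ (i, smul (scl A) f \<sigma>) # bs) = smul (scl A) f (brk A U (as @ (i, \<sigma>) # bs))"
  by (rule assms(1)[unfolded lie_infinity_structure_def, THEN conjunct2, THEN conjunct2, THEN conjunct2,
      THEN conjunct2, THEN conjunct2, THEN conjunct2, THEN conjunct1, rule_format])
    (use assms in blast)+

lemma lie_infinity_leibniz: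
  assumes "lie_infinity_structure M A" and "opn M U" and "f \<in> funs M U"
    and "\<sigma> \<in> sec A 1 U" and "\<tau> \<in> sec A 1 U"
  shows "brk A U [(1, \<sigma>), (1, smul (scl A) f \<tau>)] =
    smul (scl A) (anch A U \<sigma> U f) \<tau> + smul (scl A) f (brk A U [(1, \<sigma>), (1, \<tau>)])"
proof -
  have "homogeneous_args A U [(1, \<sigma>), (1, \<tau>)]"
    using assms by (simp add: homogeneous_args_def)
  then show ?thesis
    using assms(1)[unfolded lie_infinity_structure_def, THEN conjunct2, THEN conjunct2, THEN conjunct2,
      THEN conjunct2, THEN conjunct2, THEN conjunct2, THEN conjunct2, THEN conjunct1,
      THEN spec, of U, THEN spec, of 1, THEN spec, of 1, THEN spec, of \<sigma>, THEN spec, of \<tau>,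
      THEN bspec, OF assms(3)] assms(2)
    by simp
qed

lemma lie_infinity_jacobi:
  assumes "lie_infinity_structure M A" and "opn M U" and "homogeneous_args A U as"
  shows "(\<Sum>S \<in> Pow {..<length as} - {{}}.
      smul (scl A) (\<lambda>_. koszul (map fst as) S)
        (brk A U ((sum_list (map fst (nths as S)) - 1, brk A U (nths as S)) # nths as (- S)))) = 0"
  by (rule assms(1)[unfolded lie_infinity_structure_def, THEN conjunct2, THEN conjunct2, THEN conjunct2,
      THEN conjunct2, THEN conjunct2, THEN conjunct2, THEN conjunct2, THEN conjunct2, rule_format])
    (use assms in blast)

section \<open>Signs and subsets for three arguments\<close>

lemma Pow_lessThan_3:
  "Pow {..<3::nat} - {{}} = {{0}, {1}, {2}, {0, 1}, {0, 2}, {1, 2}, {0, 1, 2}}"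
proof -
  have "{..<3::nat} = {0, 1, 2}" by auto
  then show ?thesis by (simp only: Pow_insert Pow_empty image_insert image_empty Un_insert_left
    Un_empty_left Un_insert_right) (auto simp only:)
qed

lemma nths_3:
  "nths [a, b, c] S = (if 0 \<in> S then [a] else []) @ (if 1 \<in> S then [b] else []) @ (if 2 \<in> S then [c] else [])"
  by (simp add: nths_Cons numeral_2_eq_2 One_nat_def)

lemma length_2_cases:
  assumes "length xs = 2" obtains a b where "xs = [a, b]"
  using assms by (auto simp: length_Suc_conv numeral_2_eq_2)

lemma nths_minus_singleton:
  "nths [x, y, z] (- {0}) = [y, z]" "nths [x, y, z] (- {1}) = [x, z]" "nths [x, y, z] (- {2}) = [x, y]"
  "nths [x, y, z] (- {0, 1}) = [z]" "nths [x, y, z] (- {0, 2}) = [y]" "nths [x, y, z] (- {1, 2}) = [x]"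
  by (simp_all add: nths_3)

lemma pairs_lessThan:
  "{(i, j). i < j \<and> j < (2::nat)} = {(0, 1)}" "{(i, j). i < j \<and> j < (3::nat)} = {(0, 1), (0, 2), (1, 2)}"
  by auto

text \<open>All three arguments have odd degree, so each pair inverted by the unshuffle contributes
  exactly one sign.\<close>

lemma koszul_3:
  "koszul [1, 1, 1] S = (- 1) ^ (of_bool (0 \<notin> S \<and> 1 \<in> S) + of_bool (0 \<notin> S \<and> 2 \<in> S) + of_bool (1 \<notin> S \<and> 2 \<in> S))"
proof -
  have eq: "{(a, b). a < b \<and> b < length [1::nat, 1, 1] \<and> a \<notin> S \<and> b \<in> S} =
      {p \<in> {(0, 1), (0, 2), (1, 2)}. fst p \<notin> S \<and> snd p \<in> S}"
    by (auto simp: less_Suc_eq numeral_2_eq_2)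
  have "(\<Sum>(a, b)\<in>{(a, b). a < b \<and> b < length [1::nat, 1, 1] \<and> a \<notin> S \<and> b \<in> S}. [1, 1, 1] ! a * [1, 1, 1] ! b) =
      (\<Sum>p\<in>{(0, 1), (0, 2), (1, 2)}. of_bool (fst p \<notin> S \<and> snd p \<in> S) :: nat)"
    unfolding eq by (subst sum.inter_filter) (auto simp: numeral_2_eq_2 intro!: sum.cong)
  then show ?thesis unfolding koszul_def by simp
qed

text \<open>Of the seven nonempty subsets, the singletons contribute nothing, as their inner bracket
  lies in degree 0. The pairs give the Jacobiator and the full set the unary bracket of the ternary
  one. The order of arguments is chosen so that \<open>k\<close> always stands last, ready for the
  Leibniz rule.\<close>

lemma lie_infinity_jacobi3:
  fixes A :: "('m, 'k::real_normed_field, 'v::ab_group_add) algebroid"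
  assumes L: "lie_infinity_structure M A" and U: "opn M U"
    and s: "s \<in> sec A 1 U" and t: "t \<in> sec A 1 U" and k: "k \<in> sec A 1 U"
  shows "brk A U [(1, brk A U [(1, s), (1, t)]), (1, k)] + brk A U [(1, t), (1, brk A U [(1, s), (1, k)])] -
    brk A U [(1, s), (1, brk A U [(1, t), (1, k)])] + brk A U [(2, brk A U [(1, s), (1, t), (1, k)])] = 0"
proof -
  interpret vector_space "scl A" using L by (rule lie_infinity_vector_space)
  have sm: "smul (scl A) (\<lambda>_. 1) x = x" "smul (scl A) (\<lambda>_. - 1) x = - x" for x :: "'m \<Rightarrow> 'v"
    by (simp_all add: smul_def fun_eq_iff)
  have z: "0 \<in> sec A 0 U" using lie_infinity_sec_0[OF L U] by simp
  have unary: "brk A U [(1, x)] = 0" if "x \<in> sec A 1 U" for x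
    using lie_infinity_brk(1)[OF L U, of "[(1, x)]"] that lie_infinity_sec_0[OF L U]
    by (simp add: homogeneous_args_def)
  \<comment> \<open>Additivity applied to 0 + 0 in degree 0.\<close>
  have zero: "brk A U [(0, 0), (1, x), (1, y)] = 0" if "x \<in> sec A 1 U" "y \<in> sec A 1 U" for x y
    using lie_infinity_add[OF L U, of "[]" 0 0 "[(1, x), (1, y)]" 0] that z
    by (simp add: homogeneous_args_def)
  have swap: "brk A U [(1, x), (1, y)] = - brk A U [(1, y), (1, x)]"
    if "x \<in> sec A 1 U" "y \<in> sec A 1 U" for x y
    using lie_infinity_symmetry[OF L U, of "[]" 1 x 1 y "[]"] that
    by (simp add: homogeneous_args_def sm)
  have B: "brk A U [(1, x), (1, y)] \<in> sec A 1 U" if "x \<in> sec A 1 U" "y \<in> sec A 1 U" for x y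
    using lie_infinity_brk(1)[OF L U, of "[(1, x), (1, y)]"] that
    by (simp add: homogeneous_args_def flip: One_nat_def)
  have hom: "homogeneous_args A U [(1, s), (1, t), (1, k)]"
    using s t k by (simp add: homogeneous_args_def)
  have len: "length [(1::nat, s), (1, t), (1, k)] = 3" by simp
  \<comment> \<open>With the subsets listed without repetition, the sum over a set becomes a list
    sum whose terms can be evaluated one by one. The binary codes of the subsets tell them
    apart.\<close>
  have distinct: "distinct [{0}, {1}, {2}, {0, 1}, {0, 2}, {1, 2}, {0, 1, 2::nat}]"
  proof -
    have "distinct (map (\<lambda>S. \<Sum>i\<in>S. 2 ^ i :: nat) [{0}, {1}, {2}, {0, 1}, {0, 2}, {1, 2}, {0, 1, 2::nat}])"
      by simp
    then show ?thesis unfolding distinct_map by blast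
  qed
  have "(\<Sum>S\<leftarrow>[{0}, {1}, {2}, {0, 1}, {0, 2}, {1, 2}, {0, 1, 2}].
      smul (scl A) (\<lambda>_. koszul [1, 1, 1] S)
        (brk A U ((sum_list (map fst (nths [(1, s), (1, t), (1, k)] S)) - 1,
          brk A U (nths [(1, s), (1, t), (1, k)] S)) # nths [(1, s), (1, t), (1, k)] (- S)))) = 0"
    unfolding sum_list_distinct_conv_sum_set[OF distinct]
    using lie_infinity_jacobi[OF L U hom, unfolded len Pow_lessThan_3]
    by (simp only: list.set list.map fst_conv)
  then show ?thesis
    using unary zero s t k swap[OF B[OF s k] t] swap[OF B[OF t k] s]
    by (simp add: nths_3 koszul_3 sm algebra_simps flip: One_nat_def)
qed

text \<open>The anchor is not assumed to preserve brackets. Comparing the Jacobi identity for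
  \<open>s, t, f k\<close> with \<open>f\<close> times the one for \<open>s, t, k\<close> shows that its defect annihilates \<open>k\<close>.\<close>

lemma anchor_defect:
  fixes A :: "('m, 'k::real_normed_field, 'v::ab_group_add) algebroid"
  assumes fs: "function_sheaf M" and L: "lie_infinity_structure M A" and U: "opn M U"
    and s: "s \<in> sec A 1 U" and t: "t \<in> sec A 1 U" and G: "G \<subseteq> sec A 1 U"
    and smulG: "\<And>f k. f \<in> funs M U \<Longrightarrow> k \<in> G \<Longrightarrow> smul (scl A) f k \<in> G"
    and sG: "\<And>k. k \<in> G \<Longrightarrow> brk A U [(1, s), (1, k)] \<in> G"
    and tG: "\<And>k. k \<in> G \<Longrightarrow> brk A U [(1, t), (1, k)] \<in> G"
    and k: "k \<in> G" and f: "f \<in> funs M U"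
  shows "smul (scl A) (anch A U (brk A U [(1, s), (1, t)]) U f - vbracket (anch A U s) (anch A U t) U f) k = 0"
proof -
  interpret function_base M by unfold_locales (rule fs)
  interpret vector_space "scl A" using L by (rule lie_infinity_vector_space)
  let ?m = "smul (scl A)"
  define B where "B x y = brk A U [(1, x), (1, y)]" for x y
  define T where "T y = brk A U [(2, brk A U [(1, s), (1, t), (1, y)])]" for y
  have m: "?m h (x + y) = ?m h x + ?m h y" "?m (h + h') x = ?m h x + ?m h' x"
    "?m (h - h') x = ?m h x - ?m h' x" "?m h (x - y) = ?m h x - ?m h y"
    "?m h (?m h' x) = ?m (h * h') x" "?m h (?m h' x) = ?m h' (?m h x)" "?m h 0 = 0"
    for h h' and x y :: "'m \<Rightarrow> 'v"
    by (simp_all add: smul_def fun_eq_iff algebra_simps)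
  have add: "B x (y + z) = B x y + B x z"
    if "x \<in> sec A 1 U" "y \<in> G" "z \<in> G" for x y z
    using lie_infinity_add[OF L U, of "[(1, x)]" 1 y "[]" z] that G
    by (auto simp add: homogeneous_args_def B_def)
  have leib: "B x (?m h y) = ?m (anch A U x U h) y + ?m h (B x y)"
    if "x \<in> sec A 1 U" "y \<in> G" "h \<in> funs M U" for x y h
    using lie_infinity_leibniz[OF L U that(3,1)] that(2) G by (auto simp: B_def)
  have st: "B s t \<in> sec A 1 U"
    using lie_infinity_brk(1)[OF L U, of "[(1, s), (1, t)]"] s t
    by (simp add: homogeneous_args_def B_def flip: One_nat_def)
  have tri: "brk A U [(1, s), (1, t), (1, y)] \<in> sec A 2 U" if "y \<in> G" for y
    using lie_infinity_brk(1)[OF L U, of "[(1, s), (1, t), (1, y)]"] s t that G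
    by (auto simp: homogeneous_args_def)
  \<comment> \<open>Brackets of arity 3 and 1 have no anchor term, so the homotopy term is linear
    over functions and drops out of the comparison.\<close>
  have T: "T (?m f k) = ?m f (T k)"
  proof -
    have "brk A U [(1, s), (1, t), (1, ?m f k)] = ?m f (brk A U [(1, s), (1, t), (1, k)])"
      using lie_infinity_linear[OF L U f, of "[(1, s), (1, t)]" 1 k "[]"] s t k G
      by (auto simp: homogeneous_args_def)
    then show ?thesis
      using lie_infinity_linear[OF L U f, of "[]" 2 "brk A U [(1, s), (1, t), (1, k)]" "[]"] tri[OF k]
      by (simp add: T_def homogeneous_args_def)
  qed
  have jac: "B (B s t) y + B t (B s y) - B s (B t y) + T y = 0" if "y \<in> G" for y
    using lie_infinity_jacobi3[OF L U s t, of y] that G by (auto simp: B_def T_def)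
  note anch_funs = vf_funs[OF lie_infinity_anch[OF L U] U subset_refl]
  have sGB: "B s y \<in> G" and tGB: "B t y \<in> G" if "y \<in> G" for y
    using sG tG that by (simp_all add: B_def)
  define a where "a = anch A U s U f"
  define b where "b = anch A U t U f"
  have ab: "a \<in> funs M U" "b \<in> funs M U" using anch_funs s t f by (simp_all add: a_def b_def)
  have "B s (?m f k) = ?m a k + ?m f (B s k)" and "B t (?m f k) = ?m b k + ?m f (B t k)"
    and 1: "B (B s t) (?m f k) = ?m (anch A U (B s t) U f) k + ?m f (B (B s t) k)"
    using leib s t st k f by (simp_all add: a_def b_def)
  then have 2: "B t (B s (?m f k)) = ?m (anch A U t U a) k + ?m a (B t k) + (?m b (B s k) + ?m f (B t (B s k)))"
    and 3: "B s (B t (?m f k)) = ?m (anch A U s U b) k + ?m b (B s k) + (?m a (B t k) + ?m f (B s (B t k)))"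
    using s t k f ab sGB tGB smulG
    by (simp_all add: add leib a_def b_def)
  \<comment> \<open>The mixed terms, \<open>a\<close> times \<open>B t k\<close> and
    \<open>b\<close> times \<open>B s k\<close>, occur in both iterated brackets and cancel; only
    the terms in which \<open>f\<close> is differentiated twice, or once along \<open>B s t\<close>,
    remain.\<close>
  have "?m (anch A U (B s t) U f) k + ?m (anch A U t U a) k - ?m (anch A U s U b) k =
      (B (B s t) (?m f k) + B t (B s (?m f k)) - B s (B t (?m f k)) + T (?m f k)) -
      ?m f (B (B s t) k + B t (B s k) - B s (B t k) + T k)"
    unfolding 1 2 3 T m(1,4) by (simp add: algebra_simps)
  also have "\<dots> = 0"
    using jac[OF k] jac[OF smulG[OF f k]] m(7) by simp
  finally have "?m (anch A U (B s t) U f) k + ?m (anch A U t U a) k - ?m (anch A U s U b) k = 0" .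
  then show ?thesis
    by (simp add: vbracket_def m a_def b_def B_def algebra_simps)
qed

section \<open>The associated algebroid at a fixed point\<close>

locale fixed_point = minimal_algebroid M F m A
  for M :: "('m, 'k::real_normed_field) base" and F and m :: 'm
    and A :: "('m, 'k, 'v::ab_group_add) algebroid" +
  fixes g :: "('k, 'g::ab_group_add) lie_alg"
    and \<rho> :: "'g \<Rightarrow> ('m, 'k) vfield"
    and \<eta> :: "'g \<Rightarrow> 'g \<Rightarrow> 'm \<Rightarrow> 'v"
    and A' :: "('m, 'k, 'g \<times> 'v) algebroid"
  assumes lie_alg: "lie_algebra g"
    and action: "weak_symmetry_action M F g \<rho>"
    and curvature: "curvature_lift M g A \<rho> \<eta>"
    and associated: "associated_algebroid M g A \<rho> \<eta> A'"
    and vanishing: "\<And>x. vanishes_at m (\<rho> x)"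
    and central: "\<And>x y. \<eta> x y m \<in> center_in M F m A"
begin

lemma lscale_vs: "vector_space (lscale g)"
  using lie_alg by (simp add: lie_algebra_def)

lemma lie_infinity_A': "lie_infinity_structure M A'"
  using associated by (simp add: associated_algebroid_def)

lemma scl_A': "scl A' = (\<lambda>c (x, v). (lscale g c x, scl A c v))"
  using associated by (simp add: associated_algebroid_def)

lemma sec_A': "opn M U \<Longrightarrow> sec A' 1 U =
    {s. fst \<circ> s \<in> trivial_sections M (lscale g) U \<and> snd \<circ> s \<in> sec A 1 U}"
  using associated[unfolded associated_algebroid_def, THEN conjunct2, THEN conjunct2, THEN conjunct1,
      rule_format, of 1 U]
  by simp

lemma brk_emb: "opn M U \<Longrightarrow> homogeneous_args A U as \<Longrightarrow>
    brk A' U (map (map_prod id emb_sec) as) = emb_sec (brk A U as)"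
  and anch_A': "opn M U \<Longrightarrow> \<sigma> \<in> sec A 1 U \<Longrightarrow>
    anch A' U (const_sec U x + emb_sec \<sigma>) = vres U (\<rho> x) + anch A U \<sigma>"
  and brk_const_emb: "opn M U \<Longrightarrow> \<sigma> \<in> sec A 1 U \<Longrightarrow>
    brk A' U [(1, const_sec U x), (1, emb_sec \<sigma>)] \<in> emb_sec ` sec A 1 U"
  using associated[unfolded associated_algebroid_def, THEN conjunct2, THEN conjunct2, THEN conjunct2,
      THEN conjunct2]
  by simp_all

lemma \<rho>_vfields: "\<rho> x \<in> vfields M (pts M)"
  using action by (simp add: weak_symmetry_action_def)

lemma \<rho>_0: "\<rho> 0 = 0"
  using action unfolding weak_symmetry_action_def Vector_Spaces.linear_iff
  by (metis add_cancel_right_right)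

lemma \<eta>_sec: "\<eta> x y \<in> sec A 1 (pts M)"
  and anch_\<eta>: "anch A (pts M) (\<eta> x y) = \<rho> (lbr g x y) - vbracket (\<rho> x) (\<rho> y)"
  and \<eta>_self: "\<eta> x x = 0"
  using curvature by (simp_all add: curvature_lift_def)

text \<open>Since \<eta> is alternating, \<open>\<eta> 0 0\<close> is a global section equal to
  zero, and it can be restricted to any open set.\<close>

lemma sec_0: "opn M U \<Longrightarrow> 0 \<in> sec A 1 U"
  using sec_res[OF _ _ _ \<eta>_sec, of U 0 0] openin_subset[of "mtop M" U] by (simp add: \<eta>_self)

lemma const_sec_A':
  assumes "opn M U"
  shows "const_sec U x \<in> sec A' 1 U"
proof -
  interpret g: vector_space "lscale g" by (rule lscale_vs)
  have "fst \<circ> (const_sec U x :: 'm \<Rightarrow> 'g \<times> 'v) \<in> trivial_sections M (lscale g) U"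
    unfolding trivial_sections_def mem_Collect_eq
  proof (intro conjI ballI allI impI)
    fix p assume "p \<in> U"
    then show "\<exists>W n f y. opn M W \<and> p \<in> W \<and> W \<subseteq> U \<and> (\<forall>i<n::nat. f i \<in> funs M W) \<and>
        res W (fst \<circ> (const_sec U x :: 'm \<Rightarrow> 'g \<times> 'v)) = (\<lambda>q. \<Sum>i<n. lscale g (f i q) (y i))"
      using assms funs_const[OF assms, of 1]
      by (intro exI[of _ U] exI[of _ "Suc 0"] exI[of _ "\<lambda>_. res U (\<lambda>_. 1)"] exI[of _ "\<lambda>_. x"])
        (auto simp: fun_eq_iff res_def const_sec_def)
  qed (simp add: const_sec_def)
  moreover have "snd \<circ> (const_sec U x :: 'm \<Rightarrow> 'g \<times> 'v) = 0"
    by (simp add: fun_eq_iff const_sec_def)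
  ultimately show ?thesis using sec_A'[OF assms] sec_0[OF assms] by simp
qed

lemma emb_sec_A':
  assumes "opn M U" and "\<sigma> \<in> sec A 1 U"
  shows "emb_sec \<sigma> \<in> sec A' 1 U"
proof -
  have "fst \<circ> (emb_sec \<sigma> :: 'm \<Rightarrow> 'g \<times> 'v) \<in> trivial_sections M (lscale g) U"
    unfolding trivial_sections_def mem_Collect_eq
  proof (intro conjI ballI allI impI)
    fix p assume "p \<in> U"
    then show "\<exists>W n f y. opn M W \<and> p \<in> W \<and> W \<subseteq> U \<and> (\<forall>i<n::nat. f i \<in> funs M W) \<and>
        res W (fst \<circ> (emb_sec \<sigma> :: 'm \<Rightarrow> 'g \<times> 'v)) = (\<lambda>q. \<Sum>i<n. lscale g (f i q) (y i))"
      using assms(1) by (intro exI[of _ U] exI[of _ "0 :: nat"]) (auto simp: fun_eq_iff res_def emb_sec_def)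
  qed (simp add: emb_sec_def)
  moreover have "snd \<circ> (emb_sec \<sigma> :: 'm \<Rightarrow> 'g \<times> 'v) = \<sigma>"
    by (simp add: fun_eq_iff emb_sec_def)
  ultimately show ?thesis using sec_A'[OF assms(1)] assms(2) by simp
qed

lemma emb_sec_0: "emb_sec 0 = (0 :: 'm \<Rightarrow> 'g \<times> 'v)"
  by (simp add: fun_eq_iff emb_sec_def zero_prod_def)

lemma const_sec_0: "const_sec U 0 = (0 :: 'm \<Rightarrow> 'g \<times> 'v)"
  by (simp add: fun_eq_iff const_sec_def zero_prod_def)

lemma anch_emb: "opn M U \<Longrightarrow> \<sigma> \<in> sec A 1 U \<Longrightarrow> anch A' U (emb_sec \<sigma>) = anch A U \<sigma>"
  using anch_A'[of U \<sigma> 0] by (simp add: const_sec_0 \<rho>_0)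

lemma anch_const: "opn M U \<Longrightarrow> anch A' U (const_sec U x) = vres U (\<rho> x)"
  using anch_A'[of U 0 x] sec_0[of U] anch_0[of U] by (simp add: emb_sec_0)

lemma smul_emb: "smul (scl A') f (emb_sec \<sigma>) = emb_sec (smul (scl A) f \<sigma>)"
proof -
  interpret g: vector_space "lscale g" by (rule lscale_vs)
  show ?thesis by (simp add: fun_eq_iff smul_def emb_sec_def scl_A')
qed

section \<open>The anchor of a bracket with a constant section\<close>

text \<open>The defect of the anchor, evaluated on \<open>f\<close>, is a function that annihilates
  a frame section; independence of the frame at each point of \<open>W\<close> then makes the
  function zero.\<close>

lemma anch_nabla_aux:
  assumes fr: "frame V r b" and W: "opn M W" "W \<subseteq> V" and \<sigma>: "\<sigma> \<in> sec A 1 W" and w: "w \<in> sec A 1 W"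
    and brk: "brk A' W [(1, const_sec W x), (1, emb_sec \<sigma>)] = emb_sec w"
    and f: "f \<in> funs M W"
  shows "anch A W w W f = vbracket (vres W (\<rho> x)) (anch A W \<sigma>) W f"
proof (cases "r = 0")
  case True
  then have "sec A 1 W = {0}" using frame_sec[OF fr W] by simp
  moreover have "anch A W 0 = 0" using anch_0 W sec_0 by blast
  moreover have "vres W (\<rho> x) \<in> vfields M W"
    using vres_vfields[OF \<rho>_vfields] W(1) openin_subset by blast
  ultimately show ?thesis using \<sigma> w by simp
next
  case False
  let ?h = "anch A W w W f - vbracket (vres W (\<rho> x)) (anch A W \<sigma>) W f"
  have b: "res W (b 0) \<in> sec A 1 W" using frame_sec_basis[OF fr W] False by simp
  have "smul (scl A') (anch A' W (brk A' W [(1, const_sec W x), (1, emb_sec \<sigma>)]) W f -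
      vbracket (anch A' W (const_sec W x)) (anch A' W (emb_sec \<sigma>)) W f) (emb_sec (res W (b 0))) = 0"
  \<comment> \<open>The test sections are the embedded ones: brackets with constant sections
    preserve them by the defining property of \<open>A'\<close>, brackets with embedded sections
    because \<open>A\<close> is a subalgebroid, and the frame gives closure under multiplication by
    functions.\<close>
  proof (rule anchor_defect[OF function_sheaf lie_infinity_A' W(1), where G = "emb_sec ` sec A 1 W"])
    fix k assume "k \<in> (emb_sec ` sec A 1 W :: ('m \<Rightarrow> 'g \<times> 'v) set)"
    then obtain \<tau> where \<tau>: "\<tau> \<in> sec A 1 W" "k = emb_sec \<tau>" by blast
    show "brk A' W [(1, const_sec W x), (1, k)] \<in> emb_sec ` sec A 1 W"
      using brk_const_emb W \<tau> by blast
    have hom: "homogeneous_args A W [(1, \<sigma>), (1, \<tau>)]"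
      using \<sigma> \<tau> by (simp add: homogeneous_args_def)
    then show "brk A' W [(1, emb_sec \<sigma>), (1, k)] \<in> emb_sec ` sec A 1 W"
      using brk_emb[OF W(1) hom] lie_infinity_brk(1)[OF lie_structure W(1) hom] \<tau>
      by (simp flip: One_nat_def)
    show "smul (scl A') h k \<in> emb_sec ` sec A 1 W" if "h \<in> funs M W" for h
      using \<tau> frame_sec_smul[OF fr W _ that] by (simp add: smul_emb)
  qed (use W \<sigma> b f const_sec_A' emb_sec_A' in auto)
  then have "emb_sec (smul (scl A) ?h (res W (b 0))) = (0 :: 'm \<Rightarrow> 'g \<times> 'v)"
    using W \<sigma> w brk by (simp add: anch_emb anch_const smul_emb)
  then have hb: "scl A (?h p) (res W (b 0) p) = 0" for p
    by (simp add: fun_eq_iff emb_sec_def zero_prod_def smul_def)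
  have "?h p = 0" for p
  proof (cases "p \<in> W")
    case True
    then have "(\<Sum>i<r. scl A (if i = 0 then ?h p else 0) (b i p)) = 0"
      using hb[of p] False
      by (simp add: if_distrib[of "\<lambda>c. scl A c _"] res_def cong: if_cong)
    then show ?thesis
      using fr True W False
      by (auto simp: frame_def dest!: bspec[of _ _ p] spec[of _ "\<lambda>i. if i = 0 then ?h p else 0"])
  next
    case False
    have vf: "anch A W w \<in> vfields M W" "anch A W \<sigma> \<in> vfields M W" "vres W (\<rho> x) \<in> vfields M W"
      using anch_struct(1) vres_vfields[OF \<rho>_vfields openin_subset[OF W(1)]] W w \<sigma> by simp_all
    then show ?thesis
      using vf_support[OF vf(1) False] vf_support[OF vbracket_vfields[OF vf(3,2)] False] by simp
  qed
  then show ?thesis by (simp add: fun_eq_iff)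
qed

lemma res_const_sec: "W \<subseteq> U \<Longrightarrow> res W (const_sec U x) = (const_sec W x :: 'm \<Rightarrow> 'g \<times> 'v)"
  by (auto simp: fun_eq_iff res_def const_sec_def zero_prod_def)

lemma res_emb_sec: "res W (emb_sec \<sigma>) = (emb_sec (res W \<sigma>) :: 'm \<Rightarrow> 'g \<times> 'v)"
  by (auto simp: fun_eq_iff res_def emb_sec_def zero_prod_def)

lemma nabla_res:
  assumes U: "opn M U" and W: "opn M W" "W \<subseteq> U" and \<sigma>: "\<sigma> \<in> sec A 1 U"
    and brk: "brk A' U [(1, const_sec U x), (1, emb_sec \<sigma>)] = emb_sec w"
  shows "brk A' W [(1, const_sec W x), (1, emb_sec (res W \<sigma>))] = emb_sec (res W w)"
proof -
  have "homogeneous_args A' U [(1, const_sec U x), (1, emb_sec \<sigma>)]"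
    using U \<sigma> const_sec_A' emb_sec_A' by (simp add: homogeneous_args_def)
  from lie_infinity_brk(2)[OF lie_infinity_A' U this W] show ?thesis
    using brk W by (simp add: res_const_sec res_emb_sec)
qed

text \<open>The preceding lemma treats functions on the open set over which the sections live. A
  vector field also takes functions on smaller open sets; these are reached by first restricting the
  bracket.\<close>

lemma anch_nabla:
  assumes fr: "frame V r b" and W: "opn M W" "W \<subseteq> V" and \<sigma>: "\<sigma> \<in> sec A 1 W" and w: "w \<in> sec A 1 W"
    and brk: "brk A' W [(1, const_sec W x), (1, emb_sec \<sigma>)] = emb_sec w"
  shows "anch A W w = vbracket (vres W (\<rho> x)) (anch A W \<sigma>)" (is "?X = ?Y")
proof (intro ext)
  fix V' f p
  have X: "?X \<in> vfields M W" and S: "anch A W \<sigma> \<in> vfields M W"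
    using anch_struct(1) W w \<sigma> by auto
  have Y: "?Y \<in> vfields M W"
    using vbracket_vfields[OF vres_vfields[OF \<rho>_vfields] S] W(1) openin_subset by auto
  show "?X V' f p = ?Y V' f p"
  proof (rule vf_cases[of "{?X, ?Y}" W V' f])
    assume V': "opn M V'" "V' \<subseteq> W" and f: "f \<in> funs M V'"
    have "anch A V' (res V' w) V' f = vbracket (vres V' (\<rho> x)) (anch A V' (res V' \<sigma>)) V' f"
      using anch_nabla_aux[OF fr V'(1) _ _ _ nabla_res[OF W(1) V' \<sigma> brk] f]
        sec_res[OF W(1) V'] V' W w \<sigma> by auto
    moreover have "anch A V' (res V' w) = vres V' ?X"
      using anch_struct(4) W V' w by auto
    moreover have "vbracket (vres V' (\<rho> x)) (anch A V' (res V' \<sigma>)) = vres V' ?Y"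
      using anch_struct(4) W V' \<sigma> by (auto simp: vres_vbracket vres_vres)
    ultimately show ?thesis by simp
  qed (use X Y in \<open>auto simp flip: zero_fun_def\<close>)
qed

section \<open>The action on the fibre at the fixed point\<close>

abbreviation "act \<equiv> fibre_action M m A A'"

lemma normalizer_action:
  assumes "weak_symmetry_action M F g \<rho>'" and "\<And>x. vanishes_at m (\<rho>' x)"
  shows "\<rho>' x \<in> gN"
proof -
  have "\<rho>' x \<in> normalizer (pts M)"
    using assms unfolding weak_symmetry_action_def normalizer_def by simp
  then show ?thesis
    unfolding germs_def mem_Collect_eq
    using small_nbhd normalizer_res[of "pts M" _ "\<rho>' x"] openin_subset
    by (auto elim!: eventually_mono)
qed

lemma \<rho>_gN: "\<rho> x \<in> gN"
  using normalizer_action[OF action vanishing] .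

lemma nabla_rep:
  assumes U: "nbhd U" and \<sigma>: "\<sigma> \<in> sec A 1 U"
  shows "rep (snd (brk A' U [(1, const_sec U x), (1, emb_sec \<sigma>)] m)) (vbracket (\<rho> x) (anch A U \<sigma>))"
proof -
  have oU: "opn M U" using U by (simp add: nbhd_def)
  obtain w where w: "w \<in> sec A 1 U" "brk A' U [(1, const_sec U x), (1, emb_sec \<sigma>)] = emb_sec w"
    using brk_const_emb[OF oU \<sigma>] by blast
  obtain V r b where fr: "frame V r b" using frame_exists .
  then have V: "nbhd V" by (simp add: frame_def)
  have "germ_eq (anch A U w) (vbracket (\<rho> x) (anch A U \<sigma>))"
    unfolding germ_eq_def using small_subset[OF U] small_subset[OF V]
  proof eventually_elim
    case (elim W)
    then have W: "opn M W" "W \<subseteq> U" "W \<subseteq> V" by auto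
    have "anch A W (res W w) = vbracket (vres W (\<rho> x)) (anch A W (res W \<sigma>))"
      by (rule anch_nabla[OF fr W(1,3) _ _ nabla_res[OF oU W(1,2) \<sigma> w(2)]])
        (use sec_res oU W \<sigma> w in auto)
    then show ?case
      using anch_struct(4)[OF oU] W \<sigma> w(1) by (simp add: vres_vbracket)
  qed
  then show ?thesis
    using rep_cong[OF repI[OF U w(1)]] w(2) by (simp add: emb_sec_def)
qed

text \<open>This also shows that the definite description behind \<open>act\<close> is legitimate:
  two sections with the same value at \<open>m\<close> have anchors congruent modulo
  \<open>gI\<close>, the bracket with \<open>\<rho> x\<close> respects the congruence, and congruent
  germs have the same vector.\<close>

lemma act_rep:
  assumes "rep v X"
  shows "rep (act x v) (vbracket (\<rho> x) X)"
proof -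
  have *: "rep (snd (brk A' U [(1, const_sec U x), (1, emb_sec \<sigma>)] m)) (vbracket (\<rho> x) X)"
    if U: "nbhd U" and \<sigma>: "\<sigma> \<in> sec A 1 U" "\<sigma> m = v" for U \<sigma>
  proof -
    have S: "rep v (anch A U \<sigma>)" using repI[OF U \<sigma>(1)] \<sigma>(2) by simp
    then have "anch A U \<sigma> - X \<in> gI" using rep_eq_iff assms by blast
    then have "vbracket (\<rho> x) (anch A U \<sigma>) - vbracket (\<rho> x) X \<in> gI"
      using gN_congr[OF \<rho>_gN] rep_gF[OF S] rep_gF[OF assms] gF_gV by blast
    then show ?thesis using rep_gI_cong[OF nabla_rep[OF U \<sigma>(1)]] by blast
  qed
  obtain U \<sigma> where "nbhd U" "\<sigma> \<in> sec A 1 U" "\<sigma> m = v" using assms unfolding rep_def by blast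
  moreover from this have "act x v = snd (brk A' U [(1, const_sec U x), (1, emb_sec \<sigma>)] m)"
    unfolding fibre_action_def
    using * rep_unique gI_0 by (intro the_equality) (auto simp: nbhd_def, metis diff_self)
  ultimately show ?thesis using * by simp
qed

end

context fixed_point
begin

section \<open>Curvature and cohomology\<close>

lemma lie_add: "lbr g (x + y) z = lbr g x z + lbr g y z" "lbr g x (y + z) = lbr g x y + lbr g x z"
  and lie_scale: "lbr g (lscale g c x) z = lscale g c (lbr g x z)"
    "lbr g x (lscale g c z) = lscale g c (lbr g x z)"
  and lie_self: "lbr g x x = 0"
  and lie_jacobi: "lbr g x (lbr g y z) + lbr g y (lbr g z x) + lbr g z (lbr g x y) = 0"
  using lie_alg by (simp_all add: lie_algebra_def Vector_Spaces.linear_iff)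

lemma lie_swap: "lbr g x y = - lbr g y x"
  using lie_self[of "x + y", unfolded lie_add] by (simp add: lie_self eq_neg_iff_add_eq_0 add.commute)

text \<open>The action is an argument because the curvature of a second action will be compared with
  that of \<rho>, the module structure remaining the one of \<rho>.\<close>

definition curv :: "('g \<Rightarrow> ('m, 'k) vfield) \<Rightarrow> 'g \<Rightarrow> 'g \<Rightarrow> ('m, 'k) vfield"
  where "curv \<sigma> x y = \<sigma> (lbr g x y) - vbracket (\<sigma> x) (\<sigma> y)"

lemma \<eta>_rep: "rep (\<eta> x y m) (curv \<rho> x y)"
  using repI[OF nbhd_pts \<eta>_sec] by (simp add: anch_\<eta> curv_def)

lemma curv_gZ: "curv \<rho> x y \<in> gZ"
  using center_in_rep[OF central \<eta>_rep] .

lemma action_linear: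
  assumes "weak_symmetry_action M F g \<sigma>"
  shows "\<sigma> (x + y) = \<sigma> x + \<sigma> y" and "\<sigma> (lscale g c x) = vscale c (\<sigma> x)"
    and "\<sigma> x \<in> vfields M (pts M)"
  using assms by (simp_all add: weak_symmetry_action_def Vector_Spaces.linear_iff)

lemmas \<rho>_linear = action_linear[OF action]

lemma act_center: "z \<in> center_in M F m A \<Longrightarrow> act x z \<in> center_in M F m A"
  unfolding center_in_eq using act_rep gN_gZ \<rho>_gN by blast

lemma rep_germ_unique: "rep v X \<Longrightarrow> rep w Y \<Longrightarrow> germ_eq X Y \<Longrightarrow> v = w"
  using rep_unique germ_eq_gI by blast

lemma germ_vbracket_\<rho>:
  assumes "X \<in> gV"
  shows "germ_eq (vbracket (\<rho> (x + y)) X) (vbracket (\<rho> x) X + vbracket (\<rho> y) X)"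
    and "germ_eq (vbracket (\<rho> (lscale g c x)) X) (vscale c (vbracket (\<rho> x) X))"
proof -
  show "germ_eq (vbracket (\<rho> (x + y)) X) (vbracket (\<rho> x) X + vbracket (\<rho> y) X)"
    using assms gN_gV[OF \<rho>_gN[of x]] gN_gV[OF \<rho>_gN[of y]]
    unfolding germ_eq_def germs_def mem_Collect_eq
    by eventually_elim (simp add: \<rho>_linear vres_vbracket vres_add vbracket_add_left)
  show "germ_eq (vbracket (\<rho> (lscale g c x)) X) (vscale c (vbracket (\<rho> x) X))"
    using assms gN_gV[OF \<rho>_gN[of x]]
    unfolding germ_eq_def germs_def mem_Collect_eq
    by eventually_elim (simp add: \<rho>_linear vres_vbracket vres_vscale vbracket_scale_left)
qed

text \<open>By the Jacobi identity the failure of \<rho> to be a representation on X is the bracket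
  of the curvature with X. It lies in \<open>gI\<close> because the curvature is in
  \<open>gF0\<close> and X is central.\<close>

lemma act_lbr:
  assumes "rep z X" and "X \<in> gZ"
  shows "act (lbr g x y) z = act x (act y z) - act y (act x z)"
proof (rule rep_unique)
  show "rep (act (lbr g x y) z) (vbracket (\<rho> (lbr g x y)) X)"
    using assms act_rep by blast
  show "rep (act x (act y z) - act y (act x z))
      (vbracket (\<rho> x) (vbracket (\<rho> y) X) - vbracket (\<rho> y) (vbracket (\<rho> x) X))"
    using assms by (intro rep_diff act_rep)
  have X: "X \<in> gV" using assms rep_gF gF_gV by blast
  have C: "curv \<rho> x y \<in> gV" using curv_gZ germ_incl by blast
  have "germ_eq (vbracket (curv \<rho> x y) X) (vbracket (\<rho> (lbr g x y)) X -
      (vbracket (\<rho> x) (vbracket (\<rho> y) X) - vbracket (\<rho> y) (vbracket (\<rho> x) X)))"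
    using X C gN_gV[OF \<rho>_gN[of x]] gN_gV[OF \<rho>_gN[of y]] gN_gV[OF \<rho>_gN[of "lbr g x y"]]
    unfolding germ_eq_def germs_def mem_Collect_eq
  proof eventually_elim
    case (elim W)
    note vb = vbracket_vfields[OF elim(3,4)]
    show ?case
      unfolding curv_def vres_vbracket vres_diff
      using vbracket_diff_left[OF elim(5) vb elim(1)] vbracket_jacobi[OF elim(3,4,1)]
      by (simp add: algebra_simps)
  qed
  moreover have "vbracket (curv \<rho> x y) X \<in> gI"
    using gZ_right[OF gZ_gF0[OF curv_gZ] assms(2)] .
  ultimately show "vbracket (\<rho> (lbr g x y)) X -
      (vbracket (\<rho> x) (vbracket (\<rho> y) X) - vbracket (\<rho> y) (vbracket (\<rho> x) X)) \<in> gI"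
    using germs_cong by blast
qed

lemma act_add_right:
  assumes "rep v X" and "rep w Y"
  shows "act x (v + w) = act x v + act x w"
  by (rule rep_germ_unique[OF act_rep[OF rep_add[OF assms]] rep_add[OF act_rep[OF assms(1)] act_rep[OF assms(2)]]])
    (use assms rep_gF gF_gV gN_gV[OF \<rho>_gN] in \<open>blast intro: germ_vbracket_add_right\<close>)

lemma act_scale_right:
  assumes "rep v X"
  shows "act x (scl A c v) = scl A c (act x v)"
  by (rule rep_germ_unique[OF act_rep[OF rep_vscale[OF assms]] rep_vscale[OF act_rep[OF assms]]])
    (use assms rep_gF gF_gV gN_gV[OF \<rho>_gN] in \<open>blast intro: germ_vbracket_scale_right\<close>)

lemma lie_module_center: "lie_module g (scl A) (center_in M F m A) act"
proof -
  have *: "\<exists>X. rep z X \<and> X \<in> gZ" if "z \<in> center_in M F m A" for z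
    using that center_in_eq by blast
  have left: "act (x + y) z = act x z + act y z" "act (lscale g c x) z = scl A c (act x z)"
    if z: "z \<in> center_in M F m A" for x y z c
  proof -
    obtain X where X: "rep z X" using * z by blast
    then have gV: "X \<in> gV" using rep_gF gF_gV by blast
    show "act (x + y) z = act x z + act y z"
      using rep_germ_unique[OF act_rep[OF X] rep_add[OF act_rep[OF X] act_rep[OF X]]]
        germ_vbracket_\<rho>[OF gV] by blast
    show "act (lscale g c x) z = scl A c (act x z)"
      using rep_germ_unique[OF act_rep[OF X] rep_vscale[OF act_rep[OF X]]]
        germ_vbracket_\<rho>[OF gV] by blast
  qed
  show ?thesis
    unfolding lie_module_def
  proof (intro conjI allI ballI)
    fix x y c z z' assume z: "z \<in> center_in M F m A" and z': "z' \<in> center_in M F m A"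
    show "act x (z + z') = act x z + act x z'" using act_add_right *[OF z] *[OF z'] by blast
    show "act x (scl A c z) = scl A c (act x z)" using act_scale_right *[OF z] by blast
    show "act (lbr g x y) z = act x (act y z) - act y (act x z)" using act_lbr *[OF z] by blast
  qed (use subspace_center act_center left in auto)
qed

lemma curv_linear:
  assumes "weak_symmetry_action M F g \<sigma>"
  shows "curv \<sigma> (x + x') y = curv \<sigma> x y + curv \<sigma> x' y"
    and "curv \<sigma> x (y + y') = curv \<sigma> x y + curv \<sigma> x y'"
    and "curv \<sigma> (lscale g c x) y = vscale c (curv \<sigma> x y)"
    and "curv \<sigma> x (lscale g c y) = vscale c (curv \<sigma> x y)"
    and "curv \<sigma> x x = 0"
proof -
  note l = action_linear[OF assms]
  have vs: "vscale c (X - Y) = vscale c X - vscale c Y" for X Y :: "('m, 'k) vfield"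
    by (simp add: fun_eq_iff vscale_apply algebra_simps)
  show "curv \<sigma> (lscale g c x) y = vscale c (curv \<sigma> x y)" "curv \<sigma> x (lscale g c y) = vscale c (curv \<sigma> x y)"
    by (simp_all add: curv_def lie_scale l vs vbracket_scale_left[of _ "pts M"]
        vbracket_scale_right[of _ "pts M"])
  show "curv \<sigma> (x + x') y = curv \<sigma> x y + curv \<sigma> x' y" "curv \<sigma> x (y + y') = curv \<sigma> x y + curv \<sigma> x y'"
    by (simp_all add: curv_def lie_add l vbracket_add_left[of _ "pts M"]
        vbracket_add_right[of _ "pts M"])
  have "\<sigma> 0 = 0" using l(1)[of 0 0] by simp
  moreover have "vbracket X X = 0" for X :: "('m, 'k) vfield"
    by (simp add: fun_eq_iff vbracket_def)
  ultimately show "curv \<sigma> x x = 0" by (simp add: curv_def lie_self)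
qed

lemma ce_differential_1:
  "ce_differential g (scl A) a \<omega> [x, y] = a x (\<omega> [y]) - a y (\<omega> [x]) - \<omega> [lbr g x y]"
proof -
  have "nths [x, y] (- {0}) = [y]" "nths [x, y] (- {1}) = [x]" "nths [x, y] (- {0, 1}) = []"
    by (simp_all add: nths_Cons One_nat_def)
  moreover have "{..<2::nat} = {0, 1}" by auto
  moreover have "length [x, y] = 2" by simp
  ultimately show ?thesis
    unfolding ce_differential_def by (simp only: pairs_lessThan) simp
qed

lemma ce_differential_2:
  "ce_differential g (scl A) a \<omega> [x, y, z] =
    a x (\<omega> [y, z]) - a y (\<omega> [x, z]) + a z (\<omega> [x, y]) -
    \<omega> [lbr g x y, z] + \<omega> [lbr g x z, y] - \<omega> [lbr g y z, x]"
proof -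
  have "{..<3::nat} = {0, 1, 2}" by auto
  moreover have "length [x, y, z] = 3" by simp
  ultimately show ?thesis
    unfolding ce_differential_def
    by (simp only: pairs_lessThan) (simp add: nths_minus_singleton)
qed

text \<open>The mixed brackets, such as that of \<open>\<sigma> x\<close> with
  \<open>\<sigma> (lbr g y z)\<close>, cancel against those hidden in
  \<open>curv \<sigma> (lbr g y z) x\<close>. What remains are the Jacobi sum of vector fields and
  the image under \<sigma> of the Jacobi sum in \<open>g\<close>. The identity holds exactly, not
  just modulo \<open>gI\<close>.\<close>

lemma curv_bianchi:
  assumes "weak_symmetry_action M F g \<sigma>"
  shows "vbracket (\<sigma> x) (curv \<sigma> y z) - vbracket (\<sigma> y) (curv \<sigma> x z) + vbracket (\<sigma> z) (curv \<sigma> x y) -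
    curv \<sigma> (lbr g x y) z + curv \<sigma> (lbr g x z) y - curv \<sigma> (lbr g y z) x = 0"
proof -
  note l = action_linear[OF assms]
  have 0: "\<sigma> 0 = 0" using l(1)[of 0 0] by simp
  have neg: "\<sigma> (- u) = - \<sigma> u" for u using l(1)[of u "- u"] 0 by (simp add: minus_unique)
  have "lbr g (lbr g x y) z - lbr g (lbr g x z) y + lbr g (lbr g y z) x = 0"
    using lie_jacobi[of x y z] lie_swap[of "lbr g x y" z] lie_swap[of "lbr g x z" y]
      lie_swap[of "lbr g y z" x] lie_swap[of x z] lie_add(2)[of y "lbr g x z" "- lbr g x z"]
      lie_add(2)[of y 0 0]
    by (simp add: add_eq_0_iff algebra_simps)
  then have "\<sigma> (lbr g (lbr g x y) z + - lbr g (lbr g x z) y + lbr g (lbr g y z) x) = 0"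
    using 0 by simp
  then have lie: "\<sigma> (lbr g (lbr g x y) z) - \<sigma> (lbr g (lbr g x z) y) + \<sigma> (lbr g (lbr g y z) x) = 0"
    by (simp only: l(1) neg) simp
  have jac: "vbracket (\<sigma> x) (vbracket (\<sigma> y) (\<sigma> z)) =
      vbracket (vbracket (\<sigma> x) (\<sigma> y)) (\<sigma> z) + vbracket (\<sigma> y) (vbracket (\<sigma> x) (\<sigma> z))"
    using vbracket_jacobi l(3) by blast
  have br: "vbracket (\<sigma> u) (curv \<sigma> v w) = vbracket (\<sigma> u) (\<sigma> (lbr g v w)) - vbracket (\<sigma> u) (vbracket (\<sigma> v) (\<sigma> w))"
    for u v w
    unfolding curv_def using vbracket_diff_right[OF l(3) l(3) vbracket_vfields[OF l(3) l(3)]] by blast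
  show ?thesis
    unfolding br unfolding curv_def
    using lie jac vbracket_swap[of "\<sigma> (lbr g x y)" "\<sigma> z"] vbracket_swap[of "\<sigma> (lbr g x z)" "\<sigma> y"]
      vbracket_swap[of "\<sigma> (lbr g y z)" "\<sigma> x"] vbracket_swap[of "vbracket (\<sigma> x) (\<sigma> y)" "\<sigma> z"]
    by (simp add: algebra_simps)
qed

text \<open>The module structure comes from \<rho> while the cochain comes from \<sigma>. Their
  difference is in \<open>gF0\<close> and brackets central germs into \<open>gI\<close>, so the
  action may be computed with \<sigma>, for which the Bianchi identity is available.\<close>

lemma ce_cocycle_curv:
  assumes \<sigma>: "weak_symmetry_action M F g \<sigma>" and van: "\<And>x. vanishes_at m (\<sigma> x)"
    and eq: "\<And>x. \<sigma> x - \<rho> x \<in> gF0"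
    and \<omega>: "\<And>x y. rep (\<omega> [x, y]) (curv \<sigma> x y)" and Z: "\<And>x y. curv \<sigma> x y \<in> gZ"
  shows "ce_cocycle g (scl A) (center_in M F m A) act 2 \<omega>"
proof -
  \<comment> \<open>A germ has only one vector, so multilinearity and alternation of \<omega> are
    inherited from \<open>curv \<sigma>\<close>.\<close>
  have uniq: "\<omega> [x, y] = v" if "rep v (curv \<sigma> x y)" for x y v
    using rep_unique[OF \<omega> that] gI_0 by simp
  have lists: "(xs = [] \<and> (\<exists>b. ys = [b])) \<or> (ys = [] \<and> (\<exists>b. xs = [b]))"
    if "length xs + 1 + length ys = 2" for xs ys :: "'g list"
    using that by (cases xs; cases ys) auto
  have lin: "\<omega> (xs @ (x + y) # ys) = \<omega> (xs @ x # ys) + \<omega> (xs @ y # ys)"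
    "\<omega> (xs @ lscale g c x # ys) = scl A c (\<omega> (xs @ x # ys))"
    if "length xs + 1 + length ys = 2" for xs ys x y c
    using lists[OF that] \<omega>
    by (auto intro!: uniq simp: curv_linear[OF \<sigma>] rep_add rep_vscale)
  have alt: "\<omega> xs = 0" if xs: "length xs = 2" "\<not> distinct xs" for xs
  proof -
    obtain a b where "xs = [a, b]" using xs(1) by (rule length_2_cases)
    then show ?thesis using xs(2) by (auto intro!: uniq simp: curv_linear[OF \<sigma>] rep_0)
  qed
  have "\<omega> xs \<in> center_in M F m A" if xs: "length xs = 2" for xs
  proof -
    obtain a b where "xs = [a, b]" using xs(1) by (rule length_2_cases)
    then show ?thesis using center_in_I[OF \<omega> Z] by simp
  qed
  then have cochain: "ce_cochain g (scl A) (center_in M F m A) 2 \<omega>"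
    unfolding ce_cochain_def using lin alt by blast
  have rep_act: "rep (act x (\<omega> [y, z])) (vbracket (\<sigma> x) (curv \<sigma> y z))" for x y z
  proof (rule rep_gI_cong[OF act_rep[OF \<omega>]])
    have "vbracket (\<sigma> x - \<rho> x) (curv \<sigma> y z) \<in> gI" using gZ_right[OF eq Z] .
    moreover have "germ_eq (vbracket (\<sigma> x - \<rho> x) (curv \<sigma> y z))
        (vbracket (\<sigma> x) (curv \<sigma> y z) - vbracket (\<rho> x) (curv \<sigma> y z))"
      by (rule germ_vbracket_diff_left[OF gN_gV[OF normalizer_action[OF \<sigma> van]] gN_gV[OF \<rho>_gN]
            gF_gV[OF gF0_gF[OF gZ_gF0[OF Z]]]])
    ultimately show "vbracket (\<rho> x) (curv \<sigma> y z) - vbracket (\<sigma> x) (curv \<sigma> y z) \<in> gI"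
      using germs_cong gI_minus_commute by blast
  qed
  have "ce_differential g (scl A) act \<omega> [x, y, z] = 0" for x y z
  proof -
    \<comment> \<open>Term by term the differential is represented by the left side of the Bianchi
      identity, a germ that is literally zero.\<close>
    have "rep (ce_differential g (scl A) act \<omega> [x, y, z])
      (vbracket (\<sigma> x) (curv \<sigma> y z) - vbracket (\<sigma> y) (curv \<sigma> x z) + vbracket (\<sigma> z) (curv \<sigma> x y) -
        curv \<sigma> (lbr g x y) z + curv \<sigma> (lbr g x z) y - curv \<sigma> (lbr g y z) x)"
      unfolding ce_differential_2 by (intro rep_add rep_diff rep_act \<omega>)
    then show ?thesis unfolding curv_bianchi[OF \<sigma>] by (rule rep_of_0)
  qed
  moreover have "\<exists>x y z. xs = [x, y, z]" if "length xs = 2 + 1" for xs :: "'g list"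
    using that by (auto simp: length_Suc_conv eval_nat_numeral One_nat_def)
  ultimately show ?thesis unfolding ce_cocycle_def using cochain by blast
qed

text \<open>The primitive is the vector at \<open>m\<close> of \<open>\<sigma> x - \<rho> x\<close>.
  Expanding brackets, the difference of curvatures minus the coboundary of this cochain is the
  single bracket of \<open>\<sigma> x - \<rho> x\<close> with \<open>\<sigma> y - \<rho> y\<close>,
  which centrality puts into \<open>gI\<close>.\<close>

lemma ce_exact_curv_diff:
  assumes \<sigma>: "weak_symmetry_action M F g \<sigma>" and eq: "\<And>x. \<sigma> x - \<rho> x \<in> gZ"
    and \<omega>: "\<And>x y. rep (\<omega> [x, y]) (curv \<rho> x y)" and \<omega>': "\<And>x y. rep (\<omega>' [x, y]) (curv \<sigma> x y)"
  shows "ce_exact g (scl A) (center_in M F m A) act 2 (\<lambda>xs. \<omega> xs - \<omega>' xs)"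
proof -
  note l = action_linear[OF \<sigma>] and r = \<rho>_linear
  have "\<exists>v. rep v (\<sigma> x - \<rho> x)" for x using rep_exists eq gF0_gF gZ_gF0 by blast
  then obtain b where b: "\<And>x. rep (b x) (\<sigma> x - \<rho> x)" by metis
  define \<beta> where "\<beta> xs = b (xs ! 0)" for xs
  have uniq: "b x = v" if "rep v (\<sigma> x - \<rho> x)" for x v
    using rep_unique[OF b that] gI_0 by simp
  have "b (x + y) = b x + b y" for x y
    by (rule uniq) (use rep_add[OF b b, of x y] in \<open>simp add: l r algebra_simps\<close>)
  moreover have "b (lscale g c x) = scl A c (b x)" for c x
  proof (rule uniq)
    have "vscale c (\<sigma> x - \<rho> x) = \<sigma> (lscale g c x) - \<rho> (lscale g c x)"
      unfolding l r by (simp add: fun_eq_iff vscale_apply algebra_simps)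
    then show "rep (scl A c (b x)) (\<sigma> (lscale g c x) - \<rho> (lscale g c x))"
      using rep_vscale[OF b, of c x] by simp
  qed
  moreover have "b x \<in> center_in M F m A" for x using center_in_I[OF b eq] .
  moreover have "xs = [] \<and> ys = []" if "length xs + 1 + length ys = 1" for xs ys :: "'g list"
    using that by simp
  moreover have "distinct xs" if "length xs = 1" for xs :: "'g list"
    using that by (auto simp: length_Suc_conv One_nat_def)
  ultimately have "ce_cochain g (scl A) (center_in M F m A) 1 \<beta>"
    unfolding ce_cochain_def \<beta>_def by fastforce
  moreover have "\<omega> [x, y] - \<omega>' [x, y] = ce_differential g (scl A) act \<beta> [x, y]" for x y
  proof (rule rep_unique)
    show "rep (\<omega> [x, y] - \<omega>' [x, y]) (curv \<rho> x y - curv \<sigma> x y)"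
      by (intro rep_diff \<omega> \<omega>')
    show "rep (ce_differential g (scl A) act \<beta> [x, y])
        (vbracket (\<rho> x) (\<sigma> y - \<rho> y) - vbracket (\<rho> y) (\<sigma> x - \<rho> x) - (\<sigma> (lbr g x y) - \<rho> (lbr g x y)))"
      unfolding ce_differential_1 \<beta>_def nth_Cons_0 by (intro rep_diff act_rep b)
    have 1: "vbracket (\<sigma> x - \<rho> x) (\<sigma> y - \<rho> y) = vbracket (\<sigma> x) (\<sigma> y) - vbracket (\<rho> x) (\<sigma> y) -
        (vbracket (\<sigma> x) (\<rho> y) - vbracket (\<rho> x) (\<rho> y))"
      using vbracket_diff_left[OF l(3) r(3) diff_vfields[OF l(3) r(3)]]
        vbracket_diff_right[OF l(3) l(3) r(3)] vbracket_diff_right[OF r(3) l(3) r(3)]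
      by (simp add: algebra_simps)
    have 2: "vbracket (\<rho> u) (\<sigma> v - \<rho> v) = vbracket (\<rho> u) (\<sigma> v) - vbracket (\<rho> u) (\<rho> v)" for u v
      using vbracket_diff_right[OF r(3) l(3) r(3)] by blast
    have "curv \<rho> x y - curv \<sigma> x y -
        (vbracket (\<rho> x) (\<sigma> y - \<rho> y) - vbracket (\<rho> y) (\<sigma> x - \<rho> x) - (\<sigma> (lbr g x y) - \<rho> (lbr g x y))) =
        vbracket (\<sigma> x - \<rho> x) (\<sigma> y - \<rho> y)"
      unfolding 1 2 curv_def
      using vbracket_swap[of "\<rho> y" "\<sigma> x"] vbracket_swap[of "\<rho> y" "\<rho> x"]
      by (simp add: algebra_simps)
    also have "\<dots> \<in> gI" using gZ_right[OF gZ_gF0[OF eq] eq] .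
    finally show "curv \<rho> x y - curv \<sigma> x y -
        (vbracket (\<rho> x) (\<sigma> y - \<rho> y) - vbracket (\<rho> y) (\<sigma> x - \<rho> x) - (\<sigma> (lbr g x y) - \<rho> (lbr g x y))) \<in> gI" .
  qed
  ultimately show ?thesis
    unfolding ce_exact_def by (intro conjI exI[of _ \<beta>]) (auto elim!: length_2_cases simp flip: One_nat_def)
qed

lemma eta_at_rep: "rep (eta_at \<eta> m [x, y]) (curv \<rho> x y)"
  using \<eta>_rep by (simp add: eta_at_def)

lemma ce_cocycle_eta: "ce_cocycle g (scl A) (center_in M F m A) act 2 (eta_at \<eta> m)"
  by (rule ce_cocycle_curv[OF action vanishing _ eta_at_rep curv_gZ]) (simp add: gI_gF0[OF gI_0])

end

section \<open>Comparison of algebroids and of equivalent actions\<close>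

text \<open>Describes the canonical map between the two kernels: it keeps the germ and exchanges the
  vector. The description is unique because equal classes mean congruent germs, hence equal
  vectors.\<close>

lemma (in minimal_algebroid) isotropy_transport_rep:
  assumes "isotropy_ident M F m B w = iso_class X" and X: "X \<in> gF0"
  shows "rep (isotropy_transport M F m B A w) X"
proof -
  obtain v where v: "rep v X" using rep_exists X gF0_gF by blast
  have "isotropy_transport M F m B A w = v"
    unfolding isotropy_transport_def assms(1)
  proof (rule the_equality)
    show "v \<in> anchor_kernel M m A \<and> isotropy_ident M F m A v = iso_class X"
      unfolding anchor_kernel_eq using v X isotropy_ident_eq by blast
    fix u assume u: "u \<in> anchor_kernel M m A \<and> isotropy_ident M F m A u = iso_class X"
    then obtain Y where Y: "Y \<in> gF0" "rep u Y" unfolding anchor_kernel_eq by blast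
    then have "iso_class Y = iso_class X" using u isotropy_ident_eq by simp
    then show "u = v" using iso_class_eq_iff Y rep_unique v by blast
  qed
  then show ?thesis using v by simp
qed

lemma fixed_pointI:
  assumes "base_space M" and "lie_algebra g" and "singular_foliation M F" and "m \<in> pts M"
    and "fixed_point_data M g F m A \<rho> \<eta> A'"
  shows "fixed_point M F m A g \<rho> \<eta> A'"
  using assms unfolding fixed_point_data_def base_space_def by unfold_locales auto

context fixed_point
begin

text \<open>Equivalence puts the difference into \<open>F\<close>, and it vanishes at
  \<open>m\<close> because both actions do.\<close>

lemma equivalent_actions_gF0:
  assumes "equivalent_actions M F g \<rho> \<sigma>" and "\<And>x. vanishes_at m (\<sigma> x)"
  shows "\<sigma> x - \<rho> x \<in> gF0"
proof -
  obtain \<phi> where \<phi>: "\<phi> x \<in> F (pts M)" "\<rho> x - \<sigma> x = \<phi> x"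
    using assms(1) by (auto simp: equivalent_actions_def equivalent_via_def)
  have "vres (pts M) (\<phi> x) \<in> F (pts M)"
    using \<phi>(1) vres_self[OF F_vfields[OF _ \<phi>(1)]] by simp
  then have "- \<phi> x \<in> gF" using gF_I[OF nbhd_pts] gF_uminus by blast
  then have "\<sigma> x - \<rho> x \<in> gF" by (simp flip: \<phi>(2))
  moreover have "vanishes_at m (\<sigma> x - \<rho> x)"
    using assms(2)[of x] vanishing[of x] by (simp add: vanishes_at_def)
  ultimately show ?thesis by (rule gF0_I)
qed

text \<open>A central class consists of fields vanishing at \<open>m\<close>, so the second action
  inherits the fixed point from \<rho>; this covers the strict action to which \<rho> is
  compared.\<close>

lemma centrally_equivalent_gZ:
  assumes "centrally_equivalent_at M F g m \<rho> \<sigma>"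
  shows "\<sigma> x - \<rho> x \<in> gZ" and "vanishes_at m (\<sigma> x)"
proof -
  obtain \<phi> where \<phi>: "\<rho> x - \<sigma> x = \<phi> x"
    and c: "isotropy_class M F m (pts M) (\<phi> x) \<in> isotropy_center M F m"
    using assms by (auto simp: centrally_equivalent_at_def equivalent_via_def)
  have "\<sigma> x - \<rho> x = vscale (- 1) (\<phi> x)" by (simp add: vscale_minus1 flip: \<phi>)
  then show "\<sigma> x - \<rho> x \<in> gZ" using isotropy_center_class(1)[OF c] gZ_vscale by simp
  have "\<sigma> x = \<rho> x - \<phi> x" by (simp flip: \<phi>)
  then show "vanishes_at m (\<sigma> x)"
    using isotropy_center_class(2)[OF c] vanishing[of x] by (simp add: vanishes_at_def)
qed

end

theorem proposition4p4:
  fixes M :: "('m, 'k::real_normed_field) base"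
    and g :: "('k, 'g::ab_group_add) lie_alg"
    and F :: "'m set \<Rightarrow> ('m, 'k) vfield set"
    and m :: 'm
    and A :: "('m, 'k, 'v::ab_group_add) algebroid"
    and \<rho> :: "'g \<Rightarrow> ('m, 'k) vfield"
    and \<eta> :: "'g \<Rightarrow> 'g \<Rightarrow> 'm \<Rightarrow> 'v"
    and A' :: "('m, 'k, 'g \<times> 'v) algebroid"
  assumes "base_space M" and "lie_algebra g" and "singular_foliation M F" and "m \<in> pts M"
    and "fixed_point_data M g F m A \<rho> \<eta> A'"
  shows
    "let Z = center_in M F m A; act = fibre_action M m A A' in
      ((\<forall>x. \<forall>z\<in>Z. act x z \<in> Z) \<and> lie_module g (scl A) Z act \<and>
       (\<forall>(B :: ('m, 'k, 'w::ab_group_add) algebroid) \<rho>\<^sub>B \<eta>\<^sub>B B'.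
          fixed_point_data M g F m B \<rho>\<^sub>B \<eta>\<^sub>B B' \<and> equivalent_actions M F g \<rho> \<rho>\<^sub>B \<longrightarrow>
          lie_module_iso (scl B) (center_in M F m B) (fibre_action M m B B') (scl A) Z act
            (isotropy_transport M F m B A))) \<and>
      ce_cocycle g (scl A) Z act 2 (eta_at \<eta> m) \<and>
      (\<forall>(B :: ('m, 'k, 'w) algebroid) \<rho>\<^sub>B \<eta>\<^sub>B B'.
          fixed_point_data M g F m B \<rho>\<^sub>B \<eta>\<^sub>B B' \<and> centrally_equivalent_at M F g m \<rho> \<rho>\<^sub>B \<longrightarrow>
          ce_cohomologous g (scl A) Z act 2
            (eta_at \<eta> m) (isotropy_transport M F m B A \<circ> eta_at \<eta>\<^sub>B m)) \<and>
      (\<forall>\<rho>\<^sub>0. strict_symmetry_action M F g \<rho>\<^sub>0 \<and> centrally_equivalent_at M F g m \<rho> \<rho>\<^sub>0 \<longrightarrow>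
          ce_exact g (scl A) Z act 2 (eta_at \<eta> m))"
proof -
  interpret A: fixed_point M F m A g \<rho> \<eta> A' by (rule fixed_pointI[OF assms])
  let ?Z = "center_in M F m A" and ?act = "fibre_action M m A A'"
  \<comment> \<open>Both interpretations share \<open>M\<close>, \<open>F\<close> and
    \<open>m\<close>, so their germ sets coincide and a germ represented in \<open>B\<close> can be
    handed over to \<open>A\<close> as it stands.\<close>
  have transport: "A.rep (isotropy_transport M F m B A w) X"
    if B: "fixed_point_data M g F m B \<rho>\<^sub>B \<eta>\<^sub>B B'" and w: "minimal_algebroid.rep M m B w X" "X \<in> A.gF0"
    for B :: "('m, 'k, 'w) algebroid" and \<rho>\<^sub>B \<eta>\<^sub>B B' w X
  proof -
    interpret B: fixed_point M F m B g \<rho>\<^sub>B \<eta>\<^sub>B B' by (rule fixed_pointI[OF assms(1-4) B])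
    show ?thesis by (rule A.isotropy_transport_rep[OF B.isotropy_ident_eq[OF w] w(2)])
  qed
  have iso: "lie_module_iso (scl B) (center_in M F m B) (fibre_action M m B B') (scl A) ?Z ?act
      (isotropy_transport M F m B A)"
    if B: "fixed_point_data M g F m B \<rho>\<^sub>B \<eta>\<^sub>B B'" and eq: "equivalent_actions M F g \<rho> \<rho>\<^sub>B"
    for B :: "('m, 'k, 'w) algebroid" and \<rho>\<^sub>B \<eta>\<^sub>B B'
  proof -
    interpret B: fixed_point M F m B g \<rho>\<^sub>B \<eta>\<^sub>B B' by (rule fixed_pointI[OF assms(1-4) B])
    let ?T = "isotropy_transport M F m B A"
    have T: "A.rep (?T w) X" if "B.rep w X" "X \<in> A.gZ" for w X
      using transport[OF B that(1)] that(2) A.gZ_gF0 by blast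
    have Z: "\<exists>X. B.rep z X \<and> X \<in> A.gZ" if "z \<in> center_in M F m B" for z
      using that B.center_in_eq by blast
    show ?thesis
      unfolding lie_module_iso_def bij_betw_def
    proof (intro conjI ballI allI inj_onI equalityI subsetI)
      fix z z' assume "z \<in> center_in M F m B" "z' \<in> center_in M F m B"
      then obtain X X' where X: "B.rep z X" "X \<in> A.gZ" and X': "B.rep z' X'" "X' \<in> A.gZ"
        using Z by blast
      show "?T (z + z') = ?T z + ?T z'"
        using A.rep_unique[OF T[OF B.rep_add[OF X(1) X'(1)]] A.rep_add[OF T[OF X] T[OF X']]]
          A.gZ_add[OF X(2) X'(2)] A.gI_0 by simp
      show "?T z = ?T z' \<Longrightarrow> z = z'"
        using A.rep_eq_iff[OF T[OF X] T[OF X']] B.rep_eq_iff[OF X(1) X'(1)] by simp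
    next
      fix z c x assume "z \<in> center_in M F m B"
      then obtain X where X: "B.rep z X" "X \<in> A.gZ" using Z by blast
      show "?T (scl B c z) = scl A c (?T z)"
        using A.rep_unique[OF T[OF B.rep_vscale[OF X(1)]] A.rep_vscale[OF T[OF X]]]
          A.gZ_vscale[OF X(2)] A.gI_0 by simp
      show "?T (fibre_action M m B B' x z) = ?act x (?T z)"
      proof (rule A.rep_unique[OF T[OF B.act_rep[OF X(1)] A.gN_gZ[OF B.\<rho>_gN X(2)]] A.act_rep[OF T[OF X]]])
        \<comment> \<open>The two actions on X differ by a bracket of an element of
          \<open>gF0\<close> with a central germ; plain equivalence is enough here.\<close>
        have "vbracket (\<rho>\<^sub>B x - \<rho> x) X \<in> A.gI"
          using A.gZ_right[OF A.equivalent_actions_gF0[OF eq B.vanishing] X(2)] .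
        moreover have "A.germ_eq (vbracket (\<rho>\<^sub>B x - \<rho> x) X) (vbracket (\<rho>\<^sub>B x) X - vbracket (\<rho> x) X)"
          using A.germ_vbracket_diff_left A.gN_gV A.\<rho>_gN B.\<rho>_gN X(2) A.gF_gV A.gF0_gF A.gZ_gF0
          by blast
        ultimately show "vbracket (\<rho>\<^sub>B x) X - vbracket (\<rho> x) X \<in> A.gI"
          using A.germs_cong by blast
      qed
    next
      fix v assume "v \<in> ?T ` center_in M F m B"
      then show "v \<in> ?Z" using Z T A.center_in_I by blast
    next
      fix v assume "v \<in> ?Z"
      then obtain X where X: "A.rep v X" "X \<in> A.gZ" using A.center_in_eq by blast
      \<comment> \<open>Surjectivity: the germ behind \<open>v\<close> lies in \<open>F\<close>, so
        \<open>B\<close> has a vector for it too.\<close>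
      then obtain w where w: "B.rep w X" using B.rep_exists A.rep_gF by blast
      have "?T w = v" using A.rep_unique[OF T[OF w X(2)] X(1)] A.gI_0 by simp
      then show "v \<in> ?T ` center_in M F m B" using B.center_in_I[OF w X(2)] by blast
    qed
  qed
  have cohomologous: "ce_cohomologous g (scl A) ?Z ?act 2
      (eta_at \<eta> m) (isotropy_transport M F m B A \<circ> eta_at \<eta>\<^sub>B m)"
    if B: "fixed_point_data M g F m B \<rho>\<^sub>B \<eta>\<^sub>B B'" and eq: "centrally_equivalent_at M F g m \<rho> \<rho>\<^sub>B"
    for B :: "('m, 'k, 'w) algebroid" and \<rho>\<^sub>B \<eta>\<^sub>B B'
  proof -
    interpret B: fixed_point M F m B g \<rho>\<^sub>B \<eta>\<^sub>B B' by (rule fixed_pointI[OF assms(1-4) B])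
    \<comment> \<open>Centrality is a property of germs of \<open>F\<close>, so the assumption on
      the curvature lift of \<open>B\<close> can be used over \<open>A\<close>.\<close>
    have Zc: "A.curv \<rho>\<^sub>B x y \<in> A.gZ" for x y by (rule B.curv_gZ)
    have \<omega>: "A.rep ((isotropy_transport M F m B A \<circ> eta_at \<eta>\<^sub>B m) [x, y]) (A.curv \<rho>\<^sub>B x y)" for x y
      using transport[OF B B.eta_at_rep A.gZ_gF0[OF Zc]] by simp
    note gZ = A.centrally_equivalent_gZ(1)[OF eq]
    show ?thesis
      unfolding ce_cohomologous_def
      using A.ce_cocycle_eta A.ce_cocycle_curv[OF B.action B.vanishing A.gZ_gF0[OF gZ] \<omega> Zc]
        A.ce_exact_curv_diff[OF B.action gZ A.eta_at_rep \<omega>]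
      by blast
  qed
  have exact: "ce_exact g (scl A) ?Z ?act 2 (eta_at \<eta> m)"
    if \<sigma>: "strict_symmetry_action M F g \<rho>\<^sub>0" and eq: "centrally_equivalent_at M F g m \<rho> \<rho>\<^sub>0" for \<rho>\<^sub>0
  proof -
    have weak: "weak_symmetry_action M F g \<rho>\<^sub>0" and "A.curv \<rho>\<^sub>0 x y = 0" for x y
      using \<sigma> by (simp_all add: strict_symmetry_action_def A.curv_def)
    \<comment> \<open>A strict action has zero curvature, which the zero cochain represents;
      comparing the curvature of \<rho> with it exhibits the class of \<eta> at \<open>m\<close> as
      a coboundary.\<close>
    then show ?thesis
      using A.ce_exact_curv_diff[OF weak A.centrally_equivalent_gZ(1)[OF eq] A.eta_at_rep, of "\<lambda>_. 0"] A.rep_0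
      by simp
  qed
  show ?thesis
    unfolding Let_def
    using A.act_center A.lie_module_center A.ce_cocycle_eta iso cohomologous exact by blast
qed

end
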